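(* Let $K$ be a number field, $n>2$ an integer and $t$ a positive integer with $t\mid n$. Then there exists an extension $L/K$ of degree $n$ with ascending index $t_K(L)=t$.
   Context: For a finite extension $L/K$ (inside a fixed algebraic closure), the ascending index $t_K(L)=[F:K]$, where $F$ is the unique subfield of $L$ that is Galois over $K$ of maximum possible degree. *)

theory Defs
  imports Complex_Main "HOL-Algebra.Embedded_Algebras" "HOL-Library.FuncSet"
begin

text \<open>The complex numbers as a HOL-Algebra ring; they serve as the fixed
  algebraically closed field containing every number field.\<close>
definition C_ring :: "complex ring"
  where "C_ring = \<lparr>carrier = UNIV, mult = (*), one = 1, zero = 0, add = (+)\<rparr>"

definition fin_ext :: "complex set \<Rightarrow> complex set \<Rightarrow> bool"
  where "fin_ext K L \<longleftrightarrow> subfield K C_ring \<and> subfield L C_ring \<and> K \<subseteq> L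
                         \<and> ring.finite_dimension C_ring K L"

definition ext_degree :: "complex set \<Rightarrow> complex set \<Rightarrow> nat"
  where "ext_degree K L = ring.dim C_ring K L"

definition number_field :: "complex set \<Rightarrow> bool"
  where "number_field K \<longleftrightarrow> fin_ext \<rat> K"

definition Aut_over :: "complex set \<Rightarrow> complex set \<Rightarrow> (complex \<Rightarrow> complex) set"
  where "Aut_over K F = {\<sigma> \<in> F \<rightarrow>\<^sub>E F. bij_betw \<sigma> F F
           \<and> (\<forall>x\<in>F. \<forall>y\<in>F. \<sigma> (x + y) = \<sigma> x + \<sigma> y \<and> \<sigma> (x * y) = \<sigma> x * \<sigma> y)
           \<and> \<sigma> 1 = 1 \<and> (\<forall>k\<in>K. \<sigma> k = k)}"

text \<open>Galois extension (Dummit--Foote): finite extension with |Aut(F/K)| = [F:K].\<close>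
definition galois_ext :: "complex set \<Rightarrow> complex set \<Rightarrow> bool"
  where "galois_ext K F \<longleftrightarrow> fin_ext K F \<and> card (Aut_over K F) = ext_degree K F"

definition ascending_index :: "complex set \<Rightarrow> complex set \<Rightarrow> nat"
  where "ascending_index K L = Max {ext_degree K F | F. K \<subseteq> F \<and> F \<subseteq> L \<and> galois_ext K F}"

end

theory Submission
  imports Defs
    "HOL-Computational_Algebra.Polynomial"
    "HOL-Computational_Algebra.Fundamental_Theorem_Algebra"
    "HOL-Computational_Algebra.Primes"
    "HOL-Number_Theory.Residue_Primitive_Roots"
begin

text \<open>Write \<open>n = t m\<close>. There is a cyclic extension \<open>F/K\<close> of degree \<open>t\<close> inside \<open>K(\<zeta>\<^sub>l)\<close>, for a prime
  \<open>l \<equiv> 1 (mod t)\<close> such that \<open>l\<close> is a uniformiser for some discrete valuation of \<open>K\<close>: this makes \<open>K(\<zeta>\<^sub>l)/K\<close> cyclic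
  of degree \<open>l - 1\<close>. Above \<open>F\<close> one puts an extension \<open>L/F\<close> of degree \<open>m\<close> such that every subfield of \<open>L\<close> that is
  Galois over \<open>K\<close> lies in \<open>F\<close>. For \<open>m \<ge> 3\<close> take a polynomial over \<open>F\<close> with doubly transitive Galois group, so that \<open>L/F\<close>
  has no proper intermediate field and is not normal; for \<open>m = 2\<close>, where \<open>t \<ge> 2\<close>, take \<open>L = F(\<surd>\<delta>)\<close> such that
  \<open>\<delta>\<close> has a conjugate over \<open>K\<close> that is not a square in \<open>L\<close>.

  All irreducibility statements come from Eisenstein's criterion at discrete valuations with a rational prime
  as uniformiser. Such a valuation exists for infinitely many primes: if \<open>F = \<rat>(\<theta>)\<close> and the minimal
  polynomial of \<open>\<theta>\<close> has a simple root modulo \<open>l\<close>, Hensel's lemma embeds \<open>F\<close> into the \<open>l\<close>-adic numbers. The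
  completion itself is avoided: the valuation of \<open>q(\<theta>)\<close> is read off from integers approximating \<open>\<theta>\<close>.\<close>

section \<open>Subfields of the complex numbers\<close>

text \<open>The congruence for l needs no theorem on primes in progressions: the valuation is found
  on K(z), z a primitive t-th root of unity, with residue field of l elements, and z reduces to an
  element of order t among the nonzero residues modulo l.

  Why Galois subfields are confined to F: a subfield M of L that is Galois over K is stable under
  every embedding that fixes K. If M has an element outside F which together with F generates L,
  then an embedding of L that maps F into itself must map L into itself. So each case needs an
  embedding that leaves L. For m >= 3 it can fix F and move a root of f. For m = 2 the extension L/F
  is normal, so the embedding has to move F; this forces t >= 2, which n > 2 provides. For n = 2, t
  = 1 the claim fails, since quadratic extensions are Galois.

  No Galois correspondence is used: the fixed field inside K(\<zeta>) gets an explicit basis of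
  Gaussian periods, and its automorphisms are counted directly.\<close>

abbreviation sf :: "complex set \<Rightarrow> bool"
  where "sf K \<equiv> subfield K C_ring"

lemma C_ring_simps [simp]:
  "carrier C_ring = UNIV" "monoid.mult C_ring = (*)" "one C_ring = 1" "zero C_ring = 0" "add C_ring = (+)"
  by (simp_all add: C_ring_def)

lemma C_field: "field C_ring"
proof -
  have ab: "abelian_group C_ring"
  proof (rule abelian_groupI)
    fix x assume "x \<in> carrier C_ring"
    show "\<exists>y\<in>carrier C_ring. y \<oplus>\<^bsub>C_ring\<^esub> x = \<zero>\<^bsub>C_ring\<^esub>"
      by (rule bexI[of _ "-x"]) auto
  qed (auto simp: algebra_simps)
  have cr: "cring C_ring"
    by (rule cringI[OF ab]) (auto intro!: comm_monoidI simp: algebra_simps)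
  show ?thesis
  proof (rule cring.cring_fieldI2[OF cr])
    fix a assume "a \<in> carrier C_ring" "a \<noteq> \<zero>\<^bsub>C_ring\<^esub>"
    then show "\<exists>b\<in>carrier C_ring. a \<otimes>\<^bsub>C_ring\<^esub> b = \<one>\<^bsub>C_ring\<^esub>"
      by (intro bexI[of _ "inverse a"]) auto
  qed auto
qed

interpretation C: field C_ring by (rule C_field)

lemma C_uminus [simp]: "\<ominus>\<^bsub>C_ring\<^esub> x = - x"
  using C.r_neg[of x] by (simp add: eq_neg_iff_add_eq_0 add.commute)

lemma C_inv: "x \<noteq> 0 \<Longrightarrow> inv\<^bsub>C_ring\<^esub> x = inverse x"
  by (rule C.comm_inv_char) auto

lemma sfI:
  assumes "1 \<in> K" "\<And>x y. x \<in> K \<Longrightarrow> y \<in> K \<Longrightarrow> x + y \<in> K" "\<And>x. x \<in> K \<Longrightarrow> -x \<in> K"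
    "\<And>x y. x \<in> K \<Longrightarrow> y \<in> K \<Longrightarrow> x * y \<in> K" "\<And>x. x \<in> K \<Longrightarrow> x \<noteq> 0 \<Longrightarrow> inverse x \<in> K"
  shows "sf K"
  by (rule C.subfieldI', rule C.subringI) (use assms in \<open>auto simp: C_inv\<close>)

context
  fixes K :: "complex set"
  assumes K: "sf K"
begin

lemma sf_0 [intro]: "0 \<in> K" and sf_1 [intro]: "1 \<in> K"
  and sf_uminus: "x \<in> K \<Longrightarrow> -x \<in> K"
  and sf_mult: "x \<in> K \<Longrightarrow> y \<in> K \<Longrightarrow> x * y \<in> K"
  and sf_add: "x \<in> K \<Longrightarrow> y \<in> K \<Longrightarrow> x + y \<in> K"
  using subringE[OF subfieldE(1)[OF K]] by auto

lemma sf_inverse: "x \<in> K \<Longrightarrow> inverse x \<in> K"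
  using C.subfield_m_inv[OF K, of x] by (cases "x = 0") (auto simp: C_inv)

lemma sf_diff: "x \<in> K \<Longrightarrow> y \<in> K \<Longrightarrow> x - y \<in> K"
  using sf_add[OF _ sf_uminus, of x y] by simp

lemma sf_divide: "x \<in> K \<Longrightarrow> y \<in> K \<Longrightarrow> x / y \<in> K"
  by (simp add: divide_inverse sf_inverse sf_mult)

lemma sf_power: "x \<in> K \<Longrightarrow> x ^ n \<in> K"
  by (induction n) (simp_all add: sf_mult sf_1)

lemma sf_of_nat: "of_nat n \<in> K"
  by (induction n) (simp_all add: sf_add sf_0 sf_1)

lemma sf_of_int: "of_int n \<in> K"
  by (cases n) (simp_all add: sf_of_nat sf_uminus del: of_nat_Suc)

lemma sf_numeral: "numeral n \<in> K"
  using sf_of_nat[of "numeral n"] by simp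

lemma sf_sum: "(\<And>i. i \<in> A \<Longrightarrow> f i \<in> K) \<Longrightarrow> sum f A \<in> K"
  by (induction A rule: infinite_finite_induct) (simp_all add: sf_add sf_0)

lemma sf_prod: "(\<And>i. i \<in> A \<Longrightarrow> f i \<in> K) \<Longrightarrow> prod f A \<in> K"
  by (induction A rule: infinite_finite_induct) (simp_all add: sf_mult sf_1)

lemma Rats_subset_subfield: "\<rat> \<subseteq> K"
  by (auto elim!: Rats_cases' simp: sf_of_int sf_divide)

lemmas sf_closed = sf_0 sf_1 sf_add sf_mult sf_uminus sf_diff sf_inverse sf_divide sf_power
  sf_of_nat sf_of_int sf_numeral sf_sum sf_prod

end

lemma subfield_Rats: "sf \<rat>"
  by (rule sfI) auto

section \<open>Polynomials over a subfield\<close>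

definition polys :: "complex set \<Rightarrow> complex poly set"
  where "polys K = {p. \<forall>i. coeff p i \<in> K}"

lemma polysI: "(\<And>i. coeff p i \<in> K) \<Longrightarrow> p \<in> polys K"
  by (simp add: polys_def)

lemma polysD: "p \<in> polys K \<Longrightarrow> coeff p i \<in> K"
  by (simp add: polys_def)

lemma polys_mono: "K \<subseteq> L \<Longrightarrow> polys K \<subseteq> polys L"
  by (auto simp: polys_def)

lemma pCons_in_polys_iff: "pCons a p \<in> polys K \<longleftrightarrow> a \<in> K \<and> p \<in> polys K"
  unfolding polys_def by (auto simp: coeff_pCons split: nat.splits)

context
  fixes K :: "complex set"
  assumes K: "sf K"
begin

lemma polys_0: "0 \<in> polys K" and polys_1: "1 \<in> polys K"
  and polys_add: "p \<in> polys K \<Longrightarrow> q \<in> polys K \<Longrightarrow> p + q \<in> polys K"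
  and polys_diff: "p \<in> polys K \<Longrightarrow> q \<in> polys K \<Longrightarrow> p - q \<in> polys K"
  and polys_uminus: "p \<in> polys K \<Longrightarrow> -p \<in> polys K"
  and polys_smult: "c \<in> K \<Longrightarrow> p \<in> polys K \<Longrightarrow> smult c p \<in> polys K"
  and polys_monom: "c \<in> K \<Longrightarrow> monom c n \<in> polys K"
  and polys_mult: "p \<in> polys K \<Longrightarrow> q \<in> polys K \<Longrightarrow> p * q \<in> polys K"
  by (auto simp: polys_def coeff_mult sf_closed[OF K] coeff_1)

lemma polys_const: "c \<in> K \<Longrightarrow> [:c:] \<in> polys K"
  and polys_linear: "c \<in> K \<Longrightarrow> d \<in> K \<Longrightarrow> [:c, d:] \<in> polys K"
  by (auto simp: pCons_in_polys_iff polys_0)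

lemma polys_sum: "(\<And>i. i \<in> A \<Longrightarrow> f i \<in> polys K) \<Longrightarrow> sum f A \<in> polys K"
  by (induction A rule: infinite_finite_induct) (auto simp: polys_add polys_0)

lemma polys_power: "p \<in> polys K \<Longrightarrow> p ^ n \<in> polys K"
  by (induction n) (auto simp: polys_mult polys_1)

lemma polys_pcompose: "p \<in> polys K \<Longrightarrow> q \<in> polys K \<Longrightarrow> pcompose p q \<in> polys K"
  by (induction p) (auto simp: pcompose_pCons pCons_in_polys_iff polys_add polys_mult polys_0)

lemma polys_poly: "p \<in> polys K \<Longrightarrow> x \<in> K \<Longrightarrow> poly p x \<in> K"
  by (auto simp: poly_altdef polysD intro!: sf_closed[OF K])

lemmas polys_closed = polys_0 polys_1 polys_add polys_diff polys_uminus polys_smult polys_monom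
  polys_mult polys_const polys_linear polys_sum polys_power polys_pcompose

lemma polys_divmod_ex:
  assumes "q \<in> polys K" "q \<noteq> 0" "p \<in> polys K"
  shows "\<exists>s\<in>polys K. \<exists>r\<in>polys K. p = s * q + r \<and> (r = 0 \<or> degree r < degree q)"
  using assms(3)
proof (induction "degree p" arbitrary: p rule: less_induct)
  case less
  show ?case
  proof (cases "p = 0 \<or> degree p < degree q")
    case True
    then show ?thesis using less.prems by (intro bexI[of _ 0] bexI[of _ p]) (auto simp: polys_0)
  next
    case False
    define c where "c = lead_coeff p / lead_coeff q"
    define m where "m = monom c (degree p - degree q)"
    define p' where "p' = p - m * q"
    have c: "c \<in> K" unfolding c_def using less.prems assms by (auto intro!: sf_closed[OF K] polysD)
    have m: "m \<in> polys K" unfolding m_def by (rule polys_monom[OF c])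
    have p': "p' \<in> polys K" unfolding p'_def using m less.prems assms by (auto intro!: polys_closed)
    have c0: "c \<noteq> 0" using False assms by (auto simp: c_def)
    have dm: "degree (m * q) = degree p"
      using False assms c0 by (subst degree_mult_eq) (auto simp: m_def degree_monom_eq monom_eq_0_iff)
    have lm: "coeff (m * q) (degree p) = lead_coeff p"
    proof -
      have "lead_coeff m = c" unfolding m_def by (rule lead_coeff_monom)
      then have "lead_coeff (m * q) = lead_coeff p"
        using assms(2) by (simp only: lead_coeff_mult) (simp add: c_def)
      then show ?thesis using dm by simp
    qed
    have dp': "p' = 0 \<or> degree p' < degree p"
    proof (cases "p' = 0")
      case nz: False
      have le: "degree p' \<le> degree p" unfolding p'_def by (rule degree_diff_le) (auto simp: dm)
      have "coeff p' (degree p) = 0" using lm by (simp add: p'_def)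
      then show ?thesis using le nz by (metis leading_coeff_0_iff order_le_imp_less_or_eq)
    qed auto
    show ?thesis
    proof (cases "p' = 0")
      case True
      then show ?thesis using m by (intro bexI[of _ m] bexI[of _ 0]) (auto simp: p'_def polys_0)
    next
      case nz: False
      with dp' have "degree p' < degree p" by auto
      from less.hyps[OF this p'] obtain s r where sr: "s \<in> polys K" "r \<in> polys K"
        "p' = s * q + r" "r = 0 \<or> degree r < degree q" by blast
      have "p = (s + m) * q + r" using sr(3) by (simp add: p'_def algebra_simps)
      then show ?thesis using sr m by (intro bexI[of _ "s + m"] bexI[of _ r]) (auto intro: polys_add)
    qed
  qed
qed

text \<open>\<open>div\<close> and \<open>mod\<close> are computed over the complex numbers. A
  division carried out with coefficients in \<open>K\<close> is also a division there, and quotient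
  and remainder are unique.\<close>

lemma polys_divmod:
  assumes "p \<in> polys K" "q \<in> polys K"
  shows "p div q \<in> polys K" "p mod q \<in> polys K"
proof -
  have "p div q \<in> polys K \<and> p mod q \<in> polys K"
  proof (cases "q = 0")
    case False
    from polys_divmod_ex[OF assms(2) False assms(1)] obtain s r where sr: "s \<in> polys K" "r \<in> polys K"
      "p = s * q + r" "r = 0 \<or> degree r < degree q" by blast
    have rd: "r div q = 0" "r mod q = r"
      using sr(4) by (auto simp: div_poly_less mod_poly_less)
    have "p div q = s" "p mod q = r" unfolding sr(3) using False rd by auto
    with sr show ?thesis by auto
  qed (use assms in \<open>auto simp: polys_0\<close>)
  then show "p div q \<in> polys K" "p mod q \<in> polys K" by auto
qed

lemma polys_dvdE:
  assumes "p \<in> polys K" "q \<in> polys K" "q dvd p"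
  obtains s where "s \<in> polys K" "p = q * s"
  using assms polys_divmod(1)[OF assms(1,2)] by (metis dvd_mult_div_cancel)

text \<open>A nonzero combination of least degree works. It is sought among combinations over
  \<open>K\<close>, since a gcd taken over the complex numbers would not show that the cofactors lie
  in \<open>polys K\<close>.\<close>

lemma polys_bezout:
  assumes "p \<in> polys K" "q \<in> polys K" "q \<noteq> 0"
  obtains u v where "u \<in> polys K" "v \<in> polys K" "u * p + v * q dvd p" "u * p + v * q dvd q"
    "u * p + v * q \<noteq> 0"
proof -
  define I where "I = {u * p + v * q | u v. u \<in> polys K \<and> v \<in> polys K}"
  have q: "q \<in> I" unfolding I_def using polys_0 polys_1 by force
  have p: "p \<in> I" unfolding I_def using polys_0 polys_1 by force
  obtain g where g: "g \<in> I" "g \<noteq> 0" and gmin: "\<And>h. h \<in> I \<Longrightarrow> h \<noteq> 0 \<Longrightarrow> degree g \<le> degree h"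
    using q assms(3) ex_has_least_nat[of "\<lambda>h. h \<in> I \<and> h \<noteq> 0" q degree] by blast
  from g obtain u v where uv: "u \<in> polys K" "v \<in> polys K" "g = u * p + v * q" unfolding I_def by auto
  have gK: "g \<in> polys K" using uv assms by (auto intro!: polys_closed)
  have dv: "g dvd h" if "h \<in> I" for h
  proof (rule ccontr)
    assume n: "\<not> g dvd h"
    from that obtain a b where ab: "a \<in> polys K" "b \<in> polys K" "h = a * p + b * q" unfolding I_def by auto
    have hK: "h \<in> polys K" using ab assms by (auto intro!: polys_closed)
    have "h mod g = (a - (h div g) * u) * p + (b - (h div g) * v) * q"
      unfolding minus_div_mult_eq_mod[symmetric] using uv(3) ab(3) by (simp add: algebra_simps)
    moreover have "h div g \<in> polys K" by (rule polys_divmod[OF hK gK])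
    ultimately have "h mod g \<in> I" unfolding I_def using ab uv by (blast intro!: polys_closed)
    moreover have "h mod g \<noteq> 0" using n by (simp add: mod_eq_0_iff_dvd)
    ultimately have "degree g \<le> degree (h mod g)" by (rule gmin)
    then show False using degree_mod_less[OF g(2), of h] \<open>h mod g \<noteq> 0\<close> by auto
  qed
  from that[OF uv(1,2)] dv[OF p] dv[OF q] g(2) uv(3) show ?thesis by auto
qed

end

text \<open>Monic, so that an algebraic element has exactly one minimal polynomial
  (\<open>irr_unique\<close>). Only factors over \<open>K\<close> count: over the complex numbers
  all irreducible polynomials are linear.\<close>

definition irr :: "complex set \<Rightarrow> complex poly \<Rightarrow> bool"
  where "irr K p \<longleftrightarrow> p \<in> polys K \<and> lead_coeff p = 1 \<and> degree p > 0
    \<and> (\<forall>q\<in>polys K. \<forall>r\<in>polys K. p = q * r \<longrightarrow> degree q = 0 \<or> degree r = 0)"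

lemma irrD: "irr K p \<Longrightarrow> p \<in> polys K" "irr K p \<Longrightarrow> lead_coeff p = 1" "irr K p \<Longrightarrow> degree p > 0"
  "irr K p \<Longrightarrow> p \<noteq> 0"
  by (auto simp: irr_def)

text \<open>The leading coefficients of two factors of a monic polynomial are inverse to each other,
  so both factors can be made monic without changing the product.\<close>

lemma irrI:
  assumes K: "sf K" and p: "p \<in> polys K" "lead_coeff p = 1" "degree p > 0"
    and *: "\<And>q r. q \<in> polys K \<Longrightarrow> r \<in> polys K \<Longrightarrow> p = q * r \<Longrightarrow> lead_coeff q = 1 \<Longrightarrow> lead_coeff r = 1
      \<Longrightarrow> degree q > 0 \<Longrightarrow> degree r > 0 \<Longrightarrow> False"
  shows "irr K p"
  unfolding irr_def
proof (intro conjI ballI impI)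
  fix q r assume qr: "q \<in> polys K" "r \<in> polys K" "p = q * r"
  show "degree q = 0 \<or> degree r = 0"
  proof (rule ccontr)
    assume n: "\<not> (degree q = 0 \<or> degree r = 0)"
    have l: "lead_coeff q * lead_coeff r = 1" using p(2) qr(3) by (simp add: lead_coeff_mult)
    define q' r' where "q' = smult (inverse (lead_coeff q)) q" and "r' = smult (inverse (lead_coeff r)) r"
    have nz: "lead_coeff q \<noteq> 0" "lead_coeff r \<noteq> 0" using l by auto
    have "p = q' * r'" using l nz qr(3) by (simp add: q'_def r'_def field_simps)
    then show False using *[of q' r'] qr n nz K
      by (auto simp: q'_def r'_def intro!: polys_smult sf_inverse polysD)
  qed
qed (use p in auto)

lemma degree_0_root: "degree p = 0 \<Longrightarrow> poly p a = 0 \<Longrightarrow> p = (0 :: complex poly)"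
  by (auto elim: degree_eq_zeroE)

text \<open>The combination of \<open>p\<close> and \<open>q\<close> given by
  \<open>polys_bezout\<close> vanishes at \<open>a\<close>, hence is a nonconstant divisor of
  \<open>p\<close>, and irreducibility leaves only \<open>p\<close> up to a constant.\<close>

lemma irr_root_dvd:
  assumes K: "sf K" and p: "irr K p" "poly p a = 0" and q: "q \<in> polys K" "poly q a = 0"
  shows "p dvd q"
proof -
  from polys_bezout[OF K q(1) irrD(1,4)[OF p(1)]] p(1) obtain u v where
    uv: "u \<in> polys K" "v \<in> polys K" "u * q + v * p dvd q" "u * q + v * p dvd p" "u * q + v * p \<noteq> 0" by metis
  define g where "g = u * q + v * p"
  have gK: "g \<in> polys K" unfolding g_def using uv q irrD(1)[OF p(1)] by (auto intro!: polys_closed[OF K])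
  have ga: "poly g a = 0" using p q by (simp add: g_def)
  have "degree g \<noteq> 0"
    using degree_0_root[OF _ ga] uv(5) unfolding g_def by blast
  from uv(4) obtain s where s: "s \<in> polys K" "p = g * s"
    using polys_dvdE[OF K irrD(1)[OF p(1)] gK] by (auto simp: g_def)
  with p(1) gK \<open>degree g \<noteq> 0\<close> have "degree s = 0" by (auto simp: irr_def)
  then obtain c where c: "s = [:c:]" by (rule degree_eq_zeroE)
  have "c \<noteq> 0" using irrD(4)[OF p(1)] s c by auto
  then have "p dvd g" using s(2) c by (simp add: smult_dvd_iff mult.commute)
  then show ?thesis using uv(3) unfolding g_def by (rule dvd_trans)
qed

section \<open>Algebraic elements and minimal polynomials\<close>

definition alg :: "complex set \<Rightarrow> complex \<Rightarrow> bool"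
  where "alg K a \<longleftrightarrow> (\<exists>p\<in>polys K. p \<noteq> 0 \<and> poly p a = 0)"

lemma minpoly_exists:
  assumes K: "sf K" and "alg K a"
  obtains p where "irr K p" "poly p a = 0"
proof -
  from assms obtain q where q: "q \<in> polys K \<and> q \<noteq> 0 \<and> poly q a = 0" by (auto simp: alg_def)
  then obtain p0 where p0: "p0 \<in> polys K" "p0 \<noteq> 0" "poly p0 a = 0"
    and min: "\<And>h. h \<in> polys K \<Longrightarrow> h \<noteq> 0 \<Longrightarrow> poly h a = 0 \<Longrightarrow> degree p0 \<le> degree h"
    using ex_has_least_nat[of "\<lambda>h. h \<in> polys K \<and> h \<noteq> 0 \<and> poly h a = 0" q degree] by blast
  define p where "p = smult (inverse (lead_coeff p0)) p0"
  have p: "p \<in> polys K" "lead_coeff p = 1" "poly p a = 0" "degree p = degree p0"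
    using p0 K by (auto simp: p_def intro!: polys_smult sf_inverse polysD)
  have "degree p \<noteq> 0"
    using degree_0_root[OF _ p(3)] p(2) by (metis coeff_0 zero_neq_one)
  have "irr K p"
  proof (rule irrI[OF K p(1,2)])
    fix q r assume qr: "q \<in> polys K" "r \<in> polys K" "p = q * r" "lead_coeff q = 1" "lead_coeff r = 1"
      "degree q > 0" "degree r > 0"
    have nz: "q \<noteq> 0" "r \<noteq> 0" using qr by auto
    have dd: "degree p0 = degree q + degree r" using p(4) qr(3) nz by (simp add: degree_mult_eq)
    from p(3) qr(3) have "poly q a = 0 \<or> poly r a = 0" by auto
    then show False using min[of q] min[of r] qr nz dd by auto
  qed (use \<open>degree p \<noteq> 0\<close> in auto)
  with p show ?thesis using that by auto
qed

lemma irr_alg: "irr K p \<Longrightarrow> poly p a = 0 \<Longrightarrow> alg K a"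
  unfolding alg_def using irrD by blast

lemma irr_unique:
  assumes "sf K" "irr K p" "poly p a = 0" "irr K q" "poly q a = 0"
  shows "p = q"
proof -
  have "p dvd q" "q dvd p" using irr_root_dvd assms irrD by blast+
  then obtain s where s: "q = p * s" by (auto simp: dvd_def)
  have nz: "p \<noteq> 0" "q \<noteq> 0" using assms irrD by auto
  have "degree q \<le> degree p" using \<open>q dvd p\<close> nz by (simp add: dvd_imp_degree_le)
  with s nz have "degree s = 0" by (auto simp: degree_mult_eq)
  then obtain c where c: "s = [:c:]" by (rule degree_eq_zeroE)
  have "lead_coeff q = lead_coeff p * lead_coeff s" unfolding s by (rule lead_coeff_mult)
  then have "c = 1" using assms irrD(2) c by auto
  with s c show ?thesis by simp
qed

lemma irr_coprime:
  assumes K: "sf K" and p: "irr K p" and q: "q \<in> polys K" "\<not> p dvd q"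
  obtains u v where "u \<in> polys K" "v \<in> polys K" "u * q + v * p = 1"
proof -
  from polys_bezout[OF K q(1) irrD(1,4)[OF p]] p obtain u v where
    uv: "u \<in> polys K" "v \<in> polys K" "u * q + v * p dvd q" "u * q + v * p dvd p" "u * q + v * p \<noteq> 0" by metis
  define g where "g = u * q + v * p"
  have gK: "g \<in> polys K" unfolding g_def using uv q irrD(1)[OF p] by (auto intro!: polys_closed[OF K])
  from uv(4) obtain s where s: "s \<in> polys K" "p = g * s"
    using polys_dvdE[OF K irrD(1)[OF p] gK] by (auto simp: g_def)
  have "degree g = 0"
  proof (rule ccontr)
    assume "degree g \<noteq> 0"
    with p s gK have "degree s = 0" by (auto simp: irr_def)
    then obtain c where c: "s = [:c:]" by (rule degree_eq_zeroE)
    have "c \<noteq> 0" using irrD(4)[OF p] s c by auto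
    then have "p dvd g" using s(2) c by (simp add: smult_dvd_iff mult.commute)
    with uv(3) q(2) show False unfolding g_def using dvd_trans by blast
  qed
  then obtain c where c: "g = [:c:]" by (rule degree_eq_zeroE)
  have c0: "c \<noteq> 0" using c uv(5) by (auto simp: g_def)
  have cK: "c \<in> K" using gK c by (auto simp: pCons_in_polys_iff)
  have "smult (inverse c) u * q + smult (inverse c) v * p = smult (inverse c) g"
    by (simp add: g_def smult_add_right)
  also have "\<dots> = 1" using c c0 by simp
  finally show ?thesis using that[of "smult (inverse c) u" "smult (inverse c) v"] uv cK
    by (auto intro!: polys_smult[OF K] sf_inverse[OF K])
qed

section \<open>Simple extensions\<close>

text \<open>The ring K[a], which is the field K(a) as soon as \<open>a\<close> is algebraic over
  \<open>K\<close> (\<open>adj_sf\<close>).\<close>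

definition adj :: "complex set \<Rightarrow> complex \<Rightarrow> complex set"
  where "adj K a = {poly p a | p. p \<in> polys K}"

lemma adjI: "p \<in> polys K \<Longrightarrow> poly p a \<in> adj K a"
  by (auto simp: adj_def)

lemma adjE: "x \<in> adj K a \<Longrightarrow> (\<And>p. p \<in> polys K \<Longrightarrow> x = poly p a \<Longrightarrow> thesis) \<Longrightarrow> thesis"
  by (auto simp: adj_def)

lemma adj_base: "sf K \<Longrightarrow> K \<subseteq> adj K a"
  using adjI[OF polys_const, of K _ a] by auto

lemma adj_gen: "sf K \<Longrightarrow> a \<in> adj K a"
  using adjI[OF polys_linear[of K 0 1], of a] by (simp add: sf_closed)

lemma adj_least: "sf L \<Longrightarrow> K \<subseteq> L \<Longrightarrow> a \<in> L \<Longrightarrow> adj K a \<subseteq> L"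
  by (auto elim!: adjE intro!: polys_poly dest: polys_mono)

lemma adj_mono: "K \<subseteq> L \<Longrightarrow> adj K a \<subseteq> adj L a"
  using polys_mono[of K L] by (auto simp: adj_def)

lemma adj_sf:
  assumes K: "sf K" and a: "alg K a"
  shows "sf (adj K a)"
proof (rule sfI)
  show "1 \<in> adj K a" using adjI[OF polys_1[OF K], of a] by simp
  fix x assume "x \<in> adj K a"
  then obtain p where p: "p \<in> polys K" "x = poly p a" by (rule adjE)
  show "-x \<in> adj K a" using adjI[OF polys_uminus[OF K p(1)], of a] p by simp
  { fix y assume "y \<in> adj K a"
    then obtain q where q: "q \<in> polys K" "y = poly q a" by (rule adjE)
    show "x + y \<in> adj K a" using adjI[OF polys_add[OF K p(1) q(1)], of a] p q by simp
    show "x * y \<in> adj K a" using adjI[OF polys_mult[OF K p(1) q(1)], of a] p q by simp }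
  { assume "x \<noteq> 0"
    obtain m where m: "irr K m" "poly m a = 0" using minpoly_exists[OF K a] .
    have "\<not> m dvd p" using p \<open>x \<noteq> 0\<close> m by (auto simp: dvd_def)
    from irr_coprime[OF K m(1) p(1) this] obtain u v where uv: "u \<in> polys K" "u * p + v * m = 1" by metis
    have "poly u a * poly p a = 1" using arg_cong[OF uv(2), of "\<lambda>p. poly p a"] m by simp
    then have "inverse x = poly u a" using p by (metis inverse_unique mult.commute)
    then show "inverse x \<in> adj K a" using uv by (simp add: adjI) }
qed

section \<open>Bases and linear dependence over a subfield\<close>

lemma line_extension_C: "u \<in> C.line_extension K a E \<longleftrightarrow> (\<exists>k\<in>K. \<exists>v\<in>E. u = k * a + v)"
  using C.line_extension_mem_iff by simp

text \<open>\<open>C.dimension\<close> grows by one line at a time. Overwriting the last coefficient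
  by 0 passes independence on to the first \<open>n\<close> elements; overwriting it by -1 shows
  that \<open>b n\<close> is not in their span.\<close>

lemma dimension_basis:
  assumes K: "sf K"
    and indep: "\<And>c. (\<And>i. i < n \<Longrightarrow> c i \<in> K) \<Longrightarrow> (\<Sum>i<n. c i * b i) = 0 \<Longrightarrow> \<forall>i<n. c i = 0"
  shows "C.dimension n K {\<Sum>i<n. c i * b i | c. \<forall>i<n. c i \<in> K}"
  using indep
proof (induction n)
  case 0
  have "{\<Sum>i<0. c i * b i | c. \<forall>i<0. c i \<in> K} = {0}" by auto
  then show ?case using C.zero_dim[of K] by simp
next
  case (Suc n)
  let ?E = "{\<Sum>i<n. c i * b i | c. \<forall>i<n. c i \<in> K}"
  have IH: "C.dimension n K ?E"
  proof (rule Suc.IH)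
    fix c assume c: "\<And>i. i < n \<Longrightarrow> c i \<in> K" "(\<Sum>i<n. c i * b i) = 0"
    have "(\<Sum>i<Suc n. (c(n := 0)) i * b i) = 0" using c(2) by simp
    moreover have "\<And>i. i < Suc n \<Longrightarrow> (c(n := 0)) i \<in> K" using c(1) sf_0[OF K] by (auto simp: less_Suc_eq)
    ultimately have *: "\<forall>i<Suc n. (c(n := 0)) i = 0" by (rule Suc.prems[rotated])
    show "\<forall>i<n. c i = 0"
    proof (intro allI impI)
      fix i assume "i < n" with *[rule_format, of i] show "c i = 0" by simp
    qed
  qed
  have nin: "b n \<notin> ?E"
  proof
    assume "b n \<in> ?E"
    then obtain c where c: "\<forall>i<n. c i \<in> K" "b n = (\<Sum>i<n. c i * b i)" by auto
    have "(\<Sum>i<Suc n. (c(n := -1)) i * b i) = 0" using c(2) by simp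
    moreover have "\<And>i. i < Suc n \<Longrightarrow> (c(n := -1)) i \<in> K"
      using c(1) sf_uminus[OF K sf_1[OF K]] by (auto simp: less_Suc_eq)
    ultimately have "\<forall>i<Suc n. (c(n := -1)) i = 0" by (rule Suc.prems[rotated])
    then show False by (auto dest: spec[of _ n])
  qed
  have "C.line_extension K (b n) ?E = {\<Sum>i<Suc n. c i * b i | c. \<forall>i<Suc n. c i \<in> K}" (is "?l = ?r")
  proof (intro equalityI subsetI)
    fix u assume "u \<in> ?l"
    then obtain k c where kc: "k \<in> K" "\<forall>i<n. c i \<in> K" "u = k * b n + (\<Sum>i<n. c i * b i)"
      by (auto simp: line_extension_C)
    then show "u \<in> ?r" by (intro CollectI exI[of _ "c(n := k)"]) (auto simp: less_Suc_eq)
  next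
    fix u assume "u \<in> ?r"
    then obtain c where "\<forall>i<Suc n. c i \<in> K" "u = (\<Sum>i<Suc n. c i * b i)" by auto
    then show "u \<in> ?l" unfolding line_extension_C by (intro bexI[of _ "c n"] bexI[of _ "\<Sum>i<n. c i * b i"]) auto
  qed
  with C.Suc_dim[OF _ nin IH] show ?case by simp
qed

lemma combine_C: "length Ks = length Us \<Longrightarrow> C.combine Ks Us = (\<Sum>i<length Us. Ks ! i * Us ! i)"
proof (induction Us arbitrary: Ks)
  case (Cons u Us)
  then obtain k Ks' where "Ks = k # Ks'" by (cases Ks) auto
  with Cons show ?case by (simp add: sum.lessThan_Suc_shift del: sum.lessThan_Suc)
qed simp

lemma dimension_dependent:
  assumes K: "sf K" and E: "C.dimension n K E" and w: "\<And>i. i \<le> n \<Longrightarrow> w i \<in> E"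
  obtains c where "\<And>i. i \<le> n \<Longrightarrow> c i \<in> K" "\<exists>i\<le>n. c i \<noteq> 0" "(\<Sum>i\<le>n. c i * w i) = 0"
proof -
  define ws where "ws = map w [0..<Suc n]"
  have "set ws \<subseteq> E" using w by (auto simp: ws_def simp del: upt_Suc)
  moreover have "length ws = Suc n" by (simp add: ws_def)
  ultimately have "C.dependent K ws" using C.independent_length_le_dimension[OF K E, of ws] by auto
  then obtain Ks where Ks: "length Ks = length ws" "C.combine Ks ws = 0" "set Ks \<subseteq> K" "set Ks \<noteq> {0}"
    using C.dependent_imp_non_trivial_combine[OF K, of ws] by auto
  have l: "length Ks = Suc n" using Ks(1) by (simp add: ws_def)
  have "(\<Sum>i<Suc n. Ks ! i * w i) = 0"
    using Ks(2) combine_C[OF Ks(1)] by (simp add: ws_def del: upt_Suc sum.lessThan_Suc)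
  then have "(\<Sum>i\<le>n. Ks ! i * w i) = 0" by (simp only: lessThan_Suc_atMost)
  moreover have "\<exists>i\<le>n. Ks ! i \<noteq> 0"
  proof (rule ccontr)
    assume "\<not> (\<exists>i\<le>n. Ks ! i \<noteq> 0)"
    then have "set Ks \<subseteq> {0}" using l by (auto simp: in_set_conv_nth less_Suc_eq_le)
    moreover have "set Ks \<noteq> {}" using l by auto
    ultimately show False using Ks(4) by (metis subset_singletonD)
  qed
  moreover have "Ks ! i \<in> K" if "i \<le> n" for i
  proof -
    have "i < length Ks" using l that by simp
    then have "Ks ! i \<in> set Ks" by (rule nth_mem)
    then show ?thesis by (rule subsetD[OF Ks(3)])
  qed
  ultimately show ?thesis using that[of "\<lambda>i. Ks ! i"] by blast
qed

section \<open>Degrees of finite extensions\<close>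

lemma fin_extI:
  assumes "sf K" "sf L" "K \<subseteq> L" "C.dimension n K L"
  shows "fin_ext K L" "ext_degree K L = n"
  using assms C.finite_dimensionI[OF assms(4)] C.dimI[OF assms(1,4)]
  by (auto simp: fin_ext_def ext_degree_def over_def)

lemma fin_extD:
  assumes "fin_ext K L"
  shows "sf K" "sf L" "K \<subseteq> L" "C.dimension (ext_degree K L) K L"
  using assms C.finite_dimensionE[of K L]
  by (auto simp: fin_ext_def ext_degree_def over_def)

lemma fin_ext_tower:
  assumes "fin_ext K F" "fin_ext F L"
  shows "fin_ext K L" "ext_degree K L = ext_degree K F * ext_degree F L"
  using fin_extI[OF _ _ _ C.telescopic_base[OF _ _ fin_extD(4)[OF assms(1)] fin_extD(4)[OF assms(2)]]]
    fin_extD(1-3)[OF assms(1)] fin_extD(1-3)[OF assms(2)] by auto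

lemma ext_degree_pos: "fin_ext K L \<Longrightarrow> ext_degree K L > 0"
  using C.dimension_zero[of K L] fin_extD[of K L] sf_1[of L]
  by (metis C_ring_simps(4) gr0I singletonD zero_neq_one)

lemma fin_ext_refl:
  assumes "sf K" shows "fin_ext K K" "ext_degree K K = 1"
  using fin_extI[OF assms assms order_refl C.dimension_one[OF assms]] by auto

lemma ext_degree_mono:
  assumes "fin_ext K M" "fin_ext K L" "M \<subseteq> L"
  shows "ext_degree K M \<le> ext_degree K L" "ext_degree K M = ext_degree K L \<Longrightarrow> M = L"
proof -
  note K = fin_extD(1)[OF assms(1)]
  obtain Vs where Vs: "C.independent K Vs" "length Vs = ext_degree K M" "C.Span K Vs = M"
    using C.exists_base[OF K fin_extD(4)[OF assms(1)]] by blast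
  have "set Vs \<subseteq> M" using C.Span_base_incl[OF K, of Vs] Vs by auto
  then have sub: "set Vs \<subseteq> L" using assms by auto
  show "ext_degree K M \<le> ext_degree K L"
    using C.independent_length_le_dimension[OF K fin_extD(4)[OF assms(2)] Vs(1) sub] Vs by simp
  assume "ext_degree K M = ext_degree K L"
  then show "M = L"
    using C.independent_length_eq_dimension[OF K fin_extD(4)[OF assms(2)] Vs(1) sub] Vs by simp
qed

lemma fin_ext_alg:
  assumes "fin_ext K L" "a \<in> L"
  shows "alg K a"
proof -
  note K = fin_extD[OF assms(1)]
  define n where "n = ext_degree K L"
  obtain c where c: "\<And>i. i \<le> n \<Longrightarrow> c i \<in> K" "\<exists>i\<le>n. c i \<noteq> 0" "(\<Sum>i\<le>n. c i * a ^ i) = 0"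
    using dimension_dependent[OF K(1,4), of "\<lambda>i. a ^ i"] sf_power[OF K(2) assms(2)] unfolding n_def by metis
  define p where "p = (\<Sum>i\<le>n. monom (c i) i)"
  have cp: "coeff p i = (if i \<le> n then c i else 0)" for i
    by (simp add: p_def coeff_sum)
  have "p \<in> polys K" using c(1) sf_0[OF K(1)] by (auto intro!: polysI simp: cp)
  moreover have "p \<noteq> 0" using c(2) cp by (metis coeff_0)
  moreover have "poly p a = 0" using c(3) by (simp add: p_def poly_sum poly_monom)
  ultimately show ?thesis by (auto simp: alg_def)
qed

lemma adj_dimension:
  assumes K: "sf K" and p: "irr K p" "poly p a = 0"
  shows "C.dimension (degree p) K (adj K a)"
proof -
  let ?n = "degree p"
  have "adj K a = {\<Sum>i<?n. c i * a ^ i | c. \<forall>i<?n. c i \<in> K}" (is "_ = ?r")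
  proof (intro equalityI subsetI)
    fix x assume "x \<in> adj K a"
    then obtain q where q: "q \<in> polys K" "x = poly q a" by (rule adjE)
    define r where "r = q mod p"
    have rK: "r \<in> polys K" unfolding r_def by (rule polys_divmod[OF K q(1) irrD(1)[OF p(1)]])
    have d: "degree r < ?n" using degree_mod_less[OF irrD(4)[OF p(1)], of q] irrD(3)[OF p(1)]
      by (auto simp: r_def)
    have "poly q a = poly (q div p * p + r) a" unfolding r_def by simp
    also have "\<dots> = poly r a" using p(2) by (simp only: poly_add poly_mult) simp
    also have "\<dots> = (\<Sum>i<?n. coeff r i * a ^ i)" using d
      unfolding poly_altdef by (intro sum.mono_neutral_left) (auto intro: coeff_eq_0)
    finally show "x \<in> ?r" using q rK by (auto intro!: exI[of _ "coeff r"] polysD)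
  next
    fix x assume "x \<in> ?r"
    then obtain c where c: "\<forall>i<?n. c i \<in> K" "x = (\<Sum>i<?n. c i * a ^ i)" by auto
    have "x = poly (\<Sum>i<?n. monom (c i) i) a" using c by (simp add: poly_sum poly_monom)
    then show "x \<in> adj K a" using c by (auto intro!: adjI polys_sum polys_monom K)
  qed
  moreover have "C.dimension ?n K ?r"
  proof (rule dimension_basis[OF K])
    fix c assume c: "\<And>i. i < ?n \<Longrightarrow> c i \<in> K" "(\<Sum>i<?n. c i * a ^ i) = 0"
    define q where "q = (\<Sum>i<?n. monom (c i) i)"
    have cq: "coeff q i = (if i < ?n then c i else 0)" for i by (simp add: q_def coeff_sum)
    have "q \<in> polys K" using c(1) sf_0[OF K] by (auto intro!: polysI simp: cq)
    moreover have "poly q a = 0" using c(2) by (simp add: q_def poly_sum poly_monom)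
    ultimately have "p dvd q" using irr_root_dvd[OF K p] by auto
    have "q = 0"
    proof (rule ccontr)
      assume "q \<noteq> 0"
      with \<open>p dvd q\<close> have "?n \<le> degree q" by (simp add: dvd_imp_degree_le)
      moreover have "coeff q (degree q) \<noteq> 0" using \<open>q \<noteq> 0\<close> by simp
      ultimately show False by (simp add: cq)
    qed
    then show "\<forall>i<?n. c i = 0" using cq by (metis coeff_0)
  qed
  ultimately show ?thesis by simp
qed

lemma adj_fin_ext:
  assumes K: "sf K" and p: "irr K p" "poly p a = 0"
  shows "fin_ext K (adj K a)" "ext_degree K (adj K a) = degree p"
  using fin_extI[OF K adj_sf[OF K irr_alg[OF p]] adj_base[OF K] adj_dimension[OF assms]] by auto

lemma irr_degree_1:
  assumes "sf K" "irr K p" "poly p a = 0" "degree p = 1" shows "a \<in> K"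
proof -
  have "adj K a = K" using adj_fin_ext[OF assms(1-3)] fin_ext_refl[OF assms(1)] assms(4) adj_base[OF assms(1), of a]
    ext_degree_mono(2)[of K K "adj K a"] by simp
  then show ?thesis using adj_gen[OF assms(1)] by metis
qed

lemma linear_irr: "sf K \<Longrightarrow> a \<in> K \<Longrightarrow> irr K [:-a, 1:]"
proof (rule irrI)
  fix q r :: "complex poly"
  assume "[:-a, 1:] = q * r" "degree q > 0" "degree r > 0"
  then have "degree [:-a, 1:] = degree q + degree r"
    by (metis degree_0 degree_mult_eq less_irrefl)
  then show False using \<open>degree q > 0\<close> \<open>degree r > 0\<close> by simp
qed (auto intro!: polys_linear sf_closed)

lemma alg_mono: "K \<subseteq> L \<Longrightarrow> alg K a \<Longrightarrow> alg L a"
  using polys_mono unfolding alg_def by blast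

section \<open>The primitive element theorem\<close>

text \<open>For c = a + s b with a suitable natural number s, the minimal polynomial of
  \<open>b\<close> over K(c) divides both q and p(c - s X), and these have only \<open>b\<close> as
  a common root. Hence \<open>b\<close>, and with it \<open>a\<close>, lies in K(c).\<close>

lemma primitive_pair:
  assumes K: "sf K" and a: "alg K a" and b: "alg K b"
  obtains c where "alg K c" "adj (adj K a) b = adj K c"
proof -
  obtain p q where p: "irr K p" "poly p a = 0" and q: "irr K q" "poly q b = 0"
    using minpoly_exists[OF K a] minpoly_exists[OF K b] by metis
  \<comment> \<open>The values of s for which a + s b = x + s y with another root y of
    \<open>q\<close>. Pairs with y = b contribute 0 through division by zero, a harmless extra
    exclusion.\<close>
  define bad where "bad = (\<lambda>(x, y). (x - a) / (b - y)) ` ({x. poly p x = 0} \<times> {y. poly q y = 0})"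
  have "finite bad" unfolding bad_def
    using irrD(4)[OF p(1)] irrD(4)[OF q(1)] by (intro finite_imageI finite_cartesian_product poly_roots_finite)
  moreover have "infinite (range (of_nat :: nat \<Rightarrow> complex))" by (simp add: infinite_UNIV_char_0 inj_of_nat finite_image_iff)
  ultimately obtain s where s: "(of_nat s :: complex) \<notin> bad" by (meson finite_subset image_subsetI)
  define c where "c = a + of_nat s * b"
  have La: "sf (adj K a)" by (rule adj_sf[OF K a])
  have bL: "alg (adj K a) b" by (rule alg_mono[OF adj_base[OF K] b])
  define L where "L = adj (adj K a) b"
  have L: "sf L" unfolding L_def by (rule adj_sf[OF La bL])
  have KL: "adj K a \<subseteq> L" "K \<subseteq> L" "a \<in> L" "b \<in> L"
    unfolding L_def using adj_base[OF La] adj_base[OF K] adj_gen[OF K] adj_gen[OF La] by blast+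
  have "c \<in> L" unfolding c_def by (intro sf_closed[OF L] KL)
  have fin: "fin_ext K L" unfolding L_def
    by (rule fin_ext_tower(1)[OF adj_fin_ext(1)[OF K p]], rule minpoly_exists[OF La bL], rule adj_fin_ext(1)[OF La])
  have c: "alg K c" by (rule fin_ext_alg[OF fin \<open>c \<in> L\<close>])
  define M where "M = adj K c"
  have M: "sf M" "K \<subseteq> M" "c \<in> M" unfolding M_def using adj_sf[OF K c] adj_base[OF K] adj_gen[OF K] by blast+
  obtain r where r: "irr M r" "poly r b = 0" using minpoly_exists[OF M(1) alg_mono[OF M(2) b]] .
  define p' where "p' = pcompose p [:c, - of_nat s:]"
  have p'M: "p' \<in> polys M" unfolding p'_def
    using irrD(1)[OF p(1)] polys_mono[OF M(2)] M
    by (intro polys_pcompose polys_linear sf_closed) auto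
  have "poly p' b = 0" using p(2) by (simp add: p'_def poly_pcompose c_def)
  then have "r dvd p'" by (rule irr_root_dvd[OF M(1) r p'M])
  have "r dvd q" using irr_root_dvd[OF M(1) r _ q(2)] irrD(1)[OF q(1)] polys_mono[OF M(2)] by auto
  have only: "y = b" if "poly r y = 0" for y
  proof (rule ccontr)
    assume "y \<noteq> b"
    have qy: "poly q y = 0" using \<open>r dvd q\<close> that by (auto elim!: dvdE)
    have "poly p' y = 0" using \<open>r dvd p'\<close> that by (auto elim!: dvdE)
    then have "poly p (c - of_nat s * y) = 0" by (simp add: p'_def poly_pcompose mult.commute)
    then have "(c - of_nat s * y - a) / (b - y) \<in> bad" using qy unfolding bad_def by force
    moreover have "(c - of_nat s * y - a) / (b - y) = of_nat s" using \<open>y \<noteq> b\<close> by (simp add: c_def field_simps)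
    ultimately show False using s by simp
  qed
  \<comment> \<open>Separability is bypassed: \<open>r\<close> has the single root \<open>b\<close>,
    so it is (X - b)^n, and its coefficient at n - 1 is -n b, from which n can be divided
    out.\<close>
  have "b \<in> M"
  proof -
    define n where "n = degree r"
    have n: "n > 0" using irrD(3)[OF r(1)] by (simp add: n_def)
    have k: "smult (lead_coeff r) (\<Prod>x\<in>{x. poly r x = 0}. [:-x, 1:] ^ Polynomial.order x r) = r"
      by (rule complex_poly_decompose)
    have "{x. poly r x = 0} = {b}" using only r(2) by blast
    with k have rr: "r = [:-b, 1:] ^ Polynomial.order b r" using irrD(2)[OF r(1)] by simp
    then have "degree r = Polynomial.order b r" by (metis degree_linear_power)
    with rr have "r = [:-b, 1:] ^ n" by (simp add: n_def)
    then have "coeff r (n - 1) = of_nat n * (-b)" using n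
      using coeff_linear_poly_power[of "n - 1" n "-b" 1] binomial_symmetric[of "n - 1" n] by simp
    then have "of_nat n * (-b) \<in> M" using polysD[OF irrD(1)[OF r(1)], of "n - 1"] by simp
    then have "- (of_nat n * (-b) / of_nat n) \<in> M"
      by (rule sf_uminus[OF M(1) sf_divide[OF M(1) _ sf_of_nat[OF M(1)]]])
    then show ?thesis using n by simp
  qed
  then have "c - of_nat s * b \<in> M" using M by (auto intro!: sf_closed)
  then have "a \<in> M" by (simp add: c_def)
  have "L = M"
  proof
    show "L \<subseteq> M" unfolding L_def
      by (intro adj_least M(1) \<open>b \<in> M\<close> \<open>a \<in> M\<close> M(2))
    show "M \<subseteq> L" unfolding M_def by (intro adj_least L KL \<open>c \<in> L\<close>)
  qed
  with c that show ?thesis by (simp add: L_def M_def)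
qed

text \<open>Take \<open>c\<close> in \<open>L\<close> with K(c) of largest degree. By
  \<open>primitive_pair\<close>, adjoining a further element of \<open>L\<close> gives again a
  simple extension, which cannot be larger.\<close>

theorem primitive_element:
  assumes L: "fin_ext K L"
  obtains c where "c \<in> L" "L = adj K c"
proof -
  note K = fin_extD[OF L]
  let ?P = "\<lambda>x. x \<in> L"
  let ?d = "\<lambda>x. ext_degree K (adj K x)"
  have fin: "fin_ext K (adj K x)" "adj K x \<subseteq> L" if "x \<in> L" for x
    by (rule minpoly_exists[OF K(1) fin_ext_alg[OF L that]], rule adj_fin_ext(1)[OF K(1)])
      (auto simp: adj_least[OF K(2,3) that])
  have "\<forall>x. ?P x \<longrightarrow> ?d x < Suc (ext_degree K L)"
    using ext_degree_mono(1)[OF fin(1) L fin(2)] by (auto simp: less_Suc_eq_le)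
  then obtain c where c: "c \<in> L" and max: "\<And>x. x \<in> L \<Longrightarrow> ?d x \<le> ?d c"
    using ex_has_greatest_nat[of ?P 1 ?d] sf_1[OF K(2)] by blast
  have "L \<subseteq> adj K c"
  proof
    fix b assume b: "b \<in> L"
    obtain e where e: "adj (adj K c) b = adj K e"
      using primitive_pair[OF K(1) fin_ext_alg[OF L c] fin_ext_alg[OF L b]] by metis
    have sc: "sf (adj K c)" using fin_extD(2)[OF fin(1)[OF c]] .
    have "adj K e \<subseteq> L" unfolding e[symmetric] by (rule adj_least[OF K(2) fin(2)[OF c] b])
    then have eL: "e \<in> L" using adj_gen[OF K(1)] by blast
    have sub: "adj K c \<subseteq> adj K e" unfolding e[symmetric] by (rule adj_base[OF sc])
    have "?d c = ?d e" using ext_degree_mono(1)[OF fin(1)[OF c] fin(1)[OF eL] sub] max[OF eL] by simp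
    then have "adj K c = adj K e" using ext_degree_mono(2)[OF fin(1)[OF c] fin(1)[OF eL] sub] by simp
    then show "b \<in> adj K c" using adj_gen[OF sc, of b] e by simp
  qed
  with fin(2)[OF c] c that show ?thesis by blast
qed

section \<open>Embeddings and Galois extensions\<close>

text \<open>A field homomorphism from \<open>F\<close> into the complex numbers. Nothing is asked
  outside \<open>F\<close>, so the same function serves as its own restriction to subfields
  (\<open>emb_subset\<close>), unlike the extensional members of \<open>Aut_over\<close>.\<close>

definition emb :: "complex set \<Rightarrow> (complex \<Rightarrow> complex) \<Rightarrow> bool"
  where "emb F \<sigma> \<longleftrightarrow> (\<forall>x\<in>F. \<forall>y\<in>F. \<sigma> (x + y) = \<sigma> x + \<sigma> y \<and> \<sigma> (x * y) = \<sigma> x * \<sigma> y) \<and> \<sigma> 1 = 1"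

lemma emb_subset: "emb L \<sigma> \<Longrightarrow> F \<subseteq> L \<Longrightarrow> emb F \<sigma>"
  unfolding emb_def by blast

context
  fixes F \<sigma>
  assumes F: "sf F" and \<sigma>: "emb F \<sigma>"
begin

lemma emb_add: "x \<in> F \<Longrightarrow> y \<in> F \<Longrightarrow> \<sigma> (x + y) = \<sigma> x + \<sigma> y"
  and emb_mult: "x \<in> F \<Longrightarrow> y \<in> F \<Longrightarrow> \<sigma> (x * y) = \<sigma> x * \<sigma> y"
  and emb_1: "\<sigma> 1 = 1"
  using \<sigma> by (auto simp: emb_def)

lemma emb_0: "\<sigma> 0 = 0"
  using emb_add[of 0 0] sf_0[OF F] by simp

lemma emb_uminus: "x \<in> F \<Longrightarrow> \<sigma> (-x) = - \<sigma> x"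
  using emb_add[of x "-x"] sf_uminus[OF F] by (simp add: emb_0 eq_neg_iff_add_eq_0 add.commute)

lemma emb_diff: "x \<in> F \<Longrightarrow> y \<in> F \<Longrightarrow> \<sigma> (x - y) = \<sigma> x - \<sigma> y"
  using emb_add[of x "-y"] sf_uminus[OF F] by (simp add: emb_uminus)

lemma emb_eq_0_iff: "x \<in> F \<Longrightarrow> \<sigma> x = 0 \<longleftrightarrow> x = 0"
  using emb_mult[of x "inverse x"] sf_inverse[OF F] by (cases "x = 0") (auto simp: emb_0 emb_1)

lemma emb_inj: "inj_on \<sigma> F"
proof (rule inj_onI)
  fix x y assume "x \<in> F" "y \<in> F" "\<sigma> x = \<sigma> y"
  then have "\<sigma> (x - y) = 0" "x - y \<in> F" by (auto simp: emb_diff sf_diff[OF F])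
  then show "x = y" using emb_eq_0_iff by auto
qed

lemma emb_sum: "(\<And>i. i \<in> A \<Longrightarrow> f i \<in> F) \<Longrightarrow> \<sigma> (sum f A) = (\<Sum>i\<in>A. \<sigma> (f i))"
  by (induction A rule: infinite_finite_induct) (auto simp: emb_0 emb_add sf_sum[OF F])

lemma emb_power: "x \<in> F \<Longrightarrow> \<sigma> (x ^ n) = \<sigma> x ^ n"
  by (induction n) (auto simp: emb_1 emb_mult sf_power[OF F])

lemma emb_poly: "p \<in> polys F \<Longrightarrow> x \<in> F \<Longrightarrow> \<sigma> (poly p x) = poly (map_poly \<sigma> p) (\<sigma> x)"
  by (induction p)
    (auto simp: emb_0 emb_add emb_mult map_poly_pCons pCons_in_polys_iff sf_mult[OF F] polys_poly[OF F])

lemma map_poly_emb_add: "p \<in> polys F \<Longrightarrow> q \<in> polys F \<Longrightarrow> map_poly \<sigma> (p + q) = map_poly \<sigma> p + map_poly \<sigma> q"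
  by (rule poly_eqI) (simp add: coeff_map_poly emb_0 emb_add polysD)

lemma map_poly_emb_mult: "p \<in> polys F \<Longrightarrow> q \<in> polys F \<Longrightarrow> map_poly \<sigma> (p * q) = map_poly \<sigma> p * map_poly \<sigma> q"
  by (rule poly_eqI) (simp add: coeff_map_poly emb_0 coeff_mult emb_sum emb_mult polysD sf_mult[OF F])

text \<open>The extension sends q(a) to the value at \<open>b\<close> of the polynomial with
  coefficients moved by \<open>\<sigma>\<close>. Two polynomials with the same value at
  \<open>a\<close> differ by a multiple of \<open>p\<close>, which the hypothesis on
  \<open>b\<close> sends to 0.\<close>

lemma emb_extend:
  assumes p: "irr F p" "poly p a = 0" and b: "poly (map_poly \<sigma> p) b = 0"
  obtains \<tau> where "emb (adj F a) \<tau>" "\<And>x. x \<in> F \<Longrightarrow> \<tau> x = \<sigma> x" "\<tau> a = b"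
proof -
  define \<tau> where "\<tau> = (\<lambda>x. poly (map_poly \<sigma> (SOME q. q \<in> polys F \<and> poly q a = x)) b)"
  have wd: "poly (map_poly \<sigma> q) b = poly (map_poly \<sigma> q') b"
    if "q \<in> polys F" "q' \<in> polys F" "poly q a = poly q' a" for q q'
  proof -
    have d: "q - q' \<in> polys F" using that polys_diff[OF F] by simp
    have "p dvd q - q'" using irr_root_dvd[OF F p d] that by simp
    then obtain s where s: "s \<in> polys F" "q - q' = p * s"
      using polys_dvdE[OF F d irrD(1)[OF p(1)]] by metis
    have ps: "p * s \<in> polys F" using s d by simp
    have "q = q' + p * s" using s(2) by (simp add: algebra_simps)
    then have "map_poly \<sigma> q = map_poly \<sigma> q' + map_poly \<sigma> p * map_poly \<sigma> s"
      using s that irrD(1)[OF p(1)] ps by (simp add: map_poly_emb_add map_poly_emb_mult)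
    then show ?thesis using b by simp
  qed
  have \<tau>: "\<tau> (poly q a) = poly (map_poly \<sigma> q) b" if "q \<in> polys F" for q
    unfolding \<tau>_def using someI[of "\<lambda>q'. q' \<in> polys F \<and> poly q' a = poly q a" q] that by (intro wd) auto
  have "emb (adj F a) \<tau>"
    unfolding emb_def
  proof (intro conjI ballI)
    show "\<tau> 1 = 1" using \<tau>[OF polys_1[OF F]] by (simp add: emb_1)
    fix x y assume "x \<in> adj F a" "y \<in> adj F a"
    then obtain q r where qr: "q \<in> polys F" "x = poly q a" "r \<in> polys F" "y = poly r a" by (auto elim!: adjE)
    show "\<tau> (x + y) = \<tau> x + \<tau> y"
      using \<tau>[OF polys_add[OF F qr(1,3)]] qr by (simp add: \<tau> map_poly_emb_add)
    show "\<tau> (x * y) = \<tau> x * \<tau> y"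
      using \<tau>[OF polys_mult[OF F qr(1,3)]] qr by (simp add: \<tau> map_poly_emb_mult)
  qed
  moreover have "\<tau> x = \<sigma> x" if "x \<in> F" for x
    using \<tau>[OF polys_const[OF F that]] by (simp add: map_poly_pCons emb_0)
  moreover have "\<tau> a = b"
    using \<tau>[OF polys_linear[OF F sf_0[OF F] sf_1[OF F]]] by (simp add: map_poly_pCons emb_0 emb_1)
  ultimately show ?thesis using that by blast
qed

end

lemma map_poly_fixed: "p \<in> polys K \<Longrightarrow> (\<And>x. x \<in> K \<Longrightarrow> \<sigma> x = x) \<Longrightarrow> \<sigma> 0 = 0 \<Longrightarrow> map_poly \<sigma> p = p"
  by (rule poly_eqI) (simp add: coeff_map_poly polysD)

lemma emb_poly_fixed:
  assumes "sf F" "emb F \<sigma>" "K \<subseteq> F" "\<And>x. x \<in> K \<Longrightarrow> \<sigma> x = x" "p \<in> polys K" "x \<in> F"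
  shows "\<sigma> (poly p x) = poly p (\<sigma> x)"
  using emb_poly[OF assms(1,2) subsetD[OF polys_mono[OF assms(3)] assms(5)] assms(6)]
    map_poly_fixed[OF assms(5,4) emb_0[OF assms(1,2)]] by simp

section \<open>Automorphisms over K and normality of Galois extensions\<close>

lemma Aut_overD:
  assumes "\<sigma> \<in> Aut_over K F"
  shows "emb F \<sigma>" "\<And>x. x \<in> F \<Longrightarrow> \<sigma> x \<in> F" "\<And>k. k \<in> K \<Longrightarrow> \<sigma> k = k" "bij_betw \<sigma> F F" "\<sigma> \<in> extensional F"
  using assms unfolding Aut_over_def emb_def by (auto simp: PiE_iff)

text \<open>Only surjectivity needs an argument: for \<open>x\<close> in \<open>F\<close>, the
  injective \<open>\<sigma>\<close> permutes the finite set of roots in \<open>F\<close> of the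
  minimal polynomial of \<open>x\<close>, so \<open>x\<close> is attained.\<close>

lemma Aut_over_restrict:
  assumes F: "fin_ext K F" and \<sigma>: "emb F \<sigma>" "\<And>k. k \<in> K \<Longrightarrow> \<sigma> k = k" "\<And>x. x \<in> F \<Longrightarrow> \<sigma> x \<in> F"
  shows "restrict \<sigma> F \<in> Aut_over K F"
proof -
  note K = fin_extD[OF F]
  have inj: "inj_on \<sigma> F" by (rule emb_inj[OF K(2) \<sigma>(1)])
  have "F \<subseteq> \<sigma> ` F"
  proof
    fix x assume x: "x \<in> F"
    obtain p where p: "irr K p" "poly p x = 0" using minpoly_exists[OF K(1) fin_ext_alg[OF F x]] .
    let ?R = "{y \<in> F. poly p y = 0}"
    have fin: "finite ?R" using poly_roots_finite[OF irrD(4)[OF p(1)]] by (rule rev_finite_subset) auto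
    have "\<sigma> ` ?R \<subseteq> ?R"
    proof clarify
      fix y assume y: "y \<in> F" "poly p y = 0"
      then have "\<sigma> (poly p y) = poly p (\<sigma> y)"
        by (intro emb_poly_fixed[OF K(2) \<sigma>(1) K(3) \<sigma>(2)] irrD[OF p(1)]) auto
      with y \<sigma>(3) emb_0[OF K(2) \<sigma>(1)] show "\<sigma> y \<in> F \<and> poly p (\<sigma> y) = 0" by simp
    qed
    then have "\<sigma> ` ?R = ?R" by (rule endo_inj_surj[OF fin]) (rule inj_on_subset[OF inj], auto)
    then show "x \<in> \<sigma> ` F" using x p(2) by blast
  qed
  then have "bij_betw \<sigma> F F" unfolding bij_betw_def using inj \<sigma>(3) by auto
  then have "bij_betw (restrict \<sigma> F) F F" by (subst bij_betw_cong[of F _ \<sigma>]) auto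
  then show ?thesis
    using \<sigma> K unfolding Aut_over_def by (auto simp: emb_def sf_closed)
qed

text \<open>Used twice: to bound the number of automorphisms by the degree, and, when there are that
  many, to place all roots of \<open>p\<close> in the field.\<close>

lemma Aut_over_roots:
  assumes F: "fin_ext K F" and c: "F = adj K c" and p: "irr K p" "poly p c = 0"
  shows "inj_on (\<lambda>\<sigma>. \<sigma> c) (Aut_over K F)" "(\<lambda>\<sigma>. \<sigma> c) ` Aut_over K F \<subseteq> {x \<in> F. poly p x = 0}"
proof -
  note K = fin_extD[OF F]
  have cF: "c \<in> F" using c adj_gen[OF K(1)] by simp
  have *: "\<sigma> (poly q x) = poly q (\<sigma> x)" if "\<sigma> \<in> Aut_over K F" "q \<in> polys K" "x \<in> F" for \<sigma> q x
    using that by (intro emb_poly_fixed[OF K(2) _ K(3)]) (auto dest: Aut_overD)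
  show "inj_on (\<lambda>\<sigma>. \<sigma> c) (Aut_over K F)"
  proof (rule inj_onI)
    fix \<sigma> \<tau> assume st: "\<sigma> \<in> Aut_over K F" "\<tau> \<in> Aut_over K F" "\<sigma> c = \<tau> c"
    show "\<sigma> = \<tau>"
    proof (rule extensionalityI[of _ F])
      fix x assume "x \<in> F"
      then obtain q where q: "q \<in> polys K" "x = poly q c" unfolding c by (rule adjE)
      with *[OF st(1) q(1) cF] *[OF st(2) q(1) cF] st(3) show "\<sigma> x = \<tau> x" by simp
    qed (use st in \<open>auto dest: Aut_overD(5)\<close>)
  qed
  show "(\<lambda>\<sigma>. \<sigma> c) ` Aut_over K F \<subseteq> {x \<in> F. poly p x = 0}"
  proof clarify
    fix \<sigma> assume s: "\<sigma> \<in> Aut_over K F"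
    from *[OF s irrD(1)[OF p(1)] cF] p(2) emb_0[OF K(2) Aut_overD(1)[OF s]]
    show "\<sigma> c \<in> F \<and> poly p (\<sigma> c) = 0" using Aut_overD(2)[OF s cF] by simp
  qed
qed

lemma card_Aut_over_le:
  assumes F: "fin_ext K F"
  shows "finite (Aut_over K F)" "card (Aut_over K F) \<le> ext_degree K F"
proof -
  note K = fin_extD[OF F]
  obtain c where c: "c \<in> F" "F = adj K c" using primitive_element[OF F] .
  obtain p where p: "irr K p" "poly p c = 0" using minpoly_exists[OF K(1) fin_ext_alg[OF F c(1)]] .
  note R = Aut_over_roots[OF F c(2) p]
  have fin: "finite {x \<in> F. poly p x = 0}"
    using poly_roots_finite[OF irrD(4)[OF p(1)]] by (rule rev_finite_subset) auto
  show "finite (Aut_over K F)" using inj_on_finite[OF R fin] .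
  have "card (Aut_over K F) \<le> card {x \<in> F. poly p x = 0}" by (rule card_inj_on_le[OF R fin])
  also have "\<dots> \<le> card {x. poly p x = 0}"
    using poly_roots_finite[OF irrD(4)[OF p(1)]] by (rule card_mono) auto
  also have "\<dots> \<le> degree p" by (rule card_poly_roots_bound[OF irrD(4)[OF p(1)]])
  also have "\<dots> = ext_degree K F" using adj_fin_ext[OF K(1) p] c(2) by simp
  finally show "card (Aut_over K F) \<le> ext_degree K F" .
qed

text \<open>If the automorphisms are as many as the degree, all complex roots of the minimal
  polynomial of a generator \<open>c\<close> lie in \<open>M\<close>. So \<open>\<tau>\<close> maps
  \<open>c\<close> into \<open>M\<close>, and every element of \<open>M\<close> is a polynomial in
  \<open>c\<close> over \<open>K\<close>.\<close>

lemma galois_ext_normal: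
  assumes M: "galois_ext K M" and \<tau>: "emb M \<tau>" "\<And>k. k \<in> K \<Longrightarrow> \<tau> k = k" and x: "x \<in> M"
  shows "\<tau> x \<in> M"
proof -
  have F: "fin_ext K M" and card: "card (Aut_over K M) = ext_degree K M" using M by (auto simp: galois_ext_def)
  note K = fin_extD[OF F]
  obtain c where c: "c \<in> M" "M = adj K c" using primitive_element[OF F] .
  obtain p where p: "irr K p" "poly p c = 0" using minpoly_exists[OF K(1) fin_ext_alg[OF F c(1)]] .
  note R = Aut_over_roots[OF F c(2) p]
  have fin: "finite {x. poly p x = 0}" by (rule poly_roots_finite[OF irrD(4)[OF p(1)]])
  have fin': "finite {x \<in> M. poly p x = 0}" using fin by (rule rev_finite_subset) auto
  have "degree p \<le> card {x \<in> M. poly p x = 0}"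
    using card_inj_on_le[OF R fin'] card adj_fin_ext[OF K(1) p] c(2) by simp
  then have "{x \<in> M. poly p x = 0} = {x. poly p x = 0}"
    using card_poly_roots_bound[OF irrD(4)[OF p(1)]] card_mono[OF fin, of "{x \<in> M. poly p x = 0}"]
    by (intro card_subset_eq[OF fin]) (fastforce intro: antisym)+
  moreover have fixed: "\<tau> (poly q c) = poly q (\<tau> c)" if "q \<in> polys K" for q
    by (rule emb_poly_fixed[OF K(2) \<tau>(1) K(3) \<tau>(2) that c(1)])
  have "poly p (\<tau> c) = 0" using fixed[OF irrD(1)[OF p(1)]] p(2) emb_0[OF K(2) \<tau>(1)] by simp
  ultimately have tc: "\<tau> c \<in> M" by auto
  obtain q where q: "q \<in> polys K" "x = poly q c" using x unfolding c(2) by (rule adjE)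
  show ?thesis unfolding q(2) fixed[OF q(1)]
    by (rule polys_poly[OF K(2) _ tc]) (use q(1) polys_mono[OF K(3)] in auto)
qed

text \<open>The source of both later contradictions. Normality of \<open>M\<close> keeps
  \<open>\<tau> \<mu>\<close> in \<open>L\<close>; as \<open>\<tau>\<close> also preserves
  \<open>F\<close>, and \<open>F\<close> and \<open>\<mu>\<close> generate \<open>L\<close>, no
  element of \<open>L\<close> can be moved out of \<open>L\<close>.\<close>

lemma galois_generates_conjugate:
  assumes M: "galois_ext K M" "M \<subseteq> L" and F: "sf F" "K \<subseteq> F" and L: "sf L" "F \<subseteq> L" "L = adj F \<mu>" "\<mu> \<in> M" "\<alpha> \<in> L"
    and \<tau>: "emb L \<tau>" "\<And>k. k \<in> K \<Longrightarrow> \<tau> k = k" "\<And>x. x \<in> F \<Longrightarrow> \<tau> x \<in> F"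
  shows "\<tau> \<alpha> \<in> L"
proof -
  have m: "\<tau> \<mu> \<in> L" using galois_ext_normal[OF M(1) emb_subset[OF \<tau>(1) M(2)] \<tau>(2) L(4)] M(2) by auto
  obtain q where q: "q \<in> polys F" "\<alpha> = poly q \<mu>" using L(5) unfolding L(3) by (rule adjE)
  have "\<tau> \<alpha> = poly (map_poly \<tau> q) (\<tau> \<mu>)" unfolding q(2)
    by (rule emb_poly[OF L(1) \<tau>(1)]) (use q(1) polys_mono[OF L(2)] M L in auto)
  moreover have "map_poly \<tau> q \<in> polys L"
    using q(1) \<tau>(3) L(2) emb_0[OF L(1) \<tau>(1)] by (auto simp: polys_def coeff_map_poly)
  ultimately show ?thesis using polys_poly[OF L(1) _ m] by simp
qed

lemma adj_intermediate:
  assumes F: "sf F" and a: "alg F \<alpha>" and mu: "\<mu> \<in> adj F \<alpha>"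
  shows "fin_ext F (adj F \<mu>)" "fin_ext (adj F \<mu>) (adj F \<alpha>)" "adj (adj F \<mu>) \<alpha> = adj F \<alpha>" "alg (adj F \<mu>) \<alpha>"
proof -
  have L: "fin_ext F (adj F \<alpha>)" using minpoly_exists[OF F a] adj_fin_ext(1)[OF F] by blast
  have m: "alg F \<mu>" by (rule fin_ext_alg[OF L mu])
  show 1: "fin_ext F (adj F \<mu>)" using minpoly_exists[OF F m] adj_fin_ext(1)[OF F] by blast
  note s = fin_extD(2)[OF 1]
  show 2: "alg (adj F \<mu>) \<alpha>" by (rule alg_mono[OF adj_base[OF F] a])
  show 3: "adj (adj F \<mu>) \<alpha> = adj F \<alpha>"
  proof
    show "adj F \<alpha> \<subseteq> adj (adj F \<mu>) \<alpha>" by (rule adj_mono[OF adj_base[OF F]])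
    show "adj (adj F \<mu>) \<alpha> \<subseteq> adj F \<alpha>"
      using fin_extD[OF L] by (intro adj_least mu adj_gen F)
  qed
  show "fin_ext (adj F \<mu>) (adj F \<alpha>)" using minpoly_exists[OF s 2] adj_fin_ext(1)[OF s] 3 by metis
qed

lemma irr_factor: "irr K p \<Longrightarrow> q \<in> polys K \<Longrightarrow> r \<in> polys K \<Longrightarrow> p = q * r \<Longrightarrow> degree q = 0 \<or> degree r = 0"
  by (auto simp: irr_def)

lemma exists_root: "degree (p :: complex poly) > 0 \<Longrightarrow> \<exists>x. poly p x = 0"
  using fundamental_theorem_of_algebra[of p] constant_degree[of p] by auto

lemma irr_root_in: "sf L \<Longrightarrow> irr L h \<Longrightarrow> poly h a = 0 \<Longrightarrow> a \<in> L \<Longrightarrow> degree h = 1"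
  using irr_unique[OF _ _ _ linear_irr, of L h a] by force

text \<open>Here \<open>f\<close> splits off exactly one linear factor over the field generated by one of its roots, so
  its Galois group is doubly transitive.\<close>
lemma galois_subext_doubly_transitive:
  assumes F: "fin_ext K F" and f: "irr F f" "poly f \<alpha> = 0" and h: "f = [:-\<alpha>, 1:] * h" "irr (adj F \<alpha>) h" "degree h > 1"
    and M: "galois_ext K M" "M \<subseteq> adj F \<alpha>"
  shows "M \<subseteq> F"
proof
  fix \<mu> assume mu: "\<mu> \<in> M"
  show "\<mu> \<in> F"
  proof (rule ccontr)
    assume nF: "\<mu> \<notin> F"
    note K = fin_extD[OF F]
    define L where "L = adj F \<alpha>"
    define E where "E = adj F \<mu>"
    have aF: "alg F \<alpha>" by (rule irr_alg[OF f])
    have L: "fin_ext F L" "ext_degree F L = degree f" unfolding L_def using adj_fin_ext[OF K(2) f] by auto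
    note L' = fin_extD[OF L(1)]
    have muL: "\<mu> \<in> L" using mu M by (auto simp: L_def)
    note I = adj_intermediate[OF K(2) aF muL[unfolded L_def], folded E_def L_def]
    note E = fin_extD[OF I(1)] fin_extD[OF I(2)]
    have muE: "\<mu> \<in> E" unfolding E_def by (rule adj_gen[OF K(2)])
    have aL: "\<alpha> \<in> L" unfolding L_def by (rule adj_gen[OF K(2)])
    obtain g where g: "irr E g" "poly g \<alpha> = 0" using minpoly_exists[OF E(2) I(4)] .
    have "g dvd f" using irr_root_dvd[OF E(2) g _ f(2)] irrD(1)[OF f(1)] polys_mono[OF E(3)] by auto
    have gL: "g \<in> polys L" using irrD(1)[OF g(1)] polys_mono[OF E(7)] by auto
    have lin: "[:-\<alpha>, 1:] \<in> polys L" using aL L'(2) by (auto intro!: polys_linear sf_closed)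
    obtain g' where g': "g' \<in> polys L" "g = [:-\<alpha>, 1:] * g'"
      using polys_dvdE[OF L'(2) gL lin] g(2) poly_eq_0_iff_dvd[of g \<alpha>] by metis
    have "g' dvd h" using \<open>g dvd f\<close> unfolding g'(2) h(1) by (subst (asm) dvd_mult_cancel_left) auto
    then obtain s where s: "s \<in> polys L" "h = g' * s"
      using polys_dvdE[OF L'(2) _ g'(1)] irrD(1)[OF h(2)] unfolding L_def by metis
    have nz: "g' \<noteq> 0" "s \<noteq> 0" using irrD(4)[OF h(2)] s by auto
    have dg: "degree g = Suc (degree g')" unfolding g'(2) using nz by (subst degree_mult_eq) auto
    have df: "degree f = Suc (degree g' + degree s)" unfolding h(1) s(2) using nz
      by (subst degree_mult_eq; (subst degree_mult_eq)?) auto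
    \<comment> \<open>\<open>g\<close> is the minimal polynomial of \<open>\<alpha>\<close> over
      F(\<mu>), and its cofactor \<open>g'\<close> divides the irreducible \<open>h\<close>. Either
      \<open>g\<close> is linear and \<open>E = L\<close>, or \<open>g\<close> has the degree of
      \<open>f\<close> and \<open>E = F\<close>, which the choice of \<open>\<mu>\<close>
      excludes.\<close>
    have "degree g' = 0 \<or> degree s = 0" 
      by (rule irr_factor[OF h(2)[folded L_def] g'(1) s])
    then have EL: "E = L"
    proof
      assume "degree g' = 0"
      then have "\<alpha> \<in> E" using irr_degree_1[OF E(2) g] dg by simp
      then have "L \<subseteq> E" unfolding L_def by (intro adj_least E)
      with E(7) show ?thesis by simp
    next
      assume "degree s = 0"
      then have "ext_degree E L = ext_degree F L"
        using adj_fin_ext(2)[OF E(2) g] I(3) dg df L by simp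
      then have "ext_degree F E = 1"
        using fin_ext_tower(2)[OF I(1,2)] ext_degree_pos[OF L(1)] by simp
      then have "F = E" using ext_degree_mono(2)[OF fin_ext_refl(1)[OF K(2)] I(1) E(3)] fin_ext_refl(2)[OF K(2)] by simp
      with muE nF show ?thesis by simp
    qed
    \<comment> \<open>Being irreducible over \<open>L\<close> and not linear, \<open>h\<close> has
      no root in \<open>L\<close>; any root of it is a conjugate of \<open>\<alpha>\<close> over
      \<open>F\<close> that lies outside \<open>L\<close>.\<close>
    obtain \<alpha>' where a': "poly h \<alpha>' = 0" using exists_root[of h] h(3) by auto
    have a'L: "\<alpha>' \<notin> L" using irr_root_in[OF L'(2) h(2)[folded L_def] a'] h(3) by auto
    have "poly f \<alpha>' = 0" using a' h(1) by simp
    moreover have "emb F (\<lambda>x. x)" by (simp add: emb_def)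
    ultimately obtain \<tau> where t: "emb L \<tau>" "\<And>x. x \<in> F \<Longrightarrow> \<tau> x = x" "\<tau> \<alpha> = \<alpha>'"
      using emb_extend[OF K(2) _ f, of "\<lambda>x. x" \<alpha>'] by (auto simp: L_def map_poly_idI)
    have "\<tau> \<alpha> \<in> L"
      by (rule galois_generates_conjugate[OF M(1) M(2)[folded L_def] K(2,3) L'(2,3) _ mu aL t(1)])
        (use t(2) K(3) EL E_def in auto)
    with t(3) a'L show False by simp
  qed
qed

lemma irr_quadratic:
  assumes F: "sf F" and a: "\<alpha> ^ 2 = \<delta>" "\<delta> \<in> F" "\<alpha> \<notin> F"
  shows "irr F [:-\<delta>, 0, 1:]"
proof (rule irrI[OF F])
  show "[:-\<delta>, 0, 1:] \<in> polys F" using a F by (auto simp: pCons_in_polys_iff polys_0 intro!: sf_closed)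
  fix q r assume qr: "q \<in> polys F" "r \<in> polys F" "[:-\<delta>, 0, 1:] = q * r" "lead_coeff q = 1" "lead_coeff r = 1"
    "degree q > 0" "degree r > 0"
  have "q \<noteq> 0" "r \<noteq> 0" using qr by auto
  then have "degree q + degree r = degree [:-\<delta>, 0, 1:]" unfolding qr(3) by (simp add: degree_mult_eq)
  then have "degree q = 1" using qr(6,7) by (simp add: numeral_2_eq_2)
  then obtain c d where "q = [:c, d:]" "d \<noteq> 0" using degree1_coeffs by metis
  with qr(4) have c: "q = [:c, 1:]" by simp
  have cF: "c \<in> F" using qr(1) c by (simp add: pCons_in_polys_iff)
  have "poly [:-\<delta>, 0, 1:] (-c) = 0" unfolding qr(3) c by simp
  then have "c ^ 2 = \<alpha> ^ 2" using a(1) by (simp add: power2_eq_square)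
  then have "\<alpha> = c \<or> \<alpha> = -c" by (metis power2_eq_iff)
  then show False using cF a(3) sf_uminus[OF F cF] by auto
qed auto

text \<open>Since [L : F] = 2, an element of \<open>M\<close> outside \<open>F\<close> generates
  \<open>L\<close> over \<open>F\<close>. Now \<open>\<sigma>\<close> extends to \<open>L\<close>
  with \<open>\<alpha>\<close> sent to \<open>e\<close>, and
  \<open>galois_generates_conjugate\<close> would put \<open>e\<close> into
  \<open>L\<close>.\<close>

lemma galois_subext_quadratic:
  assumes F: "fin_ext K F" and a: "\<alpha> ^ 2 = \<delta>" "\<delta> \<in> F" "\<alpha> \<notin> F"
    and \<sigma>: "emb F \<sigma>" "\<And>k. k \<in> K \<Longrightarrow> \<sigma> k = k" "\<And>x. x \<in> F \<Longrightarrow> \<sigma> x \<in> F"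
    and e: "e ^ 2 = \<sigma> \<delta>" "e \<notin> adj F \<alpha>"
    and M: "galois_ext K M" "M \<subseteq> adj F \<alpha>"
  shows "M \<subseteq> F"
proof
  fix \<mu> assume mu: "\<mu> \<in> M"
  show "\<mu> \<in> F"
  proof (rule ccontr)
    assume nF: "\<mu> \<notin> F"
    note K = fin_extD[OF F]
    define L where "L = adj F \<alpha>"
    define E where "E = adj F \<mu>"
    define f where "f = [:-\<delta>, 0, 1:]"
    have f: "irr F f" "poly f \<alpha> = 0" unfolding f_def using irr_quadratic[OF K(2) a] a(1) by (auto simp: power2_eq_square)
    have aF: "alg F \<alpha>" by (rule irr_alg[OF f])
    have L: "fin_ext F L" "ext_degree F L = 2" unfolding L_def using adj_fin_ext[OF K(2) f] by (auto simp: f_def)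
    note L' = fin_extD[OF L(1)]
    have muL: "\<mu> \<in> L" using mu M by (auto simp: L_def)
    note I = adj_intermediate[OF K(2) aF muL[unfolded L_def], folded E_def L_def]
    note E = fin_extD[OF I(1)] fin_extD[OF I(2)]
    have muE: "\<mu> \<in> E" unfolding E_def by (rule adj_gen[OF K(2)])
    have aL: "\<alpha> \<in> L" unfolding L_def by (rule adj_gen[OF K(2)])
    have "ext_degree F E \<noteq> 1"
    proof
      assume "ext_degree F E = 1"
      then have "F = E" using ext_degree_mono(2)[OF fin_ext_refl(1)[OF K(2)] I(1) E(3)] fin_ext_refl(2)[OF K(2)] by simp
      with muE nF show False by simp
    qed
    moreover have prod: "ext_degree F E * ext_degree E L = 2" using fin_ext_tower(2)[OF I(1,2)] L(2) by simp
    moreover have "ext_degree F E dvd 2" unfolding prod[symmetric] by simp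
    then have "ext_degree F E \<le> 2" by (rule dvd_imp_le) simp
    ultimately have "ext_degree F E = ext_degree F L"
      using ext_degree_pos[OF I(1)] L(2) by linarith
    then have EL: "E = L" by (rule ext_degree_mono(2)[OF I(1) L(1) E(7)])
    have "poly (map_poly \<sigma> f) e = 0"
      using e(1) K(2) \<sigma>(1) a(2)
      by (simp add: f_def map_poly_pCons emb_0 emb_1 emb_uminus power2_eq_square)
    then obtain \<tau> where t: "emb L \<tau>" "\<And>x. x \<in> F \<Longrightarrow> \<tau> x = \<sigma> x" "\<tau> \<alpha> = e"
      using emb_extend[OF K(2) \<sigma>(1) f, of e] by (auto simp: L_def)
    have "\<tau> \<alpha> \<in> L"
      by (rule galois_generates_conjugate[OF M(1) M(2)[folded L_def] K(2,3) L'(2,3) _ mu aL t(1)])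
        (use t(2) K(3) EL E_def \<sigma> in auto)
    with t(3) e(2) show False by (simp add: L_def)
  qed
qed

section \<open>Discrete valuations\<close>

text \<open>\<open>v x \<ge> k\<close> with the convention \<open>v 0 = \<infinity>\<close>; the valuations below have a junk value at \<open>0\<close>.\<close>
definition vge :: "(complex \<Rightarrow> int) \<Rightarrow> int \<Rightarrow> complex \<Rightarrow> bool"
  where "vge v k x \<longleftrightarrow> x = 0 \<or> v x \<ge> k"

text \<open>The last axiom makes the rational prime \<open>l\<close> itself a uniformiser, so an
  integer divisible exactly once by \<open>l\<close> can be the constant term in
  \<open>Eisenstein\<close>. The axioms survive passing to a subfield
  (\<open>valued_field_subset\<close>).\<close>

locale valued_field =
  fixes F :: "complex set" and l :: nat and v :: "complex \<Rightarrow> int"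
  assumes F: "sf F" and l: "prime l"
    and v_mult: "x \<in> F \<Longrightarrow> y \<in> F \<Longrightarrow> x \<noteq> 0 \<Longrightarrow> y \<noteq> 0 \<Longrightarrow> v (x * y) = v x + v y"
    and v_add: "x \<in> F \<Longrightarrow> y \<in> F \<Longrightarrow> x \<noteq> 0 \<Longrightarrow> y \<noteq> 0 \<Longrightarrow> x + y \<noteq> 0 \<Longrightarrow> min (v x) (v y) \<le> v (x + y)"
    and v_prime: "v (of_nat l) = 1"
begin

lemma v_1: "v 1 = 0"
  using v_mult[of 1 1] sf_1[OF F] by simp

lemma v_minus_1: "v (-1) = 0"
  using v_mult[of "-1" "-1"] sf_uminus[OF F sf_1[OF F]] v_1 by simp

lemma v_uminus: "x \<in> F \<Longrightarrow> v (-x) = v x"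
  using v_mult[of "-1" x] sf_uminus[OF F sf_1[OF F]] v_minus_1 by (cases "x = 0") auto

lemma v_inverse: "x \<in> F \<Longrightarrow> x \<noteq> 0 \<Longrightarrow> v (inverse x) = - v x"
  using v_mult[of x "inverse x"] sf_inverse[OF F] v_1 by simp

lemma v_power: "x \<in> F \<Longrightarrow> x \<noteq> 0 \<Longrightarrow> v (x ^ n) = int n * v x"
  by (induction n) (auto simp: v_1 v_mult sf_power[OF F] algebra_simps)

lemma vge_0 [simp]: "vge v k 0" by (simp add: vge_def)

lemma vge_1: "vge v 0 1" by (simp add: vge_def v_1)

lemma vge_mono: "vge v k x \<Longrightarrow> j \<le> k \<Longrightarrow> vge v j x"
  by (auto simp: vge_def)

lemma vge_add: "x \<in> F \<Longrightarrow> y \<in> F \<Longrightarrow> vge v k x \<Longrightarrow> vge v k y \<Longrightarrow> vge v k (x + y)"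
  using v_add[of x y] by (cases "x = 0 \<or> y = 0 \<or> x + y = 0") (auto simp: vge_def)

lemma vge_uminus: "x \<in> F \<Longrightarrow> vge v k x \<Longrightarrow> vge v k (-x)"
  by (auto simp: vge_def v_uminus)

lemma vge_diff: "x \<in> F \<Longrightarrow> y \<in> F \<Longrightarrow> vge v k x \<Longrightarrow> vge v k y \<Longrightarrow> vge v k (x - y)"
  using vge_add[of x "-y"] by (auto simp: vge_uminus sf_uminus[OF F])

lemma vge_mult: "x \<in> F \<Longrightarrow> y \<in> F \<Longrightarrow> vge v j x \<Longrightarrow> vge v k y \<Longrightarrow> vge v (j + k) (x * y)"
  by (cases "x = 0 \<or> y = 0") (auto simp: vge_def v_mult)

lemma vge_mult': "x \<in> F \<Longrightarrow> y \<in> F \<Longrightarrow> vge v j x \<Longrightarrow> vge v k y \<Longrightarrow> i \<le> j + k \<Longrightarrow> vge v i (x * y)"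
  using vge_mult vge_mono by blast

lemma vge_sum: "(\<And>i. i \<in> A \<Longrightarrow> f i \<in> F \<and> vge v k (f i)) \<Longrightarrow> vge v k (sum f A)"
  by (induction A rule: infinite_finite_induct) (auto intro!: vge_add sf_sum[OF F])

lemma vge_power: "x \<in> F \<Longrightarrow> vge v k x \<Longrightarrow> vge v (int n * k) (x ^ n)"
proof (cases "n = 0")
  case False
  assume "x \<in> F" "vge v k x"
  then show ?thesis using False v_power[of x n] by (cases "x = 0") (auto simp: vge_def intro: mult_left_mono)
qed (simp add: vge_1)

text \<open>The equality case of the ultrametric inequality: otherwise \<open>x\<close>, as the
  difference of \<open>x + y\<close> and \<open>y\<close>, would have a larger valuation. Writing
  the hypothesis with \<open>vge\<close> includes \<open>y = 0\<close>.\<close>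

lemma v_add_eq:
  assumes "x \<in> F" "y \<in> F" "x \<noteq> 0" "vge v (v x + 1) y"
  shows "x + y \<noteq> 0" "v (x + y) = v x"
proof -
  show nz: "x + y \<noteq> 0"
    using assms v_uminus[of x] by (auto simp: vge_def add_eq_0_iff2)
  have "vge v (v x) (x + y)" using assms by (intro vge_add) (auto simp: vge_def)
  moreover have "\<not> v (x + y) > v x"
  proof
    assume "v (x + y) > v x"
    then have "vge v (v x + 1) (x + y - y)" using assms by (intro vge_diff sf_add[OF F]) (auto simp: vge_def)
    then show False using assms(3) by (simp add: vge_def)
  qed
  ultimately show "v (x + y) = v x" using nz by (auto simp: vge_def)
qed

lemma l_in_F: "of_nat l \<in> F" by (rule sf_of_nat[OF F])

lemma vge_of_nat: "vge v 0 (of_nat n)"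
  by (induction n) (auto intro!: vge_add vge_1 sf_closed[OF F])

lemma vge_of_int: "vge v 0 (of_int n)"
  by (cases n) (auto intro!: vge_uminus vge_of_nat sf_closed[OF F] simp del: of_nat_Suc)

lemma vge_of_int_dvd:
  assumes "int l ^ k dvd n" shows "vge v (int k) (of_int n)"
proof -
  obtain m where m: "n = int l ^ k * m" using assms by (auto elim: dvdE)
  have "vge v (int k * 1) (of_nat l ^ k)" by (rule vge_power[OF l_in_F]) (simp add: vge_def v_prime)
  then have "vge v (int k + 0) (of_nat l ^ k * of_int m)"
    by (intro vge_mult vge_of_int sf_closed[OF F]) auto
  then show ?thesis by (simp add: m)
qed

text \<open>If \<open>n\<close> had positive valuation, so would every integral combination of
  \<open>l\<close> and \<open>n\<close>, among them 1.\<close>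

lemma v_of_int_unit:
  assumes "\<not> int l dvd n" shows "v (of_int n) = 0" "n \<noteq> 0"
proof -
  show n: "n \<noteq> 0" using assms by auto
  have "prime (int l)" using l by simp
  then have "coprime (int l) n" using assms by (simp add: prime_imp_coprime)
  then obtain a b where ab: "a * int l + b * n = 1" by (metis bezout_int coprime_imp_gcd_eq_1)
  have "\<not> vge v 1 (of_int n)"
  proof
    assume "vge v 1 (of_int n)"
    then have "vge v (0 + 1) (of_int b * of_int n)"
      by (intro vge_mult vge_of_int sf_closed[OF F])
    moreover have "vge v 1 (of_int (a * int l))" using vge_of_int_dvd[of 1 "a * int l"] by simp
    ultimately have "vge v 1 (of_int (a * int l) + of_int b * of_int n)"
      by (intro vge_add sf_closed[OF F]) auto
    also have "of_int (a * int l) + of_int b * of_int n = (1 :: complex)"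
      unfolding of_int_mult[symmetric] of_int_add[symmetric] ab by simp
    finally show False by (simp add: vge_def v_1)
  qed
  then show "v (of_int n) = 0" using vge_of_int[of n] n by (auto simp: vge_def)
qed

lemma v_of_nat_unit: "\<not> l dvd n \<Longrightarrow> v (of_nat n) = 0"
  using v_of_int_unit(1)[of "int n"] by simp

lemma vge_of_int_1_iff: "vge v 1 (of_int n) \<longleftrightarrow> int l dvd n"
  using vge_of_int_dvd[of 1 n] v_of_int_unit[of n] by (cases "int l dvd n") (auto simp: vge_def)

text \<open>The leftmost lowest point of the Newton polygon of \<open>q\<close>. Such points add up under multiplication,
  which replaces Gauss's lemma in the proof of Eisenstein's criterion.\<close>
lemma min_coeff:
  assumes q: "q \<in> polys F" "q \<noteq> 0"
  obtains a i where "coeff q i \<noteq> 0" "v (coeff q i) = a" "\<And>j. vge v a (coeff q j)" "\<And>j. j < i \<Longrightarrow> vge v (a + 1) (coeff q j)"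
proof -
  let ?S = "{j. coeff q j \<noteq> 0}"
  have fin: "finite ?S" by (rule finite_subset[of _ "{..degree q}"]) (auto intro: le_degree)
  have ne: "?S \<noteq> {}" using q(2) by (auto intro!: exI[of _ "degree q"])
  define a where "a = Min ((\<lambda>j. v (coeff q j)) ` ?S)"
  have "a \<in> (\<lambda>j. v (coeff q j)) ` ?S" unfolding a_def using fin ne by (intro Min_in) auto
  then have ex: "\<exists>j. coeff q j \<noteq> 0 \<and> v (coeff q j) = a" by auto
  define i where "i = (LEAST j. coeff q j \<noteq> 0 \<and> v (coeff q j) = a)"
  have i: "coeff q i \<noteq> 0" "v (coeff q i) = a" using LeastI_ex[OF ex] by (auto simp: i_def)
  have ge: "vge v a (coeff q j)" for j
    unfolding vge_def a_def using fin by (auto intro!: Min_le)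
  moreover have "vge v (a + 1) (coeff q j)" if "j < i" for j
    using not_less_Least[of j "\<lambda>j. coeff q j \<noteq> 0 \<and> v (coeff q j) = a"] that ge[of j]
    by (auto simp: vge_def i_def)
  ultimately show ?thesis using that i by blast
qed

lemma coeff_mult_corner:
  assumes q: "q \<in> polys F" "coeff q i \<noteq> 0" "v (coeff q i) = a" "\<And>k. vge v a (coeff q k)" "\<And>k. k < i \<Longrightarrow> vge v (a + 1) (coeff q k)"
    and r: "r \<in> polys F" "coeff r j \<noteq> 0" "v (coeff r j) = b" "\<And>k. vge v b (coeff r k)" "\<And>k. k < j \<Longrightarrow> vge v (b + 1) (coeff r k)"
  shows "coeff (q * r) (i + j) \<noteq> 0" "v (coeff (q * r) (i + j)) = a + b"
proof -
  define x where "x = coeff q i * coeff r j"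
  define y where "y = (\<Sum>k\<in>{..i + j} - {i}. coeff q k * coeff r (i + j - k))"
  have sum: "coeff (q * r) (i + j) = x + y"
    unfolding coeff_mult x_def y_def by (subst sum.remove[of _ i]) auto
  have x: "x \<in> F" "x \<noteq> 0" "v x = a + b"
    unfolding x_def using q r by (auto simp: v_mult polysD intro!: sf_mult[OF F])
  \<comment> \<open>In every other term one of the two factors lies to the left of its corner, which
    raises the bound for the product by one.\<close>
  have "vge v (a + b + 1) (coeff q k * coeff r (i + j - k))" if "k \<le> i + j" "k \<noteq> i" for k
  proof (cases "k < i")
    case True
    then show ?thesis
      by (intro vge_mult'[OF polysD[OF q(1)] polysD[OF r(1)] q(5) r(4)]) auto
  next
    case False
    with that have "i + j - k < j" by auto
    then show ?thesis
      by (intro vge_mult'[OF polysD[OF q(1)] polysD[OF r(1)] q(4) r(5)]) auto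
  qed
  then have "vge v (v x + 1) y" unfolding y_def x(3)
    by (intro vge_sum conjI sf_mult[OF F] polysD q r) auto
  moreover have "y \<in> F" unfolding y_def by (intro sf_sum[OF F] sf_mult[OF F] polysD q r)
  ultimately show "coeff (q * r) (i + j) \<noteq> 0" "v (coeff (q * r) (i + j)) = a + b"
    using v_add_eq[OF x(1) _ x(2), of y] x(3) sum by auto
qed

text \<open>The factors are not assumed integral. As they are monic, the heights a, b of their
  corners are at most 0. The corner of \<open>f\<close> then can only sit at its leading
  coefficient, so both corners are leading coefficients of height 0. Both constant terms have
  valuation at least 1, and that of \<open>f\<close> at least 2.\<close>

theorem Eisenstein:
  assumes f: "f \<in> polys F" "lead_coeff f = 1" "degree f > 0"
    and low: "\<And>i. i < degree f \<Longrightarrow> vge v 1 (coeff f i)" and const: "coeff f 0 \<noteq> 0" "v (coeff f 0) = 1"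
  shows "irr F f"
proof (rule irrI[OF F f])
  fix q r assume qr: "q \<in> polys F" "r \<in> polys F" "f = q * r" "lead_coeff q = 1" "lead_coeff r = 1"
    "degree q > 0" "degree r > 0"
  have nz: "q \<noteq> 0" "r \<noteq> 0" using qr by auto
  obtain a i where a: "coeff q i \<noteq> 0" "v (coeff q i) = a" "\<And>j. vge v a (coeff q j)" "\<And>j. j < i \<Longrightarrow> vge v (a + 1) (coeff q j)"
    using min_coeff[OF qr(1) nz(1)] by metis
  obtain b j where b: "coeff r j \<noteq> 0" "v (coeff r j) = b" "\<And>k. vge v b (coeff r k)" "\<And>k. k < j \<Longrightarrow> vge v (b + 1) (coeff r k)"
    using min_coeff[OF qr(2) nz(2)] by metis
  have ab: "a \<le> 0" "b \<le> 0" using a(3)[of "degree q"] b(3)[of "degree r"] qr(4,5) by (auto simp: vge_def v_1)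
  note c = coeff_mult_corner[OF qr(1) a qr(2) b, folded qr(3)]
  have deg: "degree f = degree q + degree r" unfolding qr(3) using nz by (rule degree_mult_eq)
  have ij: "i \<le> degree q" "j \<le> degree r" using a(1) b(1) by (auto intro: le_degree)
  have "\<not> i + j < degree f" using low[of "i + j"] c ab by (auto simp: vge_def)
  then have ij': "i = degree q" "j = degree r" using ij deg by auto
  have "i + j = degree f" using ij' deg by simp
  then have "a + b = 0" using c(2) f(2) v_1 by simp
  with ab have "a = 0" "b = 0" by auto
  then have "vge v 1 (coeff q 0)" "vge v 1 (coeff r 0)" using a(4)[of 0] b(4)[of 0] ij' qr by auto
  then have "vge v (1 + 1) (coeff q 0 * coeff r 0)" by (intro vge_mult polysD qr)
  moreover have "coeff f 0 = coeff q 0 * coeff r 0" unfolding qr(3) by (simp add: coeff_mult)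
  ultimately show False using const by (simp add: vge_def)
qed

section \<open>Extending a valuation along an approximated root\<close>

lemma poly_bound:
  assumes "q \<in> polys F"
  shows "\<exists>B. \<forall>x\<in>F. vge v 0 x \<longrightarrow> vge v B (poly q x)"
  using assms
proof (induction q)
  case (pCons a q)
  then have aq: "a \<in> F" "q \<in> polys F" by (auto simp: pCons_in_polys_iff)
  with pCons obtain B where B: "\<And>x. x \<in> F \<Longrightarrow> vge v 0 x \<Longrightarrow> vge v B (poly q x)" by blast
  have "vge v (min (v a) B) (poly (pCons a q) x)" if x: "x \<in> F" "vge v 0 x" for x
  proof -
    have "vge v (min (v a) B) a" by (simp add: vge_def)
    moreover have "vge v (min (v a) B) (x * poly q x)"
      by (rule vge_mult'[OF x(1) polys_poly[OF F aq(2) x(1)] x(2) B[OF x]]) simp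
    ultimately show ?thesis using aq x by (auto intro!: vge_add sf_mult[OF F] polys_poly[OF F])
  qed
  then show ?case by blast
qed simp

text \<open>Induction through x q(x) - y q(y) = x (q(x) - q(y)) + (x - y) q(y). The constant
  \<open>B\<close> absorbs coefficients that are not integral and may be negative.\<close>

lemma poly_lipschitz:
  assumes "q \<in> polys F"
  shows "\<exists>B. \<forall>x\<in>F. \<forall>y\<in>F. \<forall>N. vge v 0 x \<longrightarrow> vge v 0 y \<longrightarrow> vge v N (x - y) \<longrightarrow> vge v (N + B) (poly q x - poly q y)"
  using assms
proof (induction q)
  case (pCons a q)
  then have aq: "a \<in> F" "q \<in> polys F" by (auto simp: pCons_in_polys_iff)
  with pCons obtain B where B: "\<And>x y N. x \<in> F \<Longrightarrow> y \<in> F \<Longrightarrow> vge v 0 x \<Longrightarrow> vge v 0 y \<Longrightarrow> vge v N (x - y) \<Longrightarrow>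
    vge v (N + B) (poly q x - poly q y)" by blast
  obtain C where C: "\<And>x. x \<in> F \<Longrightarrow> vge v 0 x \<Longrightarrow> vge v C (poly q x)" using poly_bound[OF aq(2)] by blast
  have "vge v (N + min B C) (poly (pCons a q) x - poly (pCons a q) y)"
    if x: "x \<in> F" "vge v 0 x" and y: "y \<in> F" "vge v 0 y" and N: "vge v N (x - y)" for x y N
  proof -
    have qF: "poly q x \<in> F" "poly q y \<in> F" using aq x y polys_poly[OF F] by auto
    have "vge v (N + min B C) (x * (poly q x - poly q y))"
      by (rule vge_mult'[OF x(1) sf_diff[OF F qF] x(2) B[OF x(1) y(1) x(2) y(2) N]]) simp
    moreover have "vge v (N + min B C) ((x - y) * poly q y)"
      by (rule vge_mult'[OF sf_diff[OF F x(1) y(1)] qF(2) N C[OF y]]) simp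
    ultimately have "vge v (N + min B C) (x * (poly q x - poly q y) + (x - y) * poly q y)"
      using qF x y by (intro vge_add sf_mult[OF F] sf_diff[OF F])
    then show ?thesis by (simp add: algebra_simps)
  qed
  then show ?case by blast
qed simp

text \<open>\<open>\<alpha>\<close> is approximated by the sequence \<open>d\<close>: the extended valuation of \<open>q(\<alpha>)\<close> is the eventual
  valuation of \<open>q(d k)\<close>.\<close>
theorem valuation_extension:
  fixes d :: "nat \<Rightarrow> complex"
  assumes f: "irr F f" "poly f \<alpha> = 0"
    and d: "\<And>k. d k \<in> F" "\<And>k. vge v 0 (d k)"
    and cauchy: "\<And>N. \<exists>k0. \<forall>j\<ge>k0. \<forall>k\<ge>k0. vge v N (d j - d k)"
    and zero: "\<And>N. \<exists>k0. \<forall>k\<ge>k0. vge v N (poly f (d k))"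
  obtains v' where "valued_field (adj F \<alpha>) l v'" "\<And>x. x \<in> F \<Longrightarrow> x \<noteq> 0 \<Longrightarrow> v' x = v x" "vge v' 0 \<alpha>"
    "\<And>x N. x \<in> adj F \<alpha> \<Longrightarrow> \<exists>y\<in>F. vge v' N (x - y)"
proof -
  have pF: "poly q (d k) \<in> F" if "q \<in> polys F" for q k using polys_poly[OF F that d(1)] .
  have cauchy_poly: "\<exists>k0. \<forall>j\<ge>k0. \<forall>k\<ge>k0. vge v N (poly q (d j) - poly q (d k))" if q: "q \<in> polys F" for q N
  proof -
    obtain B where B: "\<And>x y N. x \<in> F \<Longrightarrow> y \<in> F \<Longrightarrow> vge v 0 x \<Longrightarrow> vge v 0 y \<Longrightarrow> vge v N (x - y) \<Longrightarrow>
      vge v (N + B) (poly q x - poly q y)" using poly_lipschitz[OF q] by blast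
    obtain k0 where "\<forall>j\<ge>k0. \<forall>k\<ge>k0. vge v (N - B) (d j - d k)" using cauchy[of "N - B"] by blast
    then show ?thesis using B[OF d(1) d(1) d(2) d(2), of "N - B"] by (intro exI[of _ k0]) auto
  qed
  \<comment> \<open>A polynomial vanishing at \<open>\<alpha>\<close> is a multiple of
    \<open>f\<close>, so its values along \<open>d\<close> tend to 0. This is what makes the limit
    valuation independent of the polynomial that represents an element.\<close>
  have null: "\<exists>k0. \<forall>k\<ge>k0. vge v N (poly q (d k))" if q: "q \<in> polys F" "poly q \<alpha> = 0" for q N
  proof -
    have "f dvd q" by (rule irr_root_dvd[OF F f q])
    then obtain s where s: "s \<in> polys F" "q = f * s" using polys_dvdE[OF F q(1) irrD(1)[OF f(1)]] by metis
    obtain B where B: "\<And>x. x \<in> F \<Longrightarrow> vge v 0 x \<Longrightarrow> vge v B (poly s x)" using poly_bound[OF s(1)] by blast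
    obtain k0 where "\<forall>k\<ge>k0. vge v (N - B) (poly f (d k))" using zero[of "N - B"] by blast
    then have "vge v N (poly f (d k) * poly s (d k))" if "k \<ge> k0" for k
      using that by (intro vge_mult'[OF pF[OF irrD(1)[OF f(1)]] pF[OF s(1)] _ B[OF d], of "N - B"]) auto
    then show ?thesis unfolding s(2) by auto
  qed
  define lim where "lim q c \<longleftrightarrow> (\<exists>k0. \<forall>k\<ge>k0. poly q (d k) \<noteq> 0 \<and> v (poly q (d k)) = c)" for q c
  \<comment> \<open>From s q + w f = 1 and w f tending to 0 along \<open>d\<close>, the product s q
    is eventually a unit. As the values of \<open>s\<close> are bounded below by \<open>B\<close>,
    those of \<open>q\<close> are at most \<open>-B\<close>; once the values of \<open>q\<close>
    agree to precision \<open>-B + 1\<close>, their valuation is constant.\<close>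
  have ex: "\<exists>c. lim q c" if q: "q \<in> polys F" "poly q \<alpha> \<noteq> 0" for q
  proof -
    have "\<not> f dvd q" using q(2) f(2) by (auto elim: dvdE)
    then obtain s w where sw: "s \<in> polys F" "w \<in> polys F" "s * q + w * f = 1" using irr_coprime[OF F f(1) q(1)] by metis
    obtain B where B: "\<And>x. x \<in> F \<Longrightarrow> vge v 0 x \<Longrightarrow> vge v B (poly s x)" using poly_bound[OF sw(1)] by blast
    have wfK: "w * f \<in> polys F" using sw irrD(1)[OF f(1)] by (intro polys_mult[OF F])
    have "poly (w * f) \<alpha> = 0" using f by simp
    from null[OF wfK this, of 1] obtain k0 where k0: "\<And>k. k \<ge> k0 \<Longrightarrow> vge v 1 (poly (w * f) (d k))" by blast
    have bd: "poly q (d k) \<noteq> 0 \<and> v (poly q (d k)) \<le> -B" if "k \<ge> k0" for k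
    proof -
      have wfF: "poly (w * f) (d k) \<in> F" by (rule pF[OF wfK])
      have one: "poly s (d k) * poly q (d k) = 1 + - poly (w * f) (d k)"
        using arg_cong[OF sw(3), of "\<lambda>p. poly p (d k)"] by (simp add: algebra_simps)
      have "v (1 + - poly (w * f) (d k)) = 0" "1 + - poly (w * f) (d k) \<noteq> 0"
        using v_add_eq[of 1 "- poly (w * f) (d k)"] k0[OF that] wfF sf_1[OF F] v_1
        by (auto simp: vge_uminus sf_uminus[OF F])
      then have "v (poly s (d k) * poly q (d k)) = 0" and nz: "poly s (d k) \<noteq> 0" "poly q (d k) \<noteq> 0"
        unfolding one[symmetric] by auto
      then have "v (poly s (d k)) + v (poly q (d k)) = 0" using v_mult pF sw(1) q(1) by auto
      moreover have "v (poly s (d k)) \<ge> B" using B[OF d, of k] nz by (simp add: vge_def)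
      ultimately show ?thesis using nz by auto
    qed
    obtain k1 where k1: "\<forall>j\<ge>k1. \<forall>k\<ge>k1. vge v (-B + 1) (poly q (d j) - poly q (d k))"
      using cauchy_poly[OF q(1), of "-B + 1"] by blast
    define k2 where "k2 = max k0 k1"
    have "poly q (d k) \<noteq> 0 \<and> v (poly q (d k)) = v (poly q (d k2))" if "k \<ge> k2" for k
    proof -
      have le: "v (poly q (d k2)) + 1 \<le> -B + 1" using bd[OF max.cobounded1[of k0 k1]] by (simp add: k2_def)
      have "k \<ge> k1" "k2 \<ge> k1" using that by (auto simp: k2_def)
      then have "vge v (-B + 1) (poly q (d k) - poly q (d k2))" using k1 by blast
      from vge_mono[OF this le]
      have "vge v (v (poly q (d k2)) + 1) (poly q (d k) - poly q (d k2))" .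
      from v_add_eq[OF pF[OF q(1)] sf_diff[OF F pF[OF q(1)] pF[OF q(1)]] _ this] bd[of k2]
      show ?thesis by (simp add: k2_def)
    qed
    then show ?thesis unfolding lim_def by blast
  qed
  have uniq: "c = c'" if q: "q \<in> polys F" "q' \<in> polys F" "poly q \<alpha> = poly q' \<alpha>" "lim q c" "lim q' c'" for q q' c c'
  proof -
    obtain k0 where k0: "\<And>k. k \<ge> k0 \<Longrightarrow> poly q (d k) \<noteq> 0 \<and> v (poly q (d k)) = c" using q(4) by (auto simp: lim_def)
    obtain k1 where k1: "\<And>k. k \<ge> k1 \<Longrightarrow> poly q' (d k) \<noteq> 0 \<and> v (poly q' (d k)) = c'" using q(5) by (auto simp: lim_def)
    obtain k2 where k2: "\<And>k. k \<ge> k2 \<Longrightarrow> vge v (c + 1) (poly (q' - q) (d k))"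
      using null[OF polys_diff[OF F q(2,1)], of "c + 1"] q(3) by auto
    define k where "k = max k0 (max k1 k2)"
    have "vge v (v (poly q (d k)) + 1) (poly q' (d k) - poly q (d k))" using k0[of k] k2[of k] by (simp add: k_def)
    from v_add_eq[OF pF[OF q(1)] sf_diff[OF F pF[OF q(2)] pF[OF q(1)]] _ this] k0[of k] k1[of k]
    show ?thesis by (simp add: k_def)
  qed
  define v' where "v' x = (THE c. \<exists>q\<in>polys F. poly q \<alpha> = x \<and> lim q c)" for x
  have v'_eq: "v' (poly q \<alpha>) = c" if "q \<in> polys F" "lim q c" for q c
    unfolding v'_def
  proof (rule the_equality)
    show "\<exists>q'\<in>polys F. poly q' \<alpha> = poly q \<alpha> \<and> lim q' c" using that by blast
    fix c' assume "\<exists>q'\<in>polys F. poly q' \<alpha> = poly q \<alpha> \<and> lim q' c'"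
    then obtain q' where q': "q' \<in> polys F" "poly q' \<alpha> = poly q \<alpha>" "lim q' c'" by blast
    show "c' = c" by (rule uniq[OF q'(1) that(1) q'(2,3) that(2)])
  qed
  have v': "\<exists>k0. \<forall>k\<ge>k0. poly q (d k) \<noteq> 0 \<and> v (poly q (d k)) = v' (poly q \<alpha>)" if "q \<in> polys F" "poly q \<alpha> \<noteq> 0" for q
    using ex[OF that] v'_eq[OF that(1)] unfolding lim_def by metis
  have ext: "v' x = v x" if "x \<in> F" "x \<noteq> 0" for x
    using v'_eq[of "[:x:]" "v x"] that by (auto simp: lim_def polys_const[OF F])
  have val: "valued_field (adj F \<alpha>) l v'"
  proof (rule valued_field.intro)
    show "subfield (adj F \<alpha>) C_ring" by (rule adj_sf[OF F irr_alg[OF f]])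
    show "prime l" by (rule l)
    show "v' (complex_of_nat l) = 1" using ext[OF l_in_F] v_prime prime_gt_0_nat[OF l] by simp
  next
    fix x y assume "x \<in> adj F \<alpha>" "y \<in> adj F \<alpha>" and nz: "x \<noteq> 0" "y \<noteq> 0"
    then obtain q r where q: "q \<in> polys F" "x = poly q \<alpha>" and r: "r \<in> polys F" "y = poly r \<alpha>"
      by (auto elim!: adjE)
    obtain k0 where k0: "\<And>k. k \<ge> k0 \<Longrightarrow> poly q (d k) \<noteq> 0 \<and> v (poly q (d k)) = v' x"
      using v'[OF q(1)] q(2) nz by blast
    obtain k1 where k1: "\<And>k. k \<ge> k1 \<Longrightarrow> poly r (d k) \<noteq> 0 \<and> v (poly r (d k)) = v' y"
      using v'[OF r(1)] r(2) nz by blast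
    have "lim (q * r) (v' x + v' y)" unfolding lim_def
      using k0 k1 v_mult[OF pF[OF q(1)] pF[OF r(1)]] by (intro exI[of _ "max k0 k1"]) auto
    from v'_eq[OF polys_mult[OF F q(1) r(1)] this] show "v' (x * y) = v' x + v' y" using q r by simp
    assume "x + y \<noteq> 0"
    then have "poly (q + r) \<alpha> \<noteq> 0" using q r by simp
    from v'[OF polys_add[OF F q(1) r(1)] this] obtain k2 where
      k2: "\<And>k. k \<ge> k2 \<Longrightarrow> poly (q + r) (d k) \<noteq> 0 \<and> v (poly (q + r) (d k)) = v' (x + y)" using q r by auto
    define k where "k = max k0 (max k1 k2)"
    have "min (v (poly q (d k))) (v (poly r (d k))) \<le> v (poly q (d k) + poly r (d k))"
      using k0[of k] k1[of k] k2[of k] by (intro v_add pF q r) (auto simp: k_def)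
    then show "min (v' x) (v' y) \<le> v' (x + y)" using k0[of k] k1[of k] k2[of k] by (simp add: k_def)
  qed
  have "vge v' 0 \<alpha>"
  proof (cases "\<alpha> = 0")
    case False
    have X: "[:0, 1:] \<in> polys F" by (intro polys_linear sf_closed F)
    from v'[OF X] False obtain k0 where "\<And>k. k \<ge> k0 \<Longrightarrow> d k \<noteq> 0 \<and> v (d k) = v' \<alpha>" by auto
    then show ?thesis using d(2)[of k0] by (auto simp: vge_def)
  qed (simp add: vge_def)
  \<comment> \<open>Density of \<open>F\<close>: for x = q(\<alpha>), some value
    \<open>poly q (d k)\<close> is the approximation. It is what later passes the residue field of
    the rationals on to the extension.\<close>
  moreover have "\<exists>y\<in>F. vge v' N (x - y)" if x: "x \<in> adj F \<alpha>" for x N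
  proof -
    obtain q where q: "q \<in> polys F" "x = poly q \<alpha>" using x by (rule adjE)
    obtain k where k: "\<And>j. j \<ge> k \<Longrightarrow> vge v N (poly q (d j) - poly q (d k))"
      using cauchy_poly[OF q(1), of N] by (meson order_refl)
    define r where "r = q - [:poly q (d k):]"
    have r: "r \<in> polys F" unfolding r_def by (intro polys_diff[OF F] polys_const[OF F] q pF)
    have xr: "x - poly q (d k) = poly r \<alpha>" by (simp add: r_def q)
    have "vge v' N (poly r \<alpha>)"
    proof (cases "poly r \<alpha> = 0")
      case False
      from v'[OF r this] obtain k1 where k1: "\<And>j. j \<ge> k1 \<Longrightarrow> poly r (d j) \<noteq> 0 \<and> v (poly r (d j)) = v' (poly r \<alpha>)" by blast
      from k[of "max k k1"] k1[of "max k k1"] show ?thesis by (simp add: vge_def r_def)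
    qed (simp add: vge_def)
    then show ?thesis unfolding xr[symmetric] using pF[OF q(1)] by blast
  qed
  ultimately show ?thesis using that val ext by blast
qed

end

section \<open>The valuation of a rational prime\<close>

lemma multiplicity_add_ge:
  assumes l: "prime (l :: int)" and "a \<noteq> 0" "b \<noteq> 0" "a + b \<noteq> (0 :: int)"
  shows "min (multiplicity l a) (multiplicity l b) \<le> multiplicity l (a + b)"
proof (rule multiplicity_geI)
  show "\<not> is_unit l" using l not_prime_unit by blast
  show "l ^ min (multiplicity l a) (multiplicity l b) dvd a + b"
    by (intro dvd_add; rule multiplicity_dvd') auto
qed fact

lemma Rats_valuation:
  assumes l: "prime (l :: nat)"
  obtains v where "valued_field \<rat> l v"
proof -
  define m where "m a = int (multiplicity (int l) a)" for a :: int
  have pl: "prime (int l)" using l by simp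
  have mm: "m (a * b) = m a + m b" if "a \<noteq> 0" "b \<noteq> 0" for a b
    unfolding m_def using prime_elem_multiplicity_mult_distrib[OF prime_imp_prime_elem[OF pl] that] by simp
  have ma: "min (m a) (m b) \<le> m (a + b)" if "a \<noteq> 0" "b \<noteq> 0" "a + b \<noteq> 0" for a b
    unfolding m_def using multiplicity_add_ge[OF pl that] by simp
  define v where "v x = (THE c. \<exists>a b. a \<noteq> 0 \<and> b \<noteq> 0 \<and> x = of_int a / of_int b \<and> c = m a - m b)" for x :: complex
  have v: "v (of_int a / of_int b) = m a - m b" if "a \<noteq> 0" "b \<noteq> 0" for a b
    unfolding v_def
  proof (rule the_equality)
    show "\<exists>a' b'. a' \<noteq> 0 \<and> b' \<noteq> 0 \<and> (of_int a / of_int b :: complex) = of_int a' / of_int b' \<and> m a - m b = m a' - m b'"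
      using that by blast
    fix c assume "\<exists>a' b'. a' \<noteq> 0 \<and> b' \<noteq> 0 \<and> (of_int a / of_int b :: complex) = of_int a' / of_int b' \<and> c = m a' - m b'"
    then obtain a' b' where ab: "a' \<noteq> 0" "b' \<noteq> 0" "(of_int a / of_int b :: complex) = of_int a' / of_int b'" "c = m a' - m b'"
      by blast
    have "(of_int (a * b') :: complex) = of_int (a' * b)" using ab that by (simp add: field_simps)
    then have "a * b' = a' * b" by (simp only: of_int_eq_iff)
    then have "m a + m b' = m a' + m b" using mm ab that by metis
    then show "c = m a - m b" using ab by simp
  qed
  have frac: "\<exists>a b. a \<noteq> 0 \<and> b \<noteq> 0 \<and> x = of_int a / of_int b" if "x \<in> \<rat>" "x \<noteq> 0" for x :: complex
    using that by (auto elim!: Rats_cases')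
  have "valued_field \<rat> l v"
  proof (rule valued_field.intro)
    show "subfield \<rat> C_ring" by (rule subfield_Rats)
    show "prime l" by fact
    have "m (int l) = 1" unfolding m_def using pl by (metis multiplicity_self not_prime_unit not_prime_0 of_nat_1)
    moreover have "m 1 = 0" by (simp add: m_def)
    ultimately show "v (complex_of_nat l) = 1" using v[of "int l" 1] prime_gt_0_nat[OF l] by simp
  next
    fix x y :: complex assume "x \<in> \<rat>" "y \<in> \<rat>" and nz: "x \<noteq> 0" "y \<noteq> 0"
    then obtain a b c d where ab: "a \<noteq> 0" "b \<noteq> 0" "x = of_int a / of_int b"
      and cd: "c \<noteq> 0" "d \<noteq> 0" "y = of_int c / of_int d" using frac[of x] frac[of y] by blast
    have xy: "x * y = of_int (a * c) / of_int (b * d)" using ab cd by simp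
    show "v (x * y) = v x + v y"
      unfolding xy using ab cd by (subst v) (auto simp: mm v)
    assume nz': "x + y \<noteq> 0"
    have s: "x + y = of_int (a * d + c * b) / of_int (b * d)" using ab cd by (simp add: field_simps)
    have n: "a * d + c * b \<noteq> 0"
    proof
      assume "a * d + c * b = 0"
      then show False using nz' unfolding s by simp
    qed
    have "v (x + y) = m (a * d + c * b) - m (b * d)" unfolding s using n ab cd by (intro v) auto
    moreover have "min (m (a * d)) (m (c * b)) \<le> m (a * d + c * b)" using ab cd n by (intro ma) auto
    ultimately show "min (v x) (v y) \<le> v (x + y)" using ab cd by (simp add: v mm min_def split: if_splits)
  qed
  with that show ?thesis .
qed

section \<open>Integer polynomials\<close>

lemma poly_diff_dvd: "x - y dvd poly h x - poly h (y :: int)"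
proof (induction h)
  case (pCons a h)
  have "poly (pCons a h) x - poly (pCons a h) y = x * (poly h x - poly h y) + (x - y) * poly h y"
    by (simp add: algebra_simps)
  then show ?case using pCons(2) by (metis dvd_add dvd_mult dvd_triv_left)
qed simp

lemma poly_taylor: "\<exists>w. poly h (x + y) = poly h x + y * poly (pderiv h) x + y ^ 2 * (w :: int)"
proof (induction h)
  case (pCons a h)
  then obtain w where w: "poly h (x + y) = poly h x + y * poly (pderiv h) x + y ^ 2 * w" by blast
  show ?case
    by (rule exI[of _ "x * w + poly (pderiv h) x + y * w"])
      (simp add: w pderiv_pCons algebra_simps power2_eq_square)
qed simp

lemma hensel:
  assumes l: "prime (l :: nat)" and c: "int l dvd poly h c" "\<not> int l dvd poly (pderiv h) c"
  obtains d :: "nat \<Rightarrow> int" where "\<And>k. int l ^ Suc k dvd poly h (d k)"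
    "\<And>j k. k \<le> j \<Longrightarrow> int l ^ Suc k dvd d j - d k" "\<And>k. int l dvd d k - c"
proof -
  let ?P = "\<lambda>k x. int l ^ Suc k dvd poly h x \<and> int l dvd x - c"
  let ?Q = "\<lambda>k x y. int l ^ Suc k dvd y - x"
  have pl: "prime (int l)" using l by simp
  have "\<exists>d. \<forall>k. ?P k (d k) \<and> ?Q k (d k) (d (Suc k))"
  proof (rule dependent_nat_choice)
    show "\<exists>x. ?P 0 x" using c(1) by (intro exI[of _ c]) auto
  next
    fix x k assume P: "?P k x"
    then obtain m where m: "poly h x = int l ^ Suc k * m" by (auto elim!: dvdE)
    have "int l dvd poly (pderiv h) x - poly (pderiv h) c"
      using P poly_diff_dvd[of x c "pderiv h"] dvd_trans by blast
    then have "\<not> int l dvd poly (pderiv h) x" using c(2) by (metis dvd_diff_right_iff)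
    then have "coprime (int l) (poly (pderiv h) x)" using pl by (simp add: prime_imp_coprime)
    then obtain a b where ab: "a * int l + b * poly (pderiv h) x = 1" by (metis bezout_int coprime_imp_gcd_eq_1)
    \<comment> \<open>Newton's step: \<open>m\<close> is the quotient of h(x) by the current power
      of \<open>l\<close>, and \<open>b\<close> inverts the derivative at \<open>x\<close> modulo
      \<open>l\<close>.\<close>
    define y where "y = x + int l ^ Suc k * (- m * b)"
    obtain w where w: "poly h y = poly h x + (int l ^ Suc k * (- m * b)) * poly (pderiv h) x + (int l ^ Suc k * (- m * b)) ^ 2 * w"
      unfolding y_def using poly_taylor by blast
    have "poly h x + (int l ^ Suc k * (- m * b)) * poly (pderiv h) x = int l ^ Suc k * (m * (1 - b * poly (pderiv h) x))"
      by (simp add: m algebra_simps)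
    also have "1 - b * poly (pderiv h) x = a * int l" using ab by simp
    finally have 1: "int l ^ Suc (Suc k) dvd poly h x + (int l ^ Suc k * (- m * b)) * poly (pderiv h) x"
      by (simp add: mult.commute mult.left_commute)
    have "int l ^ Suc (Suc k) dvd int l ^ (2 * Suc k)" by (rule le_imp_power_dvd) simp
    then have "int l ^ Suc (Suc k) dvd (int l ^ Suc k * (- m * b)) ^ 2 * w"
      unfolding power_mult_distrib power_mult[symmetric] by (simp add: mult.commute[of _ 2] del: power_Suc)
    with 1 have "int l ^ Suc (Suc k) dvd poly h y" unfolding w by (rule dvd_add)
    moreover have "?Q k x y" by (simp add: y_def)
    moreover have "int l dvd y - c"
    proof -
      have "y - c = (x - c) + int l * (int l ^ k * (- m * b))" by (simp add: y_def algebra_simps)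
      with P show ?thesis by (metis dvd_add dvd_triv_left)
    qed
    ultimately show "\<exists>y. ?P (Suc k) y \<and> ?Q k x y" by blast
  qed
  then obtain d where d: "\<And>k. ?P k (d k)" "\<And>k. ?Q k (d k) (d (Suc k))" by blast
  have "int l ^ Suc k dvd d j - d k" if "k \<le> j" for j k
    using that
  proof (induction j rule: dec_induct)
    case (step n)
    have "int l ^ Suc k dvd int l ^ Suc n" using step by (intro le_imp_power_dvd) simp
    then have "int l ^ Suc k dvd d (Suc n) - d n" using d(2)[of n] dvd_trans by blast
    from dvd_add[OF this step.IH] show ?case by simp
  qed simp
  with d that show ?thesis by blast
qed

text \<open>Euclid's argument: at the multiple \<open>M * j\<close> of h(0) (B + 1)! the value of
  \<open>h\<close> is h(0) times a number congruent to 1 modulo (B + 1)!, and all prime factors of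
  that number exceed \<open>B\<close>. The choice of \<open>j\<close> keeps it different from 1 and
  -1.\<close>

lemma schur:
  assumes h: "degree (h :: int poly) > 0"
  obtains l :: nat and c where "prime l" "l > B" "int l dvd poly h c"
proof (cases "poly h 0 = 0")
  case True
  obtain l :: nat where "prime l" "l > B" using bigger_prime by blast
  then show ?thesis using that[of l 0] True by simp
next
  case False
  define a where "a = poly h 0"
  define M where "M = a * int (fact (B + 1))"
  have M: "M \<noteq> 0" using False fact_nonzero[of "B + 1", where ?'a = int] unfolding M_def a_def of_nat_fact by (metis mult_eq_0_iff)
  have "finite {x. poly (h - [:e:]) x = 0}" for e
    using h by (intro poly_roots_finite) (metis degree_pCons_0 eq_iff_diff_eq_0 less_irrefl)
  then have "finite ({x. poly (h - [:a:]) x = 0} \<union> {x. poly (h - [:-a:]) x = 0})" by blast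
  then have "finite ({x. poly h x = a} \<union> {x. poly h x = -a})" by (simp add: eq_neg_iff_add_eq_0)
  moreover have "infinite (range (\<lambda>j. M * j))"
    using M by (simp add: finite_image_iff inj_on_def infinite_UNIV_int)
  ultimately have "\<not> range (\<lambda>j. M * j) \<subseteq> {x. poly h x = a} \<union> {x. poly h x = -a}"
    using finite_subset by blast
  then obtain j where j: "poly h (M * j) \<noteq> a" "poly h (M * j) \<noteq> -a" by blast
  have "M * j - 0 dvd poly h (M * j) - poly h 0" by (rule poly_diff_dvd)
  then obtain w where "poly h (M * j) = a + M * j * w" unfolding a_def by (metis add.commute diff_add_cancel dvdE minus_int_code(1))
  then have e: "poly h (M * j) = a * (1 + int (fact (B + 1)) * (j * w))" by (simp add: M_def algebra_simps)
  define u where "u = 1 + int (fact (B + 1)) * (j * w)"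
  have e': "poly h (M * j) = a * u" using e unfolding u_def .
  have "u \<noteq> 1" "u \<noteq> -1" using j unfolding e' by auto
  then have "nat \<bar>u\<bar> \<noteq> 1" by linarith
  then obtain l where l: "prime l" "l dvd nat \<bar>u\<bar>" using prime_factor_nat by blast
  have lu: "int l dvd u" using l(2) by (metis dvd_abs_iff int_dvd_int_iff int_nat_eq abs_ge_zero)
  have "l > B"
  proof (rule ccontr)
    assume "\<not> l > B"
    then have "l dvd fact (B + 1)" using prime_gt_0_nat[OF l(1)] by (intro dvd_fact) auto
    then have "int l dvd int (fact (B + 1)) * (j * w)" by (metis dvd_mult2 of_nat_dvd_iff)
    with lu have "int l dvd 1" unfolding u_def using dvd_add_left_iff by blast
    then show False using l(1) by (simp add: prime_nat_iff)
  qed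
  moreover have "int l dvd poly h (M * j)" unfolding e using lu unfolding u_def by simp
  ultimately show ?thesis using that l by blast
qed

abbreviation ipoly :: "int poly \<Rightarrow> complex poly"
  where "ipoly \<equiv> map_poly of_int"

lemma ipoly_pCons: "ipoly (pCons a p) = pCons (of_int a) (ipoly p)"
  by (rule map_poly_pCons) simp

lemma poly_ipoly: "poly (ipoly h) (of_int c) = of_int (poly h c)"
  by (induction h) (simp_all add: ipoly_pCons)

lemma coeff_ipoly: "coeff (ipoly h) i = of_int (coeff h i)"
  by (simp add: coeff_map_poly)

lemma pderiv_ipoly: "pderiv (ipoly h) = ipoly (pderiv h)"
  by (rule poly_eqI) (simp add: coeff_pderiv coeff_ipoly)

lemma degree_ipoly: "degree (ipoly h) = degree h"
  by (rule degree_map_poly) simp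

lemma ipoly_polys: "ipoly h \<in> polys \<rat>"
  by (auto intro!: polysI simp: coeff_ipoly)

lemma clear_denominators:
  assumes "p \<in> polys \<rat>"
  obtains n :: int and h where "n \<noteq> 0" "ipoly h = smult (of_int n) p"
proof -
  have "\<exists>n h. n \<noteq> 0 \<and> ipoly h = smult (of_int n) p"
    using assms
  proof (induction p)
    case (pCons a p)
    then have "a \<in> \<rat>" "p \<in> polys \<rat>" by (auto simp: pCons_in_polys_iff)
    with pCons obtain n h where n: "n \<noteq> 0" "ipoly h = smult (of_int n) p" by blast
    from \<open>a \<in> \<rat>\<close> obtain i j where ij: "j \<noteq> 0" "a = of_int i / of_int j"
      by (elim Rats_cases') (metis less_irrefl)
    have "ipoly (smult j h) = smult (of_int j) (ipoly h)" by (rule poly_eqI) (simp add: coeff_ipoly)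
    then have "ipoly (pCons (n * i) (smult j h)) = smult (of_int (n * j)) (pCons a p)"
      using ij n by (simp add: ipoly_pCons field_simps)
    then show ?case using n ij by (intro exI[of _ "n * j"] exI[of _ "pCons (n * i) (smult j h)"]) auto
  next
    case 0
    show ?case by (rule exI[of _ 1], rule exI[of _ 0]) simp
  qed
  with that show ?thesis by blast
qed

text \<open>The polynomial \<open>g\<close> must be irreducible over \<open>F\<close>, but Hensel's
  lemma runs over the integers, on a multiple \<open>h\<close> of it. So the lemma applies over the
  rationals and also over a number field, as in \<open>doubly_transitive_polynomial\<close>.\<close>

lemma (in valued_field) valuation_extension_hensel:
  assumes g: "irr F g" "poly g \<beta> = 0" and h: "g = smult a (ipoly h)"
    and c: "int l dvd poly h c" "\<not> int l dvd poly (pderiv h) c"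
  obtains v' where "valued_field (adj F \<beta>) l v'" "vge v' 0 \<beta>"
    "\<And>x N. x \<in> adj F \<beta> \<Longrightarrow> \<exists>y\<in>F. vge v' N (x - y)"
proof -
  from hensel[OF l c] obtain d where
    d: "\<And>k. int l ^ Suc k dvd poly h (d k)" "\<And>j k. k \<le> j \<Longrightarrow> int l ^ Suc k dvd d j - d k" by metis
  define e :: "nat \<Rightarrow> complex" where "e k = of_int (d k)" for k
  have e: "e k \<in> F" "vge v 0 (e k)" for k by (auto simp: e_def vge_of_int sf_of_int[OF F])
  have a: "a \<in> F"
  proof -
    have "lead_coeff (ipoly h) \<in> F" by (simp only: coeff_ipoly sf_of_int[OF F])
    moreover have "a * lead_coeff (ipoly h) = 1" using irrD(2)[OF g(1)] unfolding h by (simp only: lead_coeff_smult)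
    then have "a = inverse (lead_coeff (ipoly h))" by (metis inverse_unique mult.commute)
    ultimately show ?thesis using sf_inverse[OF F] by simp
  qed
  have cauchy: "\<exists>k0. \<forall>j\<ge>k0. \<forall>k\<ge>k0. vge v N (e j - e k)" for N
  proof (intro exI allI impI)
    fix j k assume jk: "nat N \<le> j" "nat N \<le> k"
    have "int l ^ Suc (nat N) dvd (d j - d (nat N)) - (d k - d (nat N))" using d(2)[OF jk(1)] d(2)[OF jk(2)] by (rule dvd_diff)
    then have "int l ^ Suc (nat N) dvd d j - d k" by simp
    from vge_of_int_dvd[OF this] show "vge v N (e j - e k)" by (rule_tac vge_mono) (auto simp: e_def)
  qed
  have zero: "\<exists>k0. \<forall>k\<ge>k0. vge v N (poly g (e k))" for N
  proof (intro exI allI impI)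
    define N' where "N' = N - v a"
    fix k assume k: "nat N' \<le> k"
    have eq: "poly g (e k) = of_int (poly h (d k)) * a" by (simp add: h poly_ipoly e_def)
    have "vge v N' (of_int (poly h (d k)))"
      using vge_of_int_dvd[OF d(1)[of k]] by (rule vge_mono) (use k in linarith)
    then show "vge v N (poly g (e k))" unfolding eq
      by (rule vge_mult'[OF sf_of_int[OF F] a, where k = "v a"]) (auto simp: N'_def vge_def)
  qed
  from valuation_extension[OF g e cauchy zero] that show ?thesis by metis
qed

section \<open>Valuations of number fields\<close>

lemma number_field_sf: "number_field K \<Longrightarrow> sf K"
  by (auto simp: number_field_def fin_ext_def)

lemma number_field_ext: "number_field K \<Longrightarrow> fin_ext K F \<Longrightarrow> number_field F"
  unfolding number_field_def by (rule fin_ext_tower(1))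

text \<open>The last conclusion says that the residue field is the prime field. It holds because a
  simple root modulo \<open>l\<close> gives an embedding into the \<open>l\<close>-adic numbers, in
  which the rationals are dense.\<close>

theorem number_field_valuation:
  assumes F: "number_field F"
  obtains l v where "l > B" "valued_field F l v"
    "\<And>x. x \<in> F \<Longrightarrow> vge v 0 x \<Longrightarrow> \<exists>c :: int. vge v 1 (x - of_int c)"
proof -
  have QF: "fin_ext \<rat> F" using F by (simp add: number_field_def)
  obtain \<theta> where \<theta>: "\<theta> \<in> F" "F = adj \<rat> \<theta>" using primitive_element[OF QF] .
  obtain p where p: "irr \<rat> p" "poly p \<theta> = 0" using minpoly_exists[OF subfield_Rats fin_ext_alg[OF QF \<theta>(1)]] .
  have p': "pderiv p \<in> polys \<rat>"
    using irrD(1)[OF p(1)] by (auto intro!: polysI simp: coeff_pderiv polysD simp del: of_nat_Suc)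
  have "pderiv p \<noteq> 0" using irrD(3)[OF p(1)] by (auto simp: pderiv_eq_0_iff)
  then have "\<not> p dvd pderiv p"
    using irrD(3)[OF p(1)] dvd_imp_degree_le[of p "pderiv p"] by (auto simp: degree_pderiv)
  then obtain u w where uw: "u \<in> polys \<rat>" "w \<in> polys \<rat>" "u * pderiv p + w * p = 1"
    using irr_coprime[OF subfield_Rats p(1) p'] by metis
  obtain n h where h: "n \<noteq> 0" "ipoly h = smult (of_int n) p" using clear_denominators[OF irrD(1)[OF p(1)]] .
  obtain n1 U where U: "n1 \<noteq> 0" "ipoly U = smult (of_int n1) u" using clear_denominators[OF uw(1)] .
  obtain n2 W where W: "n2 \<noteq> 0" "ipoly W = smult (of_int n2) w" using clear_denominators[OF uw(2)] .
  have h': "ipoly (pderiv h) = smult (of_int n) (pderiv p)" using h(2) by (simp add: pderiv_ipoly[symmetric] pderiv_smult)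
  \<comment> \<open>Bezout's identity for \<open>p\<close> and its derivative with denominators
    cleared: a prime dividing both h(c) and h'(c) divides \<open>n * n1 * n2\<close>, so for a
    larger prime the root \<open>c\<close> is simple.\<close>
  have bez: "n2 * poly U c * poly (pderiv h) c + n1 * poly W c * poly h c = n * n1 * n2" for c
  proof -
    have "(of_int (n2 * poly U c * poly (pderiv h) c + n1 * poly W c * poly h c) :: complex)
        = of_int (n * n1 * n2) * poly (u * pderiv p + w * p) (of_int c)"
      by (simp add: poly_ipoly[symmetric] h h' U W algebra_simps)
    also have "\<dots> = of_int (n * n1 * n2)" unfolding uw(3) by simp
    finally show ?thesis by (simp only: of_int_eq_iff)
  qed
  have dh: "degree h > 0" using irrD(3)[OF p(1)] h by (metis degree_ipoly degree_smult_eq of_int_eq_0_iff)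
  obtain l c where l: "prime l" "l > max B (nat \<bar>n * n1 * n2\<bar>)" "int l dvd poly h c" using schur[OF dh] .
  have "\<not> int l dvd poly (pderiv h) c"
  proof
    assume "int l dvd poly (pderiv h) c"
    then have "int l dvd n * n1 * n2" unfolding bez[of c, symmetric] using l(3) by auto
    then have "int l \<le> \<bar>n * n1 * n2\<bar>" using dvd_imp_le_int[of "n * n1 * n2" "int l"] h(1) U(1) W(1) by simp
    then show False using l(2) by linarith
  qed
  note h'' = this
  obtain v where v: "valued_field \<rat> l v" using Rats_valuation[OF l(1)] .
  have "p = smult (inverse (of_int n)) (ipoly h)" using h by simp
  from valued_field.valuation_extension_hensel[OF v p this l(3) h''] obtain v' where
    v': "valued_field F l v'" "\<And>x N. x \<in> F \<Longrightarrow> \<exists>y\<in>\<rat>. vge v' N (x - y)" unfolding \<theta>(2) by metis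
  interpret V': valued_field F l v' by (rule v'(1))
  \<comment> \<open>By density \<open>x\<close> is congruent to a rational number, and a rational
    number integral at \<open>l\<close> has a denominator invertible modulo
    \<open>l\<close>.\<close>
  have "\<exists>c :: int. vge v' 1 (x - of_int c)" if x: "x \<in> F" "vge v' 0 x" for x
  proof -
    obtain y where y: "y \<in> \<rat>" "vge v' 1 (x - y)" using v'(2)[OF x(1)] by blast
    have yF: "y \<in> F" using y(1) Rats_subset_subfield[OF V'.F] by auto
    have "vge v' 0 (x - (x - y))" using y(2) yF x by (intro V'.vge_diff sf_diff[OF V'.F] V'.vge_mono[OF y(2)]) auto
    then have y0: "vge v' 0 y" by simp
    from y(1) obtain a b :: int where ab: "b > 0" "coprime a b" "y = of_int a / of_int b" by (auto elim!: Rats_cases')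
    have lb: "\<not> int l dvd b"
    proof
      assume lb: "int l dvd b"
      then have la: "\<not> int l dvd a" using ab(2) l(1)
        by (meson coprime_common_divisor not_prime_unit prime_nat_int_transfer)
      have "vge v' (0 + 1) (y * of_int b)"
        using y0 yF lb V'.vge_of_int_1_iff by (intro V'.vge_mult sf_of_int[OF V'.F]) auto
      then have "vge v' 1 (of_int a)" using ab by simp
      with la show False using V'.vge_of_int_1_iff by simp
    qed
    then have "coprime (int l) b" using l(1) by (simp add: prime_imp_coprime)
    then obtain s t where st: "s * int l + t * b = 1" by (metis bezout_int coprime_imp_gcd_eq_1)
    have "y - of_int (a * t) = y * (1 - of_int (t * b))" using ab by (simp add: field_simps)
    also have "1 - of_int (t * b) = (of_int (1 - t * b) :: complex)" by simp
    also have "1 - t * b = s * int l" using st by simp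
    finally have eq: "y - of_int (a * t) = y * of_int (s * int l)" .
    have "vge v' (0 + 1) (y * of_int (s * int l))"
      using y0 yF by (intro V'.vge_mult sf_of_int[OF V'.F]) (auto simp only: V'.vge_of_int_1_iff dvd_triv_right)
    then have "vge v' 1 (y - of_int (a * t))" unfolding eq by simp
    then have "vge v' 1 ((x - y) + (y - of_int (a * t)))" using y x yF
      by (intro V'.vge_add sf_diff[OF V'.F] sf_of_int[OF V'.F])
    then show ?thesis by (intro exI[of _ "a * t"]) simp
  qed
  with v'(1) l(2) that show ?thesis by auto
qed

text \<open>\<open>x\<close> is a root of an integer polynomial whose leading coefficient is a unit
  at every large \<open>l\<close>. With negative valuation of \<open>x\<close> the leading term
  would outweigh all the others and the value could not be 0.\<close>

lemma large_prime_integral: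
  assumes F: "number_field F" and x: "x \<in> F"
  obtains B where "\<And>l v. l > B \<Longrightarrow> valued_field F l v \<Longrightarrow> vge v 0 x"
proof -
  have QF: "fin_ext \<rat> F" using F by (simp add: number_field_def)
  obtain p where p: "irr \<rat> p" "poly p x = 0" using minpoly_exists[OF subfield_Rats fin_ext_alg[OF QF x]] .
  obtain n h where h: "n \<noteq> 0" "ipoly h = smult (of_int n) p" using clear_denominators[OF irrD(1)[OF p(1)]] .
  have lc: "lead_coeff h \<noteq> 0" using h irrD(4)[OF p(1)] by auto
  have hx: "poly (ipoly h) x = 0" using h p by simp
  define n where "n = degree h"
  have "vge v 0 x" if lv: "l > nat \<bar>lead_coeff h\<bar>" "valued_field F l v" for l v
  proof (rule ccontr)
    assume "\<not> vge v 0 x"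
    then have vx: "x \<noteq> 0" "v x < 0" by (auto simp: vge_def)
    interpret V: valued_field F l v by fact
    have "\<not> int l dvd lead_coeff h"
    proof
      assume "int l dvd lead_coeff h"
      then have "int l \<le> \<bar>lead_coeff h\<bar>" using dvd_imp_le_int[OF lc, of "int l"] by simp
      then show False using lv by linarith
    qed
    note u = V.v_of_int_unit[OF this]
    define s where "s = of_int (lead_coeff h) * x ^ n"
    define r where "r = (\<Sum>i<n. of_int (coeff h i) * x ^ i)"
    have xF: "x ^ i \<in> F" for i by (rule sf_power[OF V.F x])
    have s: "s \<in> F" "s \<noteq> 0" "v s = int n * v x"
      unfolding s_def using u lc vx x xF by (auto simp: V.v_mult V.v_power sf_of_int[OF V.F] intro!: sf_mult[OF V.F])
    have "vge v (int n * v x + 1) (of_int (coeff h i) * x ^ i)" if "i < n" for i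
    proof (rule V.vge_mult'[OF sf_of_int[OF V.F] xF V.vge_of_int])
      show "vge v (int i * v x) (x ^ i)" using V.v_power[OF x vx(1)] by (simp add: vge_def)
      have "int n * v x \<le> int (i + 1) * v x" using that vx by (intro mult_right_mono_neg) auto
      then show "int n * v x + 1 \<le> 0 + int i * v x" using vx by (simp add: algebra_simps)
    qed
    then have "vge v (v s + 1) r" unfolding r_def s(3)
      by (intro V.vge_sum conjI sf_mult[OF V.F] sf_of_int[OF V.F] xF) auto
    moreover have "r \<in> F" unfolding r_def by (intro sf_sum[OF V.F] sf_mult[OF V.F] sf_of_int[OF V.F] xF)
    ultimately have "s + r \<noteq> 0" using V.v_add_eq(1)[OF s(1) _ s(2)] by auto
    moreover have "s + r = poly (ipoly h) x"
      unfolding poly_altdef degree_ipoly coeff_ipoly s_def r_def n_def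
      by (simp add: lessThan_Suc_atMost[symmetric] add.commute)
    ultimately show False using hx by simp
  qed
  with that show ?thesis by blast
qed

lemma large_prime_unit:
  assumes F: "number_field F" and x: "x \<in> F" "x \<noteq> 0"
  obtains B where "\<And>l v. l > B \<Longrightarrow> valued_field F l v \<Longrightarrow> v x = 0"
proof -
  obtain B1 where B1: "\<And>l v. l > B1 \<Longrightarrow> valued_field F l v \<Longrightarrow> vge v 0 x"
    using large_prime_integral[OF F x(1)] by blast
  obtain B2 where B2: "\<And>l v. l > B2 \<Longrightarrow> valued_field F l v \<Longrightarrow> vge v 0 (inverse x)"
    using large_prime_integral[OF F sf_inverse[OF number_field_sf[OF F] x(1)]] by blast
  have "v x = 0" if "l > max B1 B2" "valued_field F l v" for l v
    using B1[of l v] B2[of l v] that x valued_field.v_inverse[OF that(2) x] by (auto simp: vge_def)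
  with that show ?thesis by blast
qed

section \<open>Cyclic extensions of prescribed degree\<close>

lemma valued_field_subset:
  assumes "valued_field L l v" "sf K" "K \<subseteq> L"
  shows "valued_field K l v"
  using assms unfolding valued_field_def by blast

section \<open>Roots of unity and their residues\<close>

lemma root_of_unity_exists:
  assumes "t > 0"
  obtains z :: complex where "z ^ t = 1" "\<And>s. 0 < s \<Longrightarrow> s < t \<Longrightarrow> z ^ s \<noteq> 1"
proof -
  define z where "z = cis (2 * pi / t)"
  have p: "z ^ s = cis (2 * pi * (s / t))" for s by (simp add: z_def DeMoivre field_simps)
  have "z ^ t = 1" unfolding p using assms by (simp add: cis_2pi)
  moreover have "z ^ s \<noteq> 1" if s: "0 < s" "s < t" for s
  proof
    assume "z ^ s = 1"
    then have "cos (2 * pi * (s / t)) = 1" unfolding p by (metis cis.sel(1) one_complex.sel(1))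
    then obtain k :: int where "2 * pi * (s / t) = of_int k * 2 * pi" using cos_one_2pi_int by auto
    then have "2 * pi * (real s / real t) = 2 * pi * of_int k" by simp
    then have "real s / real t = of_int k" using pi_gt_zero by (subst (asm) mult_left_cancel) auto
    moreover have "0 < real s / real t" "real s / real t < 1" using s by auto
    ultimately have "0 < k" "k < 1" by auto
    then show False by simp
  qed
  ultimately show ?thesis using that by blast
qed

lemma alg_root: "sf K \<Longrightarrow> t > 0 \<Longrightarrow> z ^ t \<in> K \<Longrightarrow> alg K z"
  unfolding alg_def
  by (rule bexI[of _ "monom 1 t - [:z ^ t:]"])
    (auto simp: poly_monom intro!: polys_closed sf_closed dest!: arg_cong[of _ _ degree]
      simp: degree_monom_eq)

lemma simple_fin_ext: "sf K \<Longrightarrow> alg K a \<Longrightarrow> fin_ext K (adj K a)"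
  using minpoly_exists adj_fin_ext(1) by metis

lemma (in valued_field) vge_power_diff:
  assumes "x \<in> F" "y \<in> F" "vge v 0 x" "vge v 0 y" "vge v 1 (x - y)"
  shows "vge v 1 (x ^ n - y ^ n)"
proof (induction n)
  case (Suc n)
  have "vge v (0 + 1) (x * (x ^ n - y ^ n))" using assms Suc by (intro vge_mult sf_closed[OF F])
  moreover have "vge v (1 + int n * 0) ((x - y) * y ^ n)" using assms by (intro vge_mult vge_power sf_closed[OF F])
  ultimately have "vge v 1 (x * (x ^ n - y ^ n) + (x - y) * y ^ n)"
    using assms by (intro vge_add sf_closed[OF F]) auto
  then show ?case by (simp add: algebra_simps)
qed simp

text \<open>\<open>z\<close> reduces to an integer \<open>e\<close> of order exactly
  \<open>t\<close> modulo \<open>l\<close>, and orders divide \<open>l - 1\<close>. If the order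
  \<open>s\<close> were smaller, \<open>w = z ^ s\<close> would be a \<open>t\<close>-th root of
  unity other than 1 that reduces to 1; then the sum of its powers, which is 0, would be congruent
  to \<open>t\<close>, impossible for 0 < t < l.\<close>

lemma (in valued_field) root_of_unity_dvd:
  assumes z: "z \<in> F" "z ^ t = 1" "\<And>s. 0 < s \<Longrightarrow> s < t \<Longrightarrow> z ^ s \<noteq> 1"
    and t: "0 < t" "t < l" and res: "\<exists>c :: int. vge v 1 (z - of_int c)"
  shows "t dvd l - 1"
proof -
  have z0: "z \<noteq> 0" using z(2) t by (metis power_0_left less_irrefl zero_neq_one)
  have "int t * v z = 0" using v_power[OF z(1) z0, of t] z(2) v_1 by simp
  then have vz: "vge v 0 z" using t by (simp add: vge_def)
  obtain c :: int where c: "vge v 1 (z - of_int c)" using res by blast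
  define e where "e = nat (c mod int l)"
  have l0: "int l > 0" using l prime_gt_0_nat by simp
  have e: "int e = c mod int l" using l0 by (simp add: e_def)
  have "vge v 1 (of_int (c - int e))" unfolding vge_of_int_1_iff e by (rule dvd_minus_mod)
  then have "vge v 1 ((z - of_int c) + of_int (c - int e))"
    using c z by (intro vge_add sf_closed[OF F])
  then have ze: "vge v 1 (z - of_nat e)" by simp
  have eF: "of_nat e \<in> F" by (rule sf_of_nat[OF F])
  note pd = vge_power_diff[OF z(1) eF vz vge_of_nat ze]
  have cong: "[e ^ s = 1] (mod l) \<longleftrightarrow> vge v 1 (z ^ s - 1)" for s
  proof -
    have "[e ^ s = 1] (mod l) \<longleftrightarrow> int l dvd int e ^ s - 1"
      by (metis cong_iff_dvd_diff cong_int_iff of_nat_1 of_nat_power)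
    also have "\<dots> \<longleftrightarrow> vge v 1 (of_nat e ^ s - 1)"
      using vge_of_int_1_iff[of "int e ^ s - 1"] by simp
    also have "\<dots> \<longleftrightarrow> vge v 1 (z ^ s - 1)"
    proof
      assume "vge v 1 (of_nat e ^ s - 1)"
      from vge_add[OF _ _ pd[of s] this] show "vge v 1 (z ^ s - 1)"
        using z eF by (simp add: sf_closed[OF F])
    next
      assume "vge v 1 (z ^ s - 1)"
      from vge_diff[OF _ _ this pd[of s]] show "vge v 1 (of_nat e ^ s - 1)"
        using z eF by (simp add: sf_closed[OF F])
    qed
    finally show ?thesis .
  qed
  have "[e ^ t = 1] (mod l)" unfolding cong using z by simp
  then have d: "ord l e dvd t" by (simp only: ord_divides)
  have "ord l e = t"
  proof (rule ccontr)
    assume ne: "ord l e \<noteq> t"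
    define s where "s = ord l e"
    have s: "0 < s" "s < t" using d ne t dvd_imp_le[OF d] dvd_pos_nat[OF t(1) d] by (auto simp: s_def)
    define w where "w = z ^ s"
    have w: "w \<noteq> 1" "w \<in> F" using z(3)[OF s] sf_power[OF F z(1)] by (auto simp: w_def)
    have wt: "w ^ t = 1" using z(2) by (metis w_def power_mult mult.commute power_one)
    have "vge v 1 (w - 1)" using cong[of s] ord[of e l] by (simp add: s_def w_def)
    moreover have "vge v 0 w" using vge_power[OF z(1) vz, of s] by (simp add: w_def)
    ultimately have "vge v 1 (w ^ i - 1)" for i using vge_power_diff[OF w(2) sf_1[OF F] _ vge_1, of i] by simp
    then have "vge v 1 (\<Sum>i<t. w ^ i - 1)" using w by (intro vge_sum conjI sf_closed[OF F])
    moreover have "(\<Sum>i<t. w ^ i) = 0" using w(1) wt by (simp add: geometric_sum)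
    ultimately have "vge v 1 (- of_nat t)" by (simp add: sum_subtractf)
    from vge_uminus[OF _ this] have "vge v 1 (of_int (int t))" by (simp add: sf_closed[OF F])
    then have "l dvd t" unfolding vge_of_int_1_iff by simp
    then show False using t by (simp add: nat_dvd_not_less)
  qed
  moreover have "\<not> l dvd e"
  proof
    assume "l dvd e"
    then have "\<not> coprime l e" using l prime_nat_iff by (metis coprime_absorb_left not_prime_unit)
    then have "ord l e = 0" by (simp add: ord_eq_0)
    with \<open>ord l e = t\<close> t show False by simp
  qed
  then have "[e ^ (l - 1) = 1] (mod l)" by (rule fermat_theorem[OF l])
  then have "ord l e dvd l - 1" by (simp only: ord_divides)
  ultimately show ?thesis by simp
qed

text \<open>The minimal polynomial of \<open>\<zeta> - 1\<close> is Eisenstein.\<close>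
lemma (in valued_field) cyclotomic_degree:
  assumes z: "\<zeta> ^ l = 1" "\<zeta> \<noteq> 1"
  shows "ext_degree F (adj F \<zeta>) = l - 1"
proof -
  \<comment> \<open>This is ((1 + X)^l - 1) / X.\<close>
  define g :: "complex poly" where "g = (\<Sum>i<l. monom (of_nat (l choose Suc i)) i)"
  have l0: "l > 0" "l > 1" using l prime_gt_0_nat prime_gt_1_nat by auto
  have cg: "coeff g i = (if i < l then of_nat (l choose Suc i) else 0)" for i
    by (simp add: g_def coeff_sum)
  have dg: "degree g = l - 1"
  proof (rule antisym)
    show "degree g \<le> l - 1" by (rule degree_le) (auto simp: cg)
    show "l - 1 \<le> degree g" using l0 by (intro le_degree) (simp add: cg)
  qed
  have irr: "irr F g"
  proof (rule Eisenstein)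
    show "g \<in> polys F" by (auto intro!: polysI sf_closed[OF F] simp: cg)
    show "lead_coeff g = 1" using l0 unfolding dg by (simp add: cg)
    show "degree g > 0" using l0 dg by simp
    show "coeff g 0 \<noteq> 0" "v (coeff g 0) = 1" using l0 v_prime by (simp_all add: cg)
    fix i assume "i < degree g"
    then have i: "Suc i < l" using dg by simp
    then have "l dvd l choose Suc i" using l by (intro dvd_choose_prime) auto
    then have "vge v 1 (of_int (int (l choose Suc i)))" unfolding vge_of_int_1_iff by simp
    then show "vge v 1 (coeff g i)" using i by (simp add: cg)
  qed
  define w where "w = \<zeta> - 1"
  have "w * poly g w = (\<Sum>i<l. of_nat (l choose Suc i) * w ^ Suc i)"
    by (simp add: g_def poly_sum poly_monom sum_distrib_left mult_ac)
  also have "\<dots> = (\<Sum>k\<le>l. of_nat (l choose k) * w ^ k) - 1"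
    by (simp add: sum.atMost_shift)
  also have "(\<Sum>k\<le>l. of_nat (l choose k) * w ^ k) = (w + 1) ^ l" by (simp add: binomial_ring)
  also have "\<dots> - 1 = 0" using z by (simp add: w_def)
  finally have root: "poly g w = 0" using z by (simp add: w_def)
  have a: "alg F \<zeta>" by (rule alg_root[OF F l0(1)]) (simp add: z sf_1[OF F])
  have "adj F w = adj F \<zeta>"
  proof
    show "adj F w \<subseteq> adj F \<zeta>" unfolding w_def
      by (intro adj_least adj_sf a F adj_base sf_diff[OF adj_sf[OF F a]] adj_gen sf_1[OF adj_sf[OF F a]])
    have aw: "alg F w" by (rule irr_alg[OF irr root])
    have "w + 1 \<in> adj F w" by (intro sf_add[OF adj_sf[OF F aw]] adj_gen F sf_1[OF adj_sf[OF F aw]])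
    then show "adj F \<zeta> \<subseteq> adj F w"
      by (intro adj_least adj_sf aw F adj_base) (simp add: w_def)
  qed
  then show ?thesis using adj_fin_ext(2)[OF F irr root] dg by simp
qed

section \<open>The fixed field of a power of a cyclic generator\<close>

lemma dimension_subspace_eq:
  assumes K: "sf K" and "C.dimension n K V" "C.dimension n K E" "V \<subseteq> E"
  shows "V = E"
proof -
  obtain Vs where Vs: "C.independent K Vs" "length Vs = n" "C.Span K Vs = V"
    using C.exists_base[OF K assms(2)] by blast
  have "set Vs \<subseteq> V" using C.Span_base_incl[OF K, of Vs] Vs by auto
  then show ?thesis
    using C.independent_length_eq_dimension[OF K assms(3) Vs(1)] Vs assms(4) by auto
qed

lemma emb_funpow:
  assumes E: "sf E" and s: "emb E \<sigma>" "\<And>x. x \<in> E \<Longrightarrow> \<sigma> x \<in> E"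
  shows "emb E (\<sigma> ^^ n)" "\<And>x. x \<in> E \<Longrightarrow> (\<sigma> ^^ n) x \<in> E"
proof -
  have *: "(\<sigma> ^^ n) x \<in> E" if "x \<in> E" for x n using that s by (induction n) auto
  then show "\<And>x. x \<in> E \<Longrightarrow> (\<sigma> ^^ n) x \<in> E" .
  show "emb E (\<sigma> ^^ n)"
    by (induction n) (use * s in \<open>auto simp: emb_def\<close>)
qed

lemma sum_lessThan_add: "(\<Sum>i<a + b. f i) = (\<Sum>i<a. f i) + (\<Sum>i<b. f (a + i :: nat) :: complex)"
  by (induction b) auto

lemma sum_lessThan_mult: "(\<Sum>i<t * m. f i) = (\<Sum>r<t. \<Sum>q<m. f (r + t * q :: nat) :: complex)"
proof (induction m)
  case (Suc m)
  have "t * Suc m = t * m + t" by simp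
  then have "(\<Sum>i<t * Suc m. f i) = (\<Sum>i<t * m. f i) + (\<Sum>r<t. f (t * m + r))" by (simp only: sum_lessThan_add)
  then show ?case using Suc by (simp add: sum.distrib add.commute)
qed simp

text \<open>In \<open>E = adj K \<zeta>\<close>, of degree l - 1 = t m, a primitive root
  \<open>g\<close> modulo \<open>l\<close> gives the automorphism \<open>\<sigma>\<close> with
  \<open>\<zeta>\<close> sent to its \<open>g\<close>-th power. \<open>F\<close> is the fixed field
  of \<open>\<sigma> ^^ t\<close>; the Gaussian periods \<open>\<eta> r\<close> with r < t form a
  basis, and the powers of \<open>\<sigma>\<close> below \<open>t\<close> differ at
  \<open>\<eta> 0\<close>, which supplies \<open>t\<close> automorphisms.\<close>

theorem cyclic_extension:
  assumes K: "number_field K" and t: "t > 0"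
  obtains F where "galois_ext K F" "ext_degree K F = t"
proof -
  note sK = number_field_sf[OF K]
  obtain z :: complex where z: "z ^ t = 1" "\<And>s. 0 < s \<Longrightarrow> s < t \<Longrightarrow> z ^ s \<noteq> 1" using root_of_unity_exists[OF t] by blast
  have az: "alg K z" by (rule alg_root[OF sK t]) (simp add: z sf_1[OF sK])
  have "number_field (adj K z)" by (rule number_field_ext[OF K simple_fin_ext[OF sK az]])
  then obtain l v where lv: "l > t" "valued_field (adj K z) l v"
    "\<And>x. x \<in> adj K z \<Longrightarrow> vge v 0 x \<Longrightarrow> \<exists>c :: int. vge v 1 (x - of_int c)" using number_field_valuation by metis
  interpret Z: valued_field "adj K z" l v by (rule lv(2))
  interpret V: valued_field K l v by (rule valued_field_subset[OF lv(2) sK adj_base[OF sK]])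
  have zin: "z \<in> adj K z" by (rule adj_gen[OF sK])
  have "int t * v z = v (z ^ t)" using Z.v_power[OF zin, of t] z t by (metis power_0_left less_irrefl zero_neq_one)
  then have "vge v 0 z" using t z Z.v_1 by (simp add: vge_def)
  then have "t dvd l - 1" using Z.root_of_unity_dvd[OF zin z t lv(1)] lv(3)[OF zin] by blast
  then obtain m where m: "l - 1 = t * m" by (auto elim: dvdE)
  have l1: "l > 1" using Z.l prime_gt_1_nat by blast
  obtain \<zeta> :: complex where \<zeta>: "\<zeta> ^ l = 1" "\<And>s. 0 < s \<Longrightarrow> s < l \<Longrightarrow> \<zeta> ^ s \<noteq> 1"
    using root_of_unity_exists[of l] l1 by auto
  have \<zeta>1: "\<zeta> \<noteq> 1" "\<zeta> \<noteq> 0" using \<zeta>(2)[of 1] \<zeta>(1) l1 by (auto simp: power_0_left)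
  define E where "E = adj K \<zeta>"
  have aE: "alg K \<zeta>" by (rule alg_root[OF sK, of l]) (use l1 \<zeta> sf_1[OF sK] in auto)
  have E: "fin_ext K E" unfolding E_def by (rule simple_fin_ext[OF sK aE])
  note E' = fin_extD[OF E]
  have zE: "\<zeta> \<in> E" unfolding E_def by (rule adj_gen[OF sK])
  have dE: "ext_degree K E = t * m" unfolding E_def using V.cyclotomic_degree[OF \<zeta>(1) \<zeta>1(1)] m by simp
  obtain p where p: "irr K p" "poly p \<zeta> = 0" using minpoly_exists[OF sK aE] .
  have dp: "degree p = l - 1" using adj_fin_ext(2)[OF sK p] dE m by (simp add: E_def)
  \<comment> \<open>The minimal polynomial of \<open>\<zeta>\<close> divides 1 + X + ... + X^(l-1)
    and has the same degree, so every \<open>l\<close>-th root of unity other than 1 is a root of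
    it.\<close>
  define \<Phi> :: "complex poly" where "\<Phi> = (\<Sum>i<l. monom 1 i)"
  have c\<Phi>: "coeff \<Phi> i = (if i < l then 1 else 0)" for i by (simp add: \<Phi>_def coeff_sum)
  have root\<Phi>: "poly \<Phi> x = 0" if "x ^ l = 1" "x \<noteq> 1" for x
    using that by (simp add: \<Phi>_def poly_sum poly_monom geometric_sum)
  have "\<Phi> \<in> polys K" by (auto intro!: polysI sf_closed[OF sK] simp: c\<Phi>)
  then have "p dvd \<Phi>" using irr_root_dvd[OF sK p] root\<Phi>[OF \<zeta>(1) \<zeta>1(1)] by blast
  then obtain s where s: "\<Phi> = p * s" by (auto elim: dvdE)
  have "\<Phi> \<noteq> 0" using c\<Phi>[of 0] l1 by auto
  have "degree \<Phi> \<le> l - 1" by (rule degree_le) (auto simp: c\<Phi>)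
  with s dp \<open>\<Phi> \<noteq> 0\<close> have "degree s = 0" by (auto simp: degree_mult_eq)
  then obtain a where a: "s = [:a:]" by (rule degree_eq_zeroE)
  have rootp: "poly p x = 0" if "x ^ l = 1" "x \<noteq> 1" for x
    using root\<Phi>[OF that] \<open>\<Phi> \<noteq> 0\<close> unfolding s a by auto
  obtain g where g: "residue_primroot l g" using prime_primitive_root_exists[OF l1 Z.l] by blast
  have g': "coprime l g" using g by (simp add: residue_primroot_def)
  \<comment> \<open>The powers of \<open>\<zeta>\<close> with exponents 1, ..., l - 1, listed in the
    order in which \<open>\<sigma>\<close> acts by a shift of the index.\<close>
  define b where "b i = \<zeta> ^ (g ^ i)" for i :: nat
  have \<zeta>mod: "\<zeta> ^ i = \<zeta> ^ (i mod l)" for i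
    using \<zeta>(1) by (metis div_mult_mod_eq mult_1 mult.commute power_add power_mult power_one)
  have bE: "b i \<in> E" for i unfolding b_def by (rule sf_power[OF E'(2) zE])
  have bper: "b (i + t * m) = b i" for i
  proof -
    have "\<not> l dvd g" using g' Z.l by (metis coprime_absorb_left not_prime_unit)
    then have "[g ^ (l - 1) = 1] (mod l)" by (rule fermat_theorem[OF Z.l])
    then have "[g ^ i * g ^ (t * m) = g ^ i * 1] (mod l)" unfolding m by (intro cong_mult cong_refl)
    then have "g ^ (i + t * m) mod l = g ^ i mod l" by (simp add: power_add cong_def)
    then show ?thesis unfolding b_def by (metis \<zeta>mod)
  qed
  have bij: "bij_betw (\<lambda>i. g ^ i mod l) {..<t * m} {0<..<l}"
    using residue_primroot_is_generator[OF l1 g] Z.l m by (simp add: totient_prime totatives_prime)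
  have indep: "\<forall>i<t * m. c i = 0" if c: "\<And>i. i < t * m \<Longrightarrow> c i \<in> K" "(\<Sum>i<t * m. c i * b i) = 0" for c
  proof -
    define e where "e = the_inv_into {..<t * m} (\<lambda>i. g ^ i mod l)"
    have e: "e (g ^ i mod l) = i" if "i < t * m" for i
      unfolding e_def using bij that by (intro the_inv_into_f_f) (auto simp: bij_betw_def)
    \<comment> \<open>Dividing the relation by \<open>\<zeta>\<close> moves the exponents 1, ..., l
      - 1 down to 0, ..., l - 2, below the degree of the minimal polynomial.\<close>
    define q where "q = (\<Sum>j\<in>{0<..<l}. monom (c (e j)) (j - 1))"
    have eK: "c (e j) \<in> K" if j: "j \<in> {0<..<l}" for j
    proof -
      obtain i where "i < t * m" "j = g ^ i mod l" using j bij unfolding bij_betw_def by blast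
      with e c(1) show ?thesis by simp
    qed
    have qK: "q \<in> polys K" unfolding q_def using eK by (intro polys_sum polys_monom sK)
    have "\<zeta> * poly q \<zeta> = (\<Sum>j\<in>{0<..<l}. c (e j) * \<zeta> ^ j)"
      unfolding q_def poly_sum sum_distrib_left
      by (intro sum.cong refl) (auto simp: poly_monom power_eq_if)
    also have "\<dots> = (\<Sum>i<t * m. c (e (g ^ i mod l)) * \<zeta> ^ (g ^ i mod l))"
      by (rule sum.reindex_bij_betw[OF bij, symmetric])
    also have "\<dots> = (\<Sum>i<t * m. c i * b i)" by (intro sum.cong refl) (auto simp: e b_def \<zeta>mod[symmetric])
    finally have "poly q \<zeta> = 0" using c \<zeta>1 by simp
    with qK have "p dvd q" by (intro irr_root_dvd[OF sK p])
    have cq: "coeff q i = (if Suc i < l then c (e (Suc i)) else 0)" for i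
    proof -
      have "coeff q i = (\<Sum>j\<in>{0<..<l}. if j = Suc i then c (e j) else 0)"
        unfolding q_def coeff_sum by (intro sum.cong refl) auto
      then show ?thesis by simp
    qed
    have "degree q < l - 1 \<or> q = 0"
    proof -
      have "degree q \<le> l - 2" by (rule degree_le) (auto simp: cq)
      moreover have "q = 0" if "l = 2"
        using that \<open>p dvd q\<close> dp \<open>degree q \<le> l - 2\<close> dvd_imp_degree_le[of p q] by (cases "q = 0") auto
      ultimately show ?thesis using l1 by linarith
    qed
    then have "q = 0" using \<open>p dvd q\<close> dp dvd_imp_degree_le[of p q] by force
    then have z: "c (e (Suc i)) = 0" if "Suc i < l" for i using cq[of i] that by simp
    show ?thesis
    proof (intro allI impI)
      fix i assume i: "i < t * m"
      then have "g ^ i mod l \<in> {0<..<l}" using bij by (auto simp: bij_betw_def)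
      then show "c i = 0" using z[of "g ^ i mod l - 1"] e[OF i] by simp
    qed
  qed
  have Ebasis: "E = {\<Sum>i<t * m. c i * b i | c. \<forall>i<t * m. c i \<in> K}"
  proof (rule dimension_subspace_eq[OF sK _ _, symmetric])
    show "C.dimension (t * m) K {\<Sum>i<t * m. c i * b i | c. \<forall>i<t * m. c i \<in> K}"
      by (rule dimension_basis[OF sK indep])
    show "C.dimension (t * m) K E" using E'(4) dE by simp
    show "{\<Sum>i<t * m. c i * b i | c. \<forall>i<t * m. c i \<in> K} \<subseteq> E"
      using E'(3) bE by (auto intro!: sf_sum[OF E'(2)] sf_mult[OF E'(2)])
  qed
  have "poly p (\<zeta> ^ g) = 0"
  proof (rule rootp)
    show "(\<zeta> ^ g) ^ l = 1" using \<zeta>(1) by (metis power_mult mult.commute power_one)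
    have "\<not> l dvd g" using g' Z.l by (metis coprime_absorb_left not_prime_unit)
    then have "0 < g mod l" "g mod l < l" using l1 by (auto simp: dvd_eq_mod_eq_0)
    then show "\<zeta> ^ g \<noteq> 1" using \<zeta>(2)[of "g mod l"] \<zeta>mod[of g] by simp
  qed
  moreover have "emb K (\<lambda>x. x)" by (simp add: emb_def)
  ultimately obtain \<sigma> where \<sigma>: "emb E \<sigma>" "\<And>x. x \<in> K \<Longrightarrow> \<sigma> x = x" "\<sigma> \<zeta> = \<zeta> ^ g"
    using emb_extend[OF sK _ p, of "\<lambda>x. x" "\<zeta> ^ g"] by (auto simp: E_def map_poly_idI)
  have \<sigma>b: "\<sigma> (b i) = b (Suc i)" for i
    unfolding b_def using emb_power[OF E'(2) \<sigma>(1) zE] \<sigma>(3) by (simp add: power_mult[symmetric])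
  have \<sigma>E: "\<sigma> x \<in> E" if x: "x \<in> E" for x
  proof -
    obtain c where c: "\<forall>i<t * m. c i \<in> K" "x = (\<Sum>i<t * m. c i * b i)" using x Ebasis by auto
    have "\<sigma> x = (\<Sum>i<t * m. \<sigma> (c i * b i))" unfolding c(2)
      using c E'(3) bE by (intro emb_sum[OF E'(2) \<sigma>(1)] sf_mult[OF E'(2)]) auto
    also have "\<dots> = (\<Sum>i<t * m. c i * b (Suc i))"
      using c E'(3) bE by (intro sum.cong refl) (auto simp: emb_mult[OF E'(2) \<sigma>(1)] \<sigma>(2) \<sigma>b)
    also have "\<dots> \<in> E" using c E'(3) bE by (intro sf_sum[OF E'(2)] sf_mult[OF E'(2)]) auto
    finally show ?thesis .
  qed
  define \<tau> where "\<tau> = \<sigma> ^^ t"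
  note pw = emb_funpow[OF E'(2) \<sigma>(1) \<sigma>E]
  have pwK: "(\<sigma> ^^ n) x = x" if "x \<in> K" for n x using that \<sigma>(2) by (induction n) auto
  have pwb: "(\<sigma> ^^ n) (b i) = b (i + n)" for n i by (induction n) (auto simp: \<sigma>b)
  note \<tau> = pw[of t, folded \<tau>_def]
  define F where "F = {x \<in> E. \<tau> x = x}"
  \<comment> \<open>The Gaussian period: the sum over the orbit of \<open>b r\<close> under
    \<open>\<tau>\<close>.\<close>
  define \<eta> where "\<eta> r = (\<Sum>q<m. b (r + t * q))" for r
  have m0: "m > 0" using m l1 by (cases m) auto
  have \<eta>E: "\<eta> r \<in> E" for r unfolding \<eta>_def by (intro sf_sum[OF E'(2)] bE)
  have pw\<eta>: "(\<sigma> ^^ n) (\<eta> r) = \<eta> (r + n)" for n r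
    unfolding \<eta>_def using bE by (subst emb_sum[OF E'(2) pw(1)]) (auto simp: pwb algebra_simps)
  have \<eta>per: "\<eta> (r + t) = \<eta> r" for r
  proof -
    obtain m' where m': "m = Suc m'" using m0 by (cases m) auto
    have "\<eta> (r + t) = (\<Sum>q<m. b (r + t * Suc q))" unfolding \<eta>_def by (simp add: algebra_simps)
    also have "\<dots> = (\<Sum>q<m'. b (r + t * Suc q)) + b (r + t * m)" by (simp add: m')
    also have "b (r + t * m) = b (r + t * 0)" using bper by simp
    also have "(\<Sum>q<m'. b (r + t * Suc q)) + b (r + t * 0) = \<eta> r"
      unfolding \<eta>_def m' by (subst sum.lessThan_Suc_shift) (simp add: add.commute)
    finally show ?thesis .
  qed
  have \<eta>F: "\<eta> r \<in> F" for r using \<eta>E pw\<eta>[of t r] \<eta>per by (simp add: F_def \<tau>_def)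
  have sF: "sf F"
  proof (rule sfI)
    show "1 \<in> F" using sf_1[OF E'(2)] emb_1[OF E'(2) \<tau>(1)] by (simp add: F_def)
    fix x assume "x \<in> F"
    then have x: "x \<in> E" "\<tau> x = x" by (auto simp: F_def)
    show "-x \<in> F" using x by (simp add: F_def emb_uminus[OF E'(2) \<tau>(1)] sf_uminus[OF E'(2)])
    { fix y assume "y \<in> F"
      then have y: "y \<in> E" "\<tau> y = y" by (auto simp: F_def)
      show "x + y \<in> F" "x * y \<in> F"
        using x y by (simp_all add: F_def emb_add[OF E'(2) \<tau>(1)] emb_mult[OF E'(2) \<tau>(1)] sf_add[OF E'(2)] sf_mult[OF E'(2)]) }
    assume "x \<noteq> 0"
    have i: "inverse x \<in> E" by (rule sf_inverse[OF E'(2) x(1)])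
    have "\<tau> (x * inverse x) = x * \<tau> (inverse x)" using emb_mult[OF E'(2) \<tau>(1) x(1) i] x by simp
    then have "x * \<tau> (inverse x) = 1" using \<open>x \<noteq> 0\<close> emb_1[OF E'(2) \<tau>(1)] by simp
    then have "\<tau> (inverse x) = inverse x" by (metis inverse_unique)
    with i show "inverse x \<in> F" by (simp add: F_def)
  qed
  have KF: "K \<subseteq> F" using E'(3) pwK by (auto simp: F_def \<tau>_def)
  have indep\<eta>: "\<forall>r<t. c r = 0" if c: "\<And>r. r < t \<Longrightarrow> c r \<in> K" "(\<Sum>r<t. c r * \<eta> r) = 0" for c
  proof -
    have "(\<Sum>i<t * m. c (i mod t) * b i) = (\<Sum>r<t. c r * \<eta> r)"
      unfolding sum_lessThan_mult \<eta>_def sum_distrib_left by (intro sum.cong refl) simp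
    then have "\<forall>i<t * m. c (i mod t) = 0" using c t by (intro indep) auto
    moreover have "t \<le> t * m" using m0 by simp
    ultimately show ?thesis by (metis mod_less order_less_le_trans)
  qed
  have Fbasis: "F = {\<Sum>r<t. c r * \<eta> r | c. \<forall>r<t. c r \<in> K}"
  proof (intro equalityI subsetI)
    fix x assume "x \<in> {\<Sum>r<t. c r * \<eta> r | c. \<forall>r<t. c r \<in> K}"
    then show "x \<in> F" using KF \<eta>F by (auto intro!: sf_sum[OF sF] sf_mult[OF sF])
  next
    fix x assume "x \<in> F"
    then have x: "x \<in> E" "\<tau> x = x" by (auto simp: F_def)
    obtain c0 where c0: "\<forall>i<t * m. c0 i \<in> K" "x = (\<Sum>i<t * m. c0 i * b i)" using x Ebasis by auto
    \<comment> \<open>A periodic continuation that matches \<open>bper\<close>, so that sums over a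
      full period are invariant under shifts.\<close>
    define c where "c i = c0 (i mod (t * m))" for i
    have tm: "t * m > 0" using t m0 by simp
    have cK: "c i \<in> K" for i using c0 tm by (simp add: c_def)
    have cE: "c i \<in> E" for i using cK E'(3) by auto
    have xc: "x = (\<Sum>i<t * m. c i * b i)" unfolding c0(2) c_def by (intro sum.cong refl) simp
    have cper: "c (i + t * m) = c i" for i by (simp add: c_def)
    have shift: "(\<Sum>i<t * m. c (i + n) * b (i + n)) = (\<Sum>i<t * m. c i * b i)" for n
    proof (induction n)
      case (Suc n)
      obtain k where k: "t * m = Suc k" using tm by (cases "t * m") auto
      define f where "f i = c (i + n) * b (i + n)" for i
      have fper: "f (t * m) = f 0" unfolding f_def using cper[of n] bper[of n] by (simp add: add.commute)
      have "(\<Sum>i<t * m. c (i + Suc n) * b (i + Suc n)) = (\<Sum>i<t * m. f (Suc i))" by (simp add: f_def)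
      also have "\<dots> = (\<Sum>i<t * m. f i)" using fper unfolding k
        by (subst (2) sum.lessThan_Suc_shift) (simp add: add.commute)
      finally show ?case using Suc by (simp add: f_def)
    qed simp
    \<comment> \<open>The image of this combination is \<open>\<tau> x - x\<close>, because the
      shifted second half reassembles \<open>x\<close>. So the combination vanishes, and
      independence makes the coefficients periodic modulo \<open>t\<close>.\<close>
    have "\<tau> (\<Sum>i<t * m. (c i - c (i + t)) * b i) = (\<Sum>i<t * m. (c i - c (i + t)) * b (i + t))"
      using cE bE cK
      by (subst emb_sum[OF E'(2) \<tau>(1)])
        (auto simp: emb_mult[OF E'(2) \<tau>(1)] sf_mult[OF E'(2)] sf_diff[OF E'(2)] \<tau>_def pwb pwK sf_diff[OF sK]
          emb_mult[OF E'(2) pw(1)])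
    also have "\<dots> = (\<Sum>i<t * m. c i * b (i + t)) - x"
      using shift[of t] xc by (simp add: left_diff_distrib sum_subtractf)
    also have "(\<Sum>i<t * m. c i * b (i + t)) = \<tau> x"
      unfolding xc using cE bE cK
      by (subst emb_sum[OF E'(2) \<tau>(1)])
        (auto simp: sf_mult[OF E'(2)] \<tau>_def pwb pwK emb_mult[OF E'(2) pw(1)])
    finally have "\<tau> (\<Sum>i<t * m. (c i - c (i + t)) * b i) = 0" using x by simp
    moreover have "(\<Sum>i<t * m. (c i - c (i + t)) * b i) \<in> E"
      by (intro sf_sum[OF E'(2)] sf_mult[OF E'(2)] sf_diff[OF E'(2)] cE bE)
    ultimately have "(\<Sum>i<t * m. (c i - c (i + t)) * b i) = 0"
      using emb_eq_0_iff[OF E'(2) \<tau>(1)] by blast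
    then have z0: "\<forall>i<t * m. c i - c (i + t) = 0" using cK by (intro indep sf_diff[OF sK]) auto
    have step: "c (r + t * q) = c r" if "r < t" "q < m" for r q
      using that(2)
    proof (induction q)
      case (Suc q)
      have "r + t * q < t * Suc q" using that(1) by simp
      also have "\<dots> \<le> t * m" using Suc.prems by (intro mult_le_mono) auto
      finally have "c (r + t * q) = c (r + t * q + t)" using z0 by simp
      with Suc show ?case by (simp add: algebra_simps)
    qed simp
    have "x = (\<Sum>r<t. \<Sum>q<m. c (r + t * q) * b (r + t * q))" unfolding xc by (rule sum_lessThan_mult)
    also have "\<dots> = (\<Sum>r<t. c r * \<eta> r)"
      unfolding \<eta>_def sum_distrib_left by (intro sum.cong refl) (simp add: step)
    finally show "x \<in> {\<Sum>r<t. c r * \<eta> r | c. \<forall>r<t. c r \<in> K}" using cK by blast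
  qed
  have "C.dimension t K F" unfolding Fbasis by (rule dimension_basis[OF sK indep\<eta>])
  note FF = fin_extI[OF sK sF KF this]
  have FE: "F \<subseteq> E" by (auto simp: F_def)
  have pwF: "(\<sigma> ^^ n) x \<in> F" if "x \<in> F" for n x
  proof -
    have x: "x \<in> E" "\<tau> x = x" using that by (auto simp: F_def)
    have "\<tau> ((\<sigma> ^^ n) x) = (\<sigma> ^^ n) (\<tau> x)" unfolding \<tau>_def by (metis add.commute comp_apply funpow_add)
    with x pw(2) show ?thesis by (simp add: F_def)
  qed
  define \<rho> where "\<rho> n = restrict (\<sigma> ^^ n) F" for n
  have \<rho>: "\<rho> n \<in> Aut_over K F" for n
    unfolding \<rho>_def by (rule Aut_over_restrict[OF FF(1) emb_subset[OF pw(1) FE] pwK pwF])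
  have "inj_on \<rho> {..<t}"
  proof (rule inj_onI)
    fix i j assume ij: "i \<in> {..<t}" "j \<in> {..<t}" "\<rho> i = \<rho> j"
    have "\<eta> i = \<eta> j" using arg_cong[OF ij(3), of "\<lambda>f. f (\<eta> 0)"] \<eta>F pw\<eta>[of i 0] pw\<eta>[of j 0] by (simp add: \<rho>_def)
    show "i = j"
    proof (rule ccontr)
      assume ne: "i \<noteq> j"
      define c :: "nat \<Rightarrow> complex" where "c r = (if r = i then 1 else 0) - (if r = j then 1 else 0)" for r
      have "(\<Sum>r<t. c r * \<eta> r) = (\<Sum>r<t. (if r = i then \<eta> r else 0)) - (\<Sum>r<t. (if r = j then \<eta> r else 0))"
        unfolding sum_subtractf[symmetric] by (intro sum.cong refl) (auto simp: c_def)
      also have "\<dots> = 0" using ij \<open>\<eta> i = \<eta> j\<close> by simp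
      finally have "\<forall>r<t. c r = 0" by (intro indep\<eta>) (auto simp: c_def intro!: sf_closed[OF sK])
      then have "c i = 0" using ij by simp
      then show False using ne by (simp add: c_def)
    qed
  qed
  then have "t \<le> card (Aut_over K F)"
    using card_inj_on_le[of \<rho> "{..<t}" "Aut_over K F"] \<rho> card_Aut_over_le(1)[OF FF(1)] by auto
  then have "galois_ext K F" using FF card_Aut_over_le(2)[OF FF(1)] by (simp add: galois_ext_def)
  then show ?thesis using that FF(2) by blast
qed

section \<open>Extensions without Galois subextensions\<close>

text \<open>The trinomial \<open>X\<^sup>m + p l X + p l\<^sup>2\<close> is Eisenstein at \<open>p\<close>. At \<open>l\<close> its Newton polygon has a segment of
  length one, so that a root \<open>\<alpha>\<close> is \<open>l\<close>-adic, and the cofactor of \<open>X - \<alpha>\<close> is Eisenstein at \<open>l\<close>.\<close>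
theorem doubly_transitive_polynomial:
  assumes F: "number_field F" and m: "m \<ge> 3"
  obtains f \<alpha> h where "irr F f" "degree f = m" "poly f \<alpha> = 0" "f = [:-\<alpha>, 1:] * h"
    "irr (adj F \<alpha>) h" "degree h = m - 1"
proof -
  note sF = number_field_sf[OF F]
  obtain p vp where p: "valued_field F p vp" using number_field_valuation[OF F] by metis
  obtain l vl where l: "l > p" "valued_field F l vl" using number_field_valuation[OF F] by metis
  interpret P: valued_field F p vp by fact
  interpret V: valued_field F l vl by fact
  have pl: "\<not> p dvd l" "\<not> l dvd p"
    using P.l V.l l(1) primes_dvd_imp_eq by blast+
  define a :: complex where "a = of_nat (p * l)"
  define f where "f = monom 1 m + [:a * of_nat l, a:]"
  have cf: "coeff f i = (if i = m then 1 else if i = 1 then a else if i = 0 then a * of_nat l else 0)" for i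
    using m by (auto simp: f_def coeff_pCons split: nat.split)
  have polyf: "poly f x = x ^ m + a * x + a * of_nat l" for x by (simp add: f_def poly_monom algebra_simps)
  have df: "degree f = m"
  proof (rule antisym)
    show "degree f \<le> m" by (rule degree_le) (use m in \<open>auto simp: cf\<close>)
    show "m \<le> degree f" by (rule le_degree) (simp add: cf)
  qed
  have a0: "a \<noteq> 0" using prime_gt_0_nat[OF P.l] prime_gt_0_nat[OF V.l] by (simp add: a_def)
  have aF: "a \<in> F" unfolding a_def by (rule sf_of_nat[OF sF])
  have vpl: "vp (of_nat l) = 0" by (rule P.v_of_nat_unit[OF pl(1)])
  have vpa: "vp a = 1" unfolding a_def of_nat_mult
    using P.v_mult[of "of_nat p" "of_nat l"] a0 vpl P.v_prime by (auto simp: a_def sf_of_nat[OF sF])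
  have vpal: "vp (a * of_nat l) = 1" using P.v_mult[OF aF sf_of_nat[OF sF] a0, of l] a0 vpa vpl by (auto simp: a_def)
  have irrf: "irr F f"
  proof (rule P.Eisenstein)
    show "f \<in> polys F" using aF by (auto intro!: polysI sf_closed[OF sF] simp: cf)
    show "lead_coeff f = 1" "degree f > 0" using m by (auto simp: df cf)
    show "coeff f 0 \<noteq> 0" "vp (coeff f 0) = 1" using m a0 vpal by (auto simp: cf a_def)
    show "vge vp 1 (coeff f i)" if "i < degree f" for i
      using that vpa vpal by (auto simp: df cf vge_def)
  qed
  obtain \<alpha> where \<alpha>: "poly f \<alpha> = 0" using exists_root[of f] df m by auto
  have aa: "alg F \<alpha>" by (rule irr_alg[OF irrf \<alpha>])
  define L where "L = adj F \<alpha>"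
  have sL: "sf L" unfolding L_def by (rule adj_sf[OF sF aa])
  have FL: "F \<subseteq> L" and \<alpha>L: "\<alpha> \<in> L" unfolding L_def using adj_base[OF sF] adj_gen[OF sF] by auto
  have l0: "(of_nat l :: complex) \<noteq> 0" using prime_gt_0_nat[OF V.l] by simp
  define \<beta> where "\<beta> = \<alpha> / of_nat l"
  have \<alpha>\<beta>: "\<alpha> = of_nat l * \<beta>" using l0 by (simp add: \<beta>_def)
  have \<beta>L: "\<beta> \<in> L" unfolding \<beta>_def by (intro sf_divide[OF sL] \<alpha>L sf_of_nat[OF sL])
  have dL: "fin_ext F L" "ext_degree F L = m" unfolding L_def using adj_fin_ext[OF sF irrf \<alpha>] df by auto
  have a\<beta>: "alg F \<beta>" by (rule fin_ext_alg[OF dL(1) \<beta>L])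
  have L\<beta>: "adj F \<beta> = L"
  proof
    show "adj F \<beta> \<subseteq> L" by (rule adj_least[OF sL FL \<beta>L])
    show "L \<subseteq> adj F \<beta>" unfolding L_def
      by (rule adj_least[OF adj_sf[OF sF a\<beta>] adj_base[OF sF]])
        (auto simp: \<alpha>\<beta> intro!: sf_mult[OF adj_sf[OF sF a\<beta>]] sf_of_nat[OF adj_sf[OF sF a\<beta>]] adj_gen[OF sF])
  qed
  define k where "k = m - 2"
  have mk: "m = Suc (Suc k)" "k > 0" using m by (auto simp: k_def)
  \<comment> \<open>This is f(l X) / l^2. Since m > 2, modulo \<open>l\<close> it is p (X + 1), with
    the simple root -1; dividing \<open>\<alpha>\<close> by \<open>l\<close> has turned the segment
    of length one into a unit root.\<close>
  define h where "h = monom (int l ^ k) m + [:int p, int p:]"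
  have ch: "coeff h i = (if i = m then int l ^ k else if i = 1 \<or> i = 0 then int p else 0)" for i
    using m by (auto simp: h_def coeff_pCons split: nat.split)
  have polyh: "poly (ipoly h) x = of_nat l ^ k * x ^ m + of_nat p * x + of_nat p" for x
  proof -
    have "ipoly h = monom (of_nat l ^ k) m + [:of_nat p, of_nat p:]"
      by (rule poly_eqI) (auto simp: h_def coeff_ipoly coeff_pCons split: nat.split)
    then show ?thesis by (simp add: poly_monom algebra_simps)
  qed
  \<comment> \<open>\<open>h\<close> needs no irreducibility proof of its own:
    \<open>\<beta>\<close> generates \<open>L\<close>, so its minimal polynomial has degree
    \<open>m\<close> and equals \<open>h\<close> up to a constant.\<close>
  obtain g where g: "irr F g" "poly g \<beta> = 0" using minpoly_exists[OF sF a\<beta>] .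
  have dg: "degree g = m" using adj_fin_ext(2)[OF sF g] L\<beta> dL by simp
  have "poly (ipoly h) \<beta> = 0"
  proof -
    have "of_nat l ^ 2 * poly (ipoly h) \<beta> = poly f \<alpha>"
      unfolding polyh polyf \<alpha>\<beta> a_def mk(1) by (simp add: power_mult_distrib power2_eq_square algebra_simps)
    then show ?thesis using \<alpha> l0 by simp
  qed
  then have "g dvd ipoly h" using irr_root_dvd[OF sF g] ipoly_polys polys_mono[OF Rats_subset_subfield[OF sF]] by blast
  then obtain s where s: "ipoly h = g * s" by (auto elim: dvdE)
  have dh: "degree (ipoly h) \<le> m" by (rule degree_le) (use m in \<open>auto simp: coeff_ipoly ch\<close>)
  have h0: "ipoly h \<noteq> 0"
  proof
    assume "ipoly h = 0"
    then have "coeff (ipoly h) m = 0" by simp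
    then show False using l0 by (simp add: coeff_ipoly ch)
  qed
  have "degree s = 0" using s dh dg h0 by (auto simp: degree_mult_eq)
  then obtain c where c: "s = [:c:]" by (rule degree_eq_zeroE)
  have c0: "c \<noteq> 0" using s c h0 by auto
  have gh: "g = smult (inverse c) (ipoly h)" unfolding s c using c0 by simp
  have h1: "int l dvd poly h (-1)" using mk by (simp add: h_def poly_monom)
  have h2: "\<not> int l dvd poly (pderiv h) (-1)"
  proof -
    have "poly (pderiv h) (-1) = int l * (int m * int l ^ (k - 1) * (-1) ^ (m - 1)) + int p"
      using mk by (simp add: h_def pderiv_add pderiv_monom poly_monom pderiv_pCons power_eq_if[of _ k])
    moreover have "\<not> int l dvd int p" using pl by simp
    ultimately show ?thesis by (metis dvd_add_right_iff dvd_triv_left)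
  qed
  from V.valuation_extension_hensel[OF g gh h1 h2] obtain v where v: "valued_field L l v" "vge v 0 \<beta>"
    unfolding L\<beta> by metis
  interpret W: valued_field L l v by (rule v(1))
  have v\<alpha>: "vge v 1 \<alpha>" unfolding \<alpha>\<beta>
    by (rule W.vge_mult'[OF sf_of_nat[OF sL] \<beta>L _ v(2), where j = 1]) (auto simp: vge_def W.v_prime)
  have va: "v a = 1" unfolding a_def of_nat_mult
    using W.v_mult[of "of_nat p" "of_nat l"] a0 W.v_of_nat_unit[OF pl(2)] W.v_prime
    by (auto simp: a_def sf_of_nat[OF sL])
  have aL: "a \<in> L" using aF FL by auto
  \<comment> \<open>The cofactor is (X^m - \<alpha>^m) / (X - \<alpha>) + a. Its constant term a +
    \<alpha>^(m-1) has valuation 1, because \<open>a\<close> has valuation 1 and m - 1 >= 2.\<close>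
  define r where "r = (\<Sum>i<m. monom (\<alpha> ^ (m - Suc i)) i) + [:a:]"
  have cr: "coeff r i = (if i < m then \<alpha> ^ (m - Suc i) else 0) + (if i = 0 then a else 0)" for i
    by (auto simp: r_def coeff_sum coeff_pCons split: nat.split)
  have dr: "degree r = m - 1"
  proof (rule antisym)
    show "degree r \<le> m - 1" by (rule degree_le) (use m in \<open>auto simp: cr\<close>)
    show "m - 1 \<le> degree r" by (rule le_degree) (use m in \<open>simp add: cr\<close>)
  qed
  have fr: "f = [:-\<alpha>, 1:] * r"
  proof (rule poly_eq_poly_eq_iff[THEN iffD1], rule ext)
    fix x
    have 0: "\<alpha> ^ m + a * \<alpha> + a * of_nat l = 0" using \<alpha> by (simp add: polyf)
    then have e: "\<alpha> ^ m = - (a * \<alpha> + a * of_nat l)" by (simp only: eq_neg_iff_add_eq_0 add.assoc)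
    have "poly ([:-\<alpha>, 1:] * r) x = (x - \<alpha>) * (\<Sum>i<m. \<alpha> ^ (m - Suc i) * x ^ i) + (x - \<alpha>) * a"
      by (simp add: r_def poly_sum poly_monom algebra_simps)
    also have "(x - \<alpha>) * (\<Sum>i<m. \<alpha> ^ (m - Suc i) * x ^ i) = x ^ m - \<alpha> ^ m" by (rule power_diff_sumr2[symmetric])
    finally show "poly f x = poly ([:-\<alpha>, 1:] * r) x"
      unfolding polyf e by (simp add: algebra_simps)
  qed
  have v\<alpha>n: "vge v (int n) (\<alpha> ^ n)" for n using W.vge_power[OF \<alpha>L v\<alpha>, of n] by simp
  have r0: "coeff r 0 = a + \<alpha> ^ (m - 1)" using m by (simp add: cr)
  have vr0: "coeff r 0 \<noteq> 0" "v (coeff r 0) = 1"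
  proof -
    have "vge v (v a + 1) (\<alpha> ^ (m - 1))" unfolding va by (rule W.vge_mono[OF v\<alpha>n]) (use m in simp)
    from W.v_add_eq[OF aL sf_power[OF sL \<alpha>L] a0 this] show "coeff r 0 \<noteq> 0" "v (coeff r 0) = 1"
      unfolding r0 va by auto
  qed
  have "irr L r"
  proof (rule W.Eisenstein)
    show "r \<in> polys L" using aL \<alpha>L by (auto intro!: polysI sf_closed[OF sL] simp: cr)
    show "lead_coeff r = 1" "degree r > 0" using m by (auto simp: dr cr)
    show "coeff r 0 \<noteq> 0" "v (coeff r 0) = 1" by fact+
    show "vge v 1 (coeff r i)" if "i < degree r" for i
    proof (cases "i = 0")
      case True
      then show ?thesis using vr0 by (simp add: vge_def)
    next
      case False
      have "vge v 1 (\<alpha> ^ (m - Suc i))" by (rule W.vge_mono[OF v\<alpha>n]) (use that dr in simp)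
      then show ?thesis using False that dr by (simp add: cr)
    qed
  qed
  then show ?thesis using that[OF irrf df \<alpha> fr] dr by (simp add: L_def)
qed

lemma adj_sqrt_elem:
  assumes F: "sf F" and a: "\<alpha> ^ 2 = \<delta>" "\<delta> \<in> F" and x: "x \<in> adj F \<alpha>"
  obtains a b where "a \<in> F" "b \<in> F" "x = a + b * \<alpha>"
proof -
  obtain q where q: "q \<in> polys F" "x = poly q \<alpha>" using x by (rule adjE)
  have "\<exists>a\<in>F. \<exists>b\<in>F. poly q \<alpha> = a + b * \<alpha>" using q(1)
  proof (induction q)
    case (pCons c q)
    then obtain a b where ab: "a \<in> F" "b \<in> F" "poly q \<alpha> = a + b * \<alpha>" "c \<in> F" by (auto simp: pCons_in_polys_iff)
    have "poly (pCons c q) \<alpha> = (c + b * \<delta>) + a * \<alpha>" using ab a(1) by (simp add: algebra_simps power2_eq_square)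
    then show ?case using ab a(2) by (intro bexI[of _ "c + b * \<delta>"] bexI[of _ a]) (auto intro!: sf_closed[OF F])
  next
    case 0
    show ?case by (intro bexI[of _ 0]) (auto simp: sf_0[OF F])
  qed
  with q that show ?thesis by auto
qed

text \<open>The valuation of \<open>\<delta>\<close> is odd and that of its conjugate \<open>\<sigma>(\<delta>)\<close> is even.\<close>
theorem non_normal_quadratic:
  assumes K: "number_field K" and F: "galois_ext K F" "ext_degree K F \<ge> 2"
  obtains \<alpha> where "ext_degree F (adj F \<alpha>) = 2" "fin_ext F (adj F \<alpha>)"
    "\<And>M. galois_ext K M \<Longrightarrow> M \<subseteq> adj F \<alpha> \<Longrightarrow> M \<subseteq> F"
proof -
  have KF: "fin_ext K F" and card: "card (Aut_over K F) = ext_degree K F" using F by (auto simp: galois_ext_def)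
  have nF: "number_field F" by (rule number_field_ext[OF K KF])
  note sF = number_field_sf[OF nF]
  obtain \<sigma> where \<sigma>': "\<sigma> \<in> Aut_over K F" "\<sigma> \<noteq> restrict (\<lambda>x. x) F"
  proof (rule ccontr)
    assume "\<not> thesis"
    then have "Aut_over K F \<subseteq> {restrict (\<lambda>x. x) F}" using that by blast
    then have "card (Aut_over K F) \<le> 1" using card_mono[of "{restrict (\<lambda>x. x) F}"] by fastforce
    then show False using card F by simp
  qed
  note \<sigma> = Aut_overD[OF \<sigma>'(1)]
  have "\<exists>\<theta>\<in>F. \<sigma> \<theta> \<noteq> \<theta>"
  proof (rule ccontr)
    assume "\<not> ?thesis"
    then have "\<sigma> = restrict (\<lambda>x. x) F" using \<sigma>(5) by (intro extensionalityI[of _ F]) auto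
    with \<sigma>'(2) show False by simp
  qed
  then obtain \<theta> where \<theta>: "\<theta> \<in> F" "\<sigma> \<theta> - \<theta> \<noteq> 0" by auto
  have \<sigma>\<theta>: "\<sigma> \<theta> - \<theta> \<in> F" by (intro sf_diff[OF sF] \<sigma>(2) \<theta>)
  \<comment> \<open>For large \<open>l\<close> the element \<open>\<theta>\<close> is integral and
    \<open>\<sigma> \<theta> - \<theta>\<close> is a unit. So if
    \<open>\<delta> = \<theta> - c\<close> has valuation 1, its conjugate, which is
    \<open>\<delta>\<close> plus this unit, has valuation 0.\<close>
  obtain B1 where B1: "\<And>l v. l > B1 \<Longrightarrow> valued_field F l v \<Longrightarrow> vge v 0 \<theta>"
    using large_prime_integral[OF nF \<theta>(1)] by blast
  obtain B2 where B2: "\<And>l v. l > B2 \<Longrightarrow> valued_field F l v \<Longrightarrow> v (\<sigma> \<theta> - \<theta>) = 0"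
    using large_prime_unit[OF nF \<sigma>\<theta> \<theta>(2)] by blast
  obtain l v where l: "l > max B1 B2" "valued_field F l v"
    "\<And>x. x \<in> F \<Longrightarrow> vge v 0 x \<Longrightarrow> \<exists>c :: int. vge v 1 (x - of_int c)"
    using number_field_valuation[OF nF] by metis
  interpret V: valued_field F l v by fact
  obtain c0 :: int where c0: "vge v 1 (\<theta> - of_int c0)" using l(3)[OF \<theta>(1)] B1[OF _ l(2)] l(1) by auto
  \<comment> \<open>If \<open>\<theta> - c0\<close> has valuation at least 2, replacing
    \<open>c0\<close> by \<open>c0 + l\<close> brings it down to exactly 1.\<close>
  have "\<exists>c :: int. \<theta> - of_int c \<noteq> 0 \<and> v (\<theta> - of_int c) = 1"
  proof (cases "vge v 2 (\<theta> - of_int c0)")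
    case False
    then show ?thesis using c0 by (intro exI[of _ c0]) (auto simp: vge_def)
  next
    case True
    have "v (- of_nat l) = 1" using V.v_uminus[OF V.l_in_F] V.v_prime by simp
    with V.v_add_eq[of "- of_nat l" "\<theta> - of_int c0"] True \<theta>(1) prime_gt_0_nat[OF V.l]
    have "- of_nat l + (\<theta> - of_int c0) \<noteq> 0" "v (- of_nat l + (\<theta> - of_int c0)) = 1"
      by (auto simp: sf_closed[OF sF])
    then show ?thesis by (intro exI[of _ "c0 + int l"]) (simp add: algebra_simps)
  qed
  then obtain c :: int where c: "\<theta> - of_int c \<noteq> 0" "v (\<theta> - of_int c) = 1" by blast
  define \<delta> where "\<delta> = \<theta> - of_int c"
  have cF: "of_int c \<in> F" by (rule sf_of_int[OF sF])
  have \<delta>: "\<delta> \<in> F" "\<delta> \<noteq> 0" "v \<delta> = 1" unfolding \<delta>_def using c by (auto intro!: sf_diff[OF sF] \<theta> cF)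
  have \<sigma>c: "\<sigma> (of_int c) = of_int c" using \<sigma>(3) sf_of_int[OF fin_extD(1)[OF KF]] by blast
  have "\<sigma> \<delta> = (\<sigma> \<theta> - \<theta>) + \<delta>" unfolding \<delta>_def using emb_diff[OF sF \<sigma>(1) \<theta>(1) cF] \<sigma>c by simp
  moreover have "v (\<sigma> \<theta> - \<theta>) = 0" using B2[OF _ l(2)] l(1) by simp
  ultimately have \<sigma>\<delta>: "\<sigma> \<delta> \<noteq> 0" "v (\<sigma> \<delta>) = 0"
    using V.v_add_eq[OF \<sigma>\<theta> \<delta>(1) \<theta>(2)] \<delta>(3) by (auto simp: vge_def)
  define \<alpha> where "\<alpha> = csqrt \<delta>"
  define e where "e = csqrt (\<sigma> \<delta>)"
  have \<alpha>: "\<alpha> ^ 2 = \<delta>" and e: "e ^ 2 = \<sigma> \<delta>" by (auto simp: \<alpha>_def e_def)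
  have sq: "even (v (x ^ 2))" if "x \<in> F" "x \<noteq> 0" for x using V.v_power[OF that, of 2] by simp
  have nsq: "x ^ 2 \<noteq> \<delta>" if "x \<in> F" for x using sq[OF that] \<delta> by auto
  have \<alpha>F: "\<alpha> \<notin> F" using nsq \<alpha> by blast
  have eL: "e \<notin> adj F \<alpha>"
  proof
    assume "e \<in> adj F \<alpha>"
    then obtain a b where ab: "a \<in> F" "b \<in> F" "e = a + b * \<alpha>" by (rule adj_sqrt_elem[OF sF \<alpha> \<delta>(1)])
    have "\<sigma> \<delta> = (a + b * \<alpha>) ^ 2" using e ab(3) by simp
    also have "\<dots> = a ^ 2 + b ^ 2 * \<alpha> ^ 2 + 2 * a * b * \<alpha>" by (simp add: power2_eq_square algebra_simps)
    finally have eq: "\<sigma> \<delta> = a ^ 2 + b ^ 2 * \<delta> + 2 * a * b * \<alpha>" unfolding \<alpha> .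
    \<comment> \<open>Otherwise the cross term could be solved for \<open>\<alpha>\<close>, which is
      not in \<open>F\<close>.\<close>
    have "a * b = 0"
    proof (rule ccontr)
      assume "a * b \<noteq> 0"
      then have "\<alpha> = (\<sigma> \<delta> - a ^ 2 - b ^ 2 * \<delta>) / (2 * a * b)" unfolding eq by simp
      also have "\<dots> \<in> F" using ab \<sigma>(2)[OF \<delta>(1)] \<delta>(1)
        by (intro sf_divide[OF sF] sf_diff[OF sF] sf_mult[OF sF] sf_power[OF sF] sf_numeral[OF sF])
      finally show False using \<alpha>F by simp
    qed
    then consider "a = 0" | "b = 0" by auto
    then show False
    proof cases
      case 1
      then have "\<sigma> \<delta> = b ^ 2 * \<delta>" using eq by simp
      moreover from this have "b \<noteq> 0" using \<sigma>\<delta>(1) by auto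
      ultimately have "0 = v (b ^ 2) + 1" using \<sigma>\<delta>(2) \<delta> ab V.v_mult[of "b ^ 2" \<delta>] by (simp add: sf_power[OF sF])
      moreover have "even (v (b ^ 2))" by (rule sq) fact+
      ultimately show False by presburger
    next
      \<comment> \<open>Parity gives nothing directly, as \<open>\<sigma> \<delta>\<close> has even
        valuation. Pulling \<open>a\<close> back along the automorphism makes
        \<open>\<delta>\<close> itself a square in \<open>F\<close>, against its odd
        valuation.\<close>
      case 2
      then have "\<sigma> \<delta> = a ^ 2" using eq by simp
      obtain a' where a': "a' \<in> F" "a = \<sigma> a'" using \<sigma>(4) ab(1) by (auto simp: bij_betw_def)
      have "\<sigma> (a' ^ 2) = \<sigma> \<delta>" using emb_power[OF sF \<sigma>(1) a'(1)] a'(2) \<open>\<sigma> \<delta> = a ^ 2\<close> by simp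
      then have "a' ^ 2 = \<delta>"
        using inj_onD[OF emb_inj[OF sF \<sigma>(1)]] sf_power[OF sF a'(1)] \<delta>(1) by blast
      then show False using nsq[OF a'(1)] by simp
    qed
  qed
  note q = irr_quadratic[OF sF \<alpha> \<delta>(1) \<alpha>F]
  have q0: "poly [:-\<delta>, 0, 1:] \<alpha> = 0" using \<alpha> by (simp add: power2_eq_square)
  show ?thesis
  proof (rule that)
    show "ext_degree F (adj F \<alpha>) = 2" "fin_ext F (adj F \<alpha>)" using adj_fin_ext[OF sF q q0] by simp_all
    show "M \<subseteq> F" if "galois_ext K M" "M \<subseteq> adj F \<alpha>" for M
      by (rule galois_subext_quadratic[OF KF \<alpha> \<delta>(1) \<alpha>F \<sigma>(1,3,2) e eL that])
  qed
qed

section \<open>From the tower over K to the ascending index\<close>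

lemma ascending_index_eqI:
  assumes L: "fin_ext K L" and F: "galois_ext K F" "F \<subseteq> L"
    and max: "\<And>M. galois_ext K M \<Longrightarrow> M \<subseteq> L \<Longrightarrow> M \<subseteq> F"
  shows "ascending_index K L = ext_degree K F"
proof -
  have fin: "fin_ext K M" if "galois_ext K M" for M using that by (simp add: galois_ext_def)
  have le: "ext_degree K M \<le> ext_degree K F" if "galois_ext K M" "M \<subseteq> L" for M
    using ext_degree_mono(1)[OF fin[OF that(1)] fin[OF F(1)] max[OF that]] .
  show ?thesis unfolding ascending_index_def
  proof (rule Max_eqI)
    \<comment> \<open>\<open>Max\<close> is only meaningful on a finite set; the bound that makes
      \<open>F\<close> maximal also bounds all degrees.\<close>
    show "finite {ext_degree K M | M. K \<subseteq> M \<and> M \<subseteq> L \<and> galois_ext K M}"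
      by (rule finite_subset[of _ "{..ext_degree K F}"]) (auto intro: le)
    show "ext_degree K F \<in> {ext_degree K M | M. K \<subseteq> M \<and> M \<subseteq> L \<and> galois_ext K M}"
      using F fin_extD(3)[OF fin[OF F(1)]] by blast
  qed (auto intro: le)
qed

theorem theorem9p5:
  fixes K :: "complex set" and n t :: nat
  assumes "number_field K" and "n > 2" and "t > 0" and "t dvd n"
  shows "\<exists>L. fin_ext K L \<and> ext_degree K L = n \<and> ascending_index K L = t"
proof -
  obtain F where F: "galois_ext K F" "ext_degree K F = t" using cyclic_extension[OF assms(1,3)] .
  have KF: "fin_ext K F" using F(1) by (simp add: galois_ext_def)
  have nF: "number_field F" by (rule number_field_ext[OF assms(1) KF])
  obtain m where m: "n = t * m" using assms(4) by (auto elim: dvdE)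
  have "m \<noteq> 0" using m assms(2) by (metis mult_0_right not_less_zero)
  have "\<exists>L. fin_ext F L \<and> ext_degree F L = m \<and> (\<forall>M. galois_ext K M \<longrightarrow> M \<subseteq> L \<longrightarrow> M \<subseteq> F)"
  proof -
    consider "m = 1" | "m = 2" | "m \<ge> 3" using \<open>m \<noteq> 0\<close> by linarith
    then show ?thesis
    proof cases
      case 1
      then show ?thesis using fin_ext_refl[OF number_field_sf[OF nF]] by auto
    next
      case 2
      \<comment> \<open>Here n = 2 t, so n > 2 gives t >= 2 and hence a nontrivial automorphism of
        \<open>F\<close> over \<open>K\<close>.\<close>
      then have "ext_degree K F \<ge> 2" using m assms(2) F(2) by auto
      from non_normal_quadratic[OF assms(1) F(1) this] 2 show ?thesis by metis
    next
      case 3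
      obtain f \<alpha> h where f: "irr F f" "degree f = m" "poly f \<alpha> = 0" "f = [:-\<alpha>, 1:] * h"
        "irr (adj F \<alpha>) h" "degree h = m - 1" using doubly_transitive_polynomial[OF nF 3] .
      have dh: "degree h > 1" using f(6) 3 by simp
      show ?thesis
      proof (intro exI[of _ "adj F \<alpha>"] conjI allI impI)
        show "fin_ext F (adj F \<alpha>)" "ext_degree F (adj F \<alpha>) = m"
          using adj_fin_ext[OF number_field_sf[OF nF] f(1,3)] f(2) by auto
        show "M \<subseteq> F" if "galois_ext K M" "M \<subseteq> adj F \<alpha>" for M
          by (rule galois_subext_doubly_transitive[OF KF f(1,3,4,5) dh that])
      qed
    qed
  qed
  then obtain L where L: "fin_ext F L" "ext_degree F L = m"
    "\<And>M. galois_ext K M \<Longrightarrow> M \<subseteq> L \<Longrightarrow> M \<subseteq> F" by blast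
  have "fin_ext K L" "ext_degree K L = n" using fin_ext_tower[OF KF L(1)] L(2) F(2) m by auto
  moreover have "ascending_index K L = t"
    using ascending_index_eqI[OF \<open>fin_ext K L\<close> F(1) fin_extD(3)[OF L(1)] L(3)] F(2) by simp
  ultimately show ?thesis by blast
qed

end
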